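(* Let $d\geq 2$ be an integer, let $c_1,\dots,c_s\in\mathbb{Z}$, and let $G=\langle x^d+c_1,\dots,x^d+c_s\rangle$ be the semigroup generated by these polynomials under composition. Assume that $G$ contains a polynomial that is irreducible over $\mathbb{Q}$. Then one of the following statements must hold: (1) There exists $F\in G$ with $\ell(F)\leq 6$ such that $\{F\circ g: g\in G\}$ is a set of irreducible polynomials over $\mathbb{Q}$. (2) $d\geq 4$ is even and $\{c_1,\dots,c_s\}\subseteq\{y^p-y^{pd},\; y^p,\; -y^p,\; -y^p-y^{pd}\}$ for some $y\in\mathbb{Z}$ and some prime $p\mid d$. (3) $d\geq 5$ is odd and $\{c_1,\dots,c_s\}=\{y^p-y^{pd},\; y^p\}$ for some $y\in\mathbb{Z}$ and some prime $p\mid d$.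
   Context: For polynomials $f_1,\dots,f_s$, $\langle f_1,\dots,f_s\rangle$ denotes the set of all finite nonempty compositions of the $f_i$ (with repetition allowed). The length $\ell(F)$ of $F\in G$ is the integer $n\geq 1$ such that $F=\theta_1\circ\cdots\circ\theta_n$ with each $\theta_i$ of the form $x^d+b_i$; it is well defined since then $\deg F=d^n$. *)

theory Defs
  imports "HOL-Computational_Algebra.Computational_Algebra"
begin

definition unicritical :: "nat \<Rightarrow> 'a::comm_semiring_1 \<Rightarrow> 'a poly"
  where "unicritical d c = monom 1 d + [:c:]"

text \<open>\<open>compose_list [f\<^sub>1, \<dots>, f\<^sub>n]\<close> is \<open>f\<^sub>1 \<circ> \<dots> \<circ> f\<^sub>n\<close>; the empty composition is the
  polynomial \<open>x\<close>.\<close>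

definition compose_list :: "'a::comm_semiring_1 poly list \<Rightarrow> 'a poly"
  where "compose_list fs = foldr pcompose fs [:0, 1:]"

text \<open>Only nonempty compositions are allowed, so the semigroup need not contain \<open>x\<close>.\<close>

definition comp_semigroup :: "'a::comm_semiring_1 poly set \<Rightarrow> 'a poly set"
  where "comp_semigroup S = {compose_list fs | fs. fs \<noteq> [] \<and> set fs \<subseteq> S}"

text \<open>The description is meaningful only if \<open>d \<ge> 2\<close> and \<open>F\<close> is a nonempty composition of
  polynomials \<open>x\<^sup>d + b\<close>; see \<open>comp_length_compose_list\<close>.\<close>

definition comp_length :: "nat \<Rightarrow> 'a::comm_semiring_1 poly \<Rightarrow> nat"
  where "comp_length d F =
    (THE n. n \<ge> 1 \<and> (\<exists>bs. length bs = n \<and> F = compose_list (map (unicritical d) bs)))"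

lemma degree_unicritical: "degree (unicritical d (c :: 'a::comm_semiring_1)) = d"
proof (cases "d = 0")
  case True
  then show ?thesis by (simp add: unicritical_def monom_0)
next
  case False
  then have "degree [:c:] < degree (monom (1::'a) d)" by (simp add: degree_monom_eq)
  then show ?thesis by (simp add: unicritical_def degree_add_eq_left degree_monom_eq)
qed

lemma degree_compose_unicritical:
  "degree (compose_list (map (unicritical d) (bs :: 'a::idom list))) = d ^ length bs"
  by (induction bs) (simp_all add: compose_list_def degree_pcompose degree_unicritical)

lemma comp_length_compose_list:
  fixes bs :: "'a::idom list"
  assumes "d \<ge> 2" and "bs \<noteq> []"
  shows "comp_length d (compose_list (map (unicritical d) bs)) = length bs"
  unfolding comp_length_def
proof (rule the_equality)
  show "length bs \<ge> 1 \<and> (\<exists>bs'. length bs' = length bs \<and>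
      compose_list (map (unicritical d) bs) = compose_list (map (unicritical d) bs'))"
    using assms(2) by (auto simp: Suc_le_eq)
next
  fix n assume "n \<ge> 1 \<and> (\<exists>bs'. length bs' = n \<and>
      compose_list (map (unicritical d) bs) = compose_list (map (unicritical d) bs'))"
  then have "d ^ length bs = d ^ n"
    by (metis degree_compose_unicritical)
  then show "n = length bs"
    using assms(1) by simp
qed

end

theory Submission
  imports Defs "HOL-Computational_Algebra.Field_as_Ring" "Jordan_Normal_Form.Char_Poly"
begin

text \<open>
Write \<open>f\<^sub>b = x\<^sup>d + b\<close> and call an integer a \<^emph>\<open>root power\<close> if it is a \<open>p\<close>-th power for some prime \<open>p\<close>
dividing \<open>d\<close> (\<open>has_prime_root\<close>). The link between irreducibility and arithmetic is a norm argument: if \<open>F\<close> is an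
irreducible composition of the generators and \<open>F \<circ> f\<^sub>b\<close> is reducible, then \<open>F(b)\<close> is a root power
(\<open>irreducible_word_snoc\<close>). So \<open>F\<close> has all its extensions \<open>F \<circ> g\<close> irreducible as soon as \<open>F\<close> takes no
root power as value at an integer, and the irreducibility of \<open>F\<close> itself is obtained one factor at a
time from the same criterion. If the semigroup contains an irreducible polynomial, its outermost
factor \<open>f\<^sub>c\<close> is irreducible, so \<open>-c\<close> is not a root power and in particular \<open>c \<noteq> 0, -1\<close>. It remains
to find a short word without root powers among its values.

\<^bold>\<open>Degree at least three.\<close> Distinct \<open>p\<close>-th powers are far apart, so \<open>u\<^sup>d + c = z\<^sup>p\<close> forces
\<open>u\<^sup>2 \<le> \<bar>c\<bar>\<close>. Suppose that \<open>f\<^sub>c\<^sup>3\<close> takes a root power at \<open>w\<close>, and let \<open>v = f\<^sub>c(w)\<close>, \<open>u = f\<^sub>c(v)\<close>. Then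
\<open>w\<^sup>d - v\<^sup>d = v - u\<close>, and comparing sizes gives \<open>w\<^sup>d = v\<^sup>d\<close>: the point \<open>v\<close> is fixed by \<open>f\<^sub>c\<close> and is itself a
root power, \<open>v = y\<^sup>p\<close> and \<open>c = y\<^sup>p - y\<^sup>p\<^sup>d\<close> (\<open>third_iterate_power_imp_fixed_point\<close>). Otherwise
\<open>f\<^sub>c\<^sup>3\<close> is the required word. In the remaining case \<open>f\<^sub>c\<^sup>3\<close> takes root powers only at the integers \<open>w\<close>
with \<open>w\<^sup>d = v\<^sup>d\<close>, and for a generator \<open>f\<^sub>b\<close> that is not on the list of the theorem one of
\<open>f\<^sub>c\<^sup>3 \<circ> f\<^sub>b \<circ> f\<^sub>b\<close> and \<open>f\<^sub>c\<^sup>3 \<circ> f\<^sub>b \<circ> f\<^sub>c\<close> never meets these \<open>w\<close> (\<open>never_power_extension_off_list\<close>). For odd \<open>d\<close>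
the list has two members; if only \<open>f\<^sub>c\<close> occurs, all its iterates are irreducible because the orbit
of \<open>0\<close> grows.

\<^bold>\<open>Degree three\<close> is not an exception: there \<open>f\<^sub>c \<circ> f\<^sub>v\<close> is irreducible. A factorization would make
\<open>\<alpha> - y\<^sup>3\<close> a cube in the cubic field generated by a root \<open>\<alpha>\<close> of \<open>f\<^sub>c\<close>. Comparing characteristic
polynomials turns this into a binary cubic form being a cube, and that equation maps to the Fermat
cubic (\<open>cubic_form_eq_cube\<close>), whose trivial points give only \<open>y \<in> {0, 1, -1}\<close>.

\<^bold>\<open>Degree two.\<close> If \<open>c > 0\<close> then \<open>f\<^sub>c\<^sup>2\<close> works. For \<open>c = -m\<close> with \<open>m \<ge> 2\<close> the bound
\<open>2\<bar>u\<bar> - 1 \<le> m\<close> is weaker, and besides the fixed point, \<open>m = y\<^sup>4 - y\<^sup>2\<close>, also a cycle of length two,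
\<open>m = k\<^sup>4 + k\<^sup>2 + 1\<close>, leads to square values after four iterations (\<open>fourth_iterate_square\<close>). In these cases a second
generator \<open>f\<^sub>b\<close>, followed by \<open>f\<^sub>b\<close> or \<open>f\<^sub>c\<close>, avoids the integers that an iterate of \<open>f\<^sub>c\<close> maps to squares,
unless \<open>b\<close> lies in a short explicit list (\<open>extension_candidates\<close>); and the members of the list are not
of the two special forms, so that \<open>f\<^sub>b\<^sup>4\<close> works. The single exception is \<open>x\<^sup>2 - y\<^sup>2\<close> beside \<open>x\<^sup>2 + y\<^sup>2 - y\<^sup>4\<close>, where
\<open>f\<^sub>c\<^sup>2 \<circ> (x\<^sup>2 - y\<^sup>2)\<close> is shown to be irreducible by hand (\<open>irreducible_fixed_fixed_zero\<close>).
\<close>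

section \<open>Gaps between powers of integers\<close>

lemma power_eq_imp_abs_eq:
  fixes x y :: "'a::linordered_idom"
  assumes "x ^ n = y ^ n" "n > 0"
  shows "\<bar>x\<bar> = \<bar>y\<bar>"
proof -
  have "\<bar>x\<bar> ^ n = \<bar>y\<bar> ^ n" using assms(1) by (metis power_abs)
  then show ?thesis using assms(2) by (simp add: power_eq_iff_eq_base)
qed

lemma odd_power_inject:
  fixes x y :: "'a::linordered_idom"
  assumes "x ^ n = y ^ n" "odd n"
  shows "x = y"
proof -
  have "n > 0" using assms(2) by (auto intro: Nat.gr0I)
  then have "x = y \<or> x = - y"
    using power_eq_imp_abs_eq[OF assms(1)] by (auto simp: abs_eq_iff)
  then show ?thesis using assms \<open>n > 0\<close> by auto
qed

text \<open>The extreme case is \<open>\<bar>x\<bar> = \<bar>y\<bar> - 1\<close>, where \<open>(Y - 1)\<^sup>n \<le> Y\<^sup>n\<^sup>-\<^sup>2 (Y - 1)\<^sup>2\<close> with \<open>Y = \<bar>y\<bar>\<close>. The bound is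
what remains of \<open>Y\<^sup>n - (Y - 1)\<^sup>n\<close> after this estimate.\<close>

lemma power_gap:
  fixes x y :: int
  assumes "n \<ge> 2" "x ^ n \<noteq> y ^ n"
  shows "\<bar>y\<bar> ^ (n - 2) * (2 * \<bar>y\<bar> - 1) \<le> \<bar>x ^ n - y ^ n\<bar>"
proof -
  define k where "k = n - 2"
  have n: "n = k + 2" using assms(1) by (simp add: k_def)
  define X Y where "X = \<bar>x\<bar>" and "Y = \<bar>y\<bar>"
  have nn: "0 \<le> X" "0 \<le> Y" by (simp_all add: X_def Y_def)
  have le: "\<bar>X ^ (k + 2) - Y ^ (k + 2)\<bar> \<le> \<bar>x ^ (k + 2) - y ^ (k + 2)\<bar>"
    unfolding X_def Y_def power_abs [symmetric] by (rule abs_triangle_ineq3)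
  consider "X \<ge> Y + 1" | "X \<le> Y - 1" | "X = Y" by linarith
  then have "Y ^ k * (2 * Y - 1) \<le> \<bar>x ^ (k + 2) - y ^ (k + 2)\<bar>"
  proof cases
    case 1
    have "Y ^ k * (Y + 1) ^ 2 \<le> (Y + 1) ^ k * (Y + 1) ^ 2"
      using nn by (intro mult_right_mono power_mono) auto
    also have "\<dots> = (Y + 1) ^ (k + 2)" by (simp only: power_add)
    also have "\<dots> \<le> X ^ (k + 2)"
      using 1 nn by (intro power_mono) auto
    finally have "Y ^ k * (Y + 1) ^ 2 - Y ^ (k + 2) \<le> X ^ (k + 2) - Y ^ (k + 2)" by simp
    also have "Y ^ k * (Y + 1) ^ 2 - Y ^ (k + 2) = Y ^ k * (2 * Y - 1) + 2 * Y ^ k"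
      by (simp add: power2_eq_square algebra_simps)
    finally show ?thesis using le nn zero_le_power[of Y k] by linarith
  next
    case 2
    have "X ^ (k + 2) \<le> (Y - 1) ^ (k + 2)"
      using 2 nn by (intro power_mono) auto
    also have "\<dots> = (Y - 1) ^ k * (Y - 1) ^ 2" by (simp only: power_add)
    also have "\<dots> \<le> Y ^ k * (Y - 1) ^ 2"
      using 2 nn by (intro mult_right_mono power_mono) auto
    finally have "Y ^ (k + 2) - Y ^ k * (Y - 1) ^ 2 \<le> Y ^ (k + 2) - X ^ (k + 2)" by simp
    also have "Y ^ (k + 2) - Y ^ k * (Y - 1) ^ 2 = Y ^ k * (2 * Y - 1)"
      by (simp add: power2_eq_square algebra_simps)
    finally show ?thesis using le by linarith
  next
    case 3
    then have "x = y \<or> x = - y" by (auto simp: X_def Y_def abs_eq_iff)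
    then have neg: "x = - y" "odd (k + 2)" using assms(2) n by auto
    then have "x ^ (k + 2) = - (y ^ (k + 2))" by simp
    then have "\<bar>x ^ (k + 2) - y ^ (k + 2)\<bar> = 2 * Y ^ (k + 2)"
      by (simp add: Y_def power_abs [symmetric] abs_mult)
    moreover have "Y ^ k * (2 * Y - 1) \<le> Y ^ k * (2 * Y ^ 2)"
    proof (rule mult_left_mono)
      have "0 \<le> (Y - 1) ^ 2 + Y ^ 2" by simp
      then show "2 * Y - 1 \<le> 2 * Y ^ 2" by (simp add: power2_eq_square algebra_simps)
    qed (use nn in simp)
    ultimately show ?thesis by (simp add: power2_eq_square algebra_simps)
  qed
  then show ?thesis unfolding n by (simp add: Y_def)
qed

lemma mult_abs_le_square:
  fixes x :: int
  assumes "0 \<le> k" "k \<le> \<bar>x\<bar>"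
  shows "k * \<bar>x\<bar> \<le> x ^ 2"
  using mult_right_mono[of k "\<bar>x\<bar>" "\<bar>x\<bar>"] assms by (simp add: power2_eq_square)

definition has_prime_root :: "nat \<Rightarrow> int \<Rightarrow> bool" where
  "has_prime_root d z \<longleftrightarrow> (\<exists>p y. prime p \<and> p dvd d \<and> z = y ^ p)"

definition eval_word :: "nat \<Rightarrow> int list \<Rightarrow> int \<Rightarrow> int" where
  "eval_word d bs t = foldr (\<lambda>b x. x ^ d + b) bs t"

lemma eval_word_simps [simp]: "eval_word d [] t = t" "eval_word d (b # bs) t = eval_word d bs t ^ d + b"
  by (simp_all add: eval_word_def)

lemma eval_word_append [simp]: "eval_word d (bs @ cs) t = eval_word d bs (eval_word d cs t)"
  by (simp add: eval_word_def)

lemma has_prime_root_1: "d \<ge> 2 \<Longrightarrow> has_prime_root d 1"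
  unfolding has_prime_root_def by (metis One_nat_def Suc_le_lessD less_numeral_extra(4) numeral_2_eq_2 power_one prime_factor_nat not_less_eq_eq)

section \<open>Norms and the substitution of a power of the variable\<close>

text \<open>The matrix of multiplication by \<open>g\<close> on the quotient ring of polynomials modulo \<open>h\<close>, in the basis of
powers of the variable. Its determinant is the norm of \<open>g\<close>, and its characteristic polynomial
gives, for every \<open>g\<close>, a polynomial with coefficients in the ground field whose roots are the values
of \<open>g\<close> at the roots of \<open>h\<close>.\<close>

definition mult_mat :: "'a::field poly \<Rightarrow> 'a poly \<Rightarrow> 'a mat" where
  "mult_mat h g = mat (degree h) (degree h) (\<lambda>(i, j). coeff (monom 1 j * g mod h) i)"

lemma mult_mat_carrier [simp]: "mult_mat h g \<in> carrier_mat (degree h) (degree h)"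
  by (simp add: mult_mat_def)

lemma coeff_mod_expand:
  fixes h g V :: "'a::field poly"
  assumes "degree V < degree h"
  shows "coeff (V * g mod h) i = (\<Sum>k<degree h. coeff V k * coeff (monom 1 k * g mod h) i)"
proof -
  have add: "(\<Sum>k\<in>K. f k) mod h = (\<Sum>k\<in>K. f k mod h)" for f :: "nat \<Rightarrow> 'a poly" and K
    by (induction K rule: infinite_finite_induct) (simp_all add: poly_mod_add_left)
  have "V = (\<Sum>k<degree h. monom (coeff V k) k)"
    by (rule poly_eqI) (use assms in \<open>auto simp: coeff_sum if_distrib sum.delta' coeff_eq_0 cong: if_cong\<close>)
  also have "\<dots> = (\<Sum>k<degree h. Polynomial.smult (coeff V k) (monom 1 k))"
    by (simp add: smult_monom)
  finally have "V * g mod h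
      = (\<Sum>k<degree h. Polynomial.smult (coeff V k) (monom 1 k)) * g mod h"
    by (rule arg_cong)
  also have "\<dots> = (\<Sum>k<degree h. Polynomial.smult (coeff V k) (monom 1 k * g mod h))"
    by (simp add: sum_distrib_right add mod_smult_left)
  finally show ?thesis
    by (simp add: coeff_sum)
qed

lemma mult_mat_mult:
  assumes "degree h > 0"
  shows "mult_mat h (g1 * g2) = mult_mat h g1 * mult_mat h g2"
proof (rule eq_matI)
  fix i j assume "i < dim_row (mult_mat h g1 * mult_mat h g2)"
    and "j < dim_col (mult_mat h g1 * mult_mat h g2)"
  then have i: "i < degree h" and j: "j < degree h"
    by (simp_all add: mult_mat_def)
  have deg: "degree (monom 1 j * g2 mod h) < degree h"
    using assms degree_mod_less[of h "monom 1 j * g2"] by fastforce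
  have "monom 1 j * (g1 * g2) mod h = (monom 1 j * g2 mod h) * g1 mod h"
    by (simp add: mod_mult_right_eq mult_ac)
  then show "mult_mat h (g1 * g2) $$ (i, j) = (mult_mat h g1 * mult_mat h g2) $$ (i, j)"
    using i j coeff_mod_expand[OF deg, of g1 i]
    by (simp add: mult_mat_def scalar_prod_def mult.commute lessThan_atLeast0)
qed (simp_all add: mult_mat_def)

lemma mult_mat_const:
  assumes "i < degree h" "j < degree h"
  shows "mult_mat h [:a:] $$ (i, j) = (if i = j then a else 0)"
proof -
  have "degree (Polynomial.smult a (monom 1 j)) < degree h"
    using assms by (metis degree_monom_le degree_smult_le le_less_trans)
  then have "monom 1 j * [:a:] mod h = Polynomial.smult a (monom 1 j)"
    by (simp add: mod_poly_less)
  then show ?thesis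
    using assms by (simp add: mult_mat_def)
qed

lemma mult_mat_1: "mult_mat h 1 = 1\<^sub>m (degree h)"
  by (rule eq_matI) (use mult_mat_const[of _ h _ 1] in \<open>auto simp: mult_mat_def one_pCons\<close>)

lemma mult_mat_diff:
  assumes "i < degree h" "j < degree h"
  shows "mult_mat h (f - g) $$ (i, j) = mult_mat h f $$ (i, j) - mult_mat h g $$ (i, j)"
  using assms by (simp add: mult_mat_def right_diff_distrib poly_mod_diff_left)

lemma det_mult_mat_power:
  assumes "degree h > 0"
  shows "det (mult_mat h (g ^ k)) = det (mult_mat h g) ^ k"
proof (induction k)
  case 0
  then show ?case by (simp add: mult_mat_1)
next
  case (Suc k)
  then show ?case
    by (simp add: mult_mat_mult[OF assms] det_mult[of _ "degree h"])
qed

text \<open>A Bezout identity makes \<open>g\<close> invertible modulo \<open>h\<close>.\<close>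

lemma det_mult_mat_nonzero:
  fixes h g :: "'a::field_gcd poly"
  assumes "degree h > 0" "coprime g h"
  shows "det (mult_mat h g) \<noteq> 0"
proof
  assume 0: "det (mult_mat h g) = 0"
  obtain u v where "u * g + v * h = 1"
    using assms(2) bezout_coefficients_fst_snd[of g h] by auto
  then have "u * g mod h = 1 mod h"
    by (metis mod_mult_self1)
  then have "mult_mat h (u * g) = mult_mat h 1"
    unfolding mult_mat_def by (metis mod_mult_right_eq)
  then have "mult_mat h u * mult_mat h g = 1\<^sub>m (degree h)"
    by (simp add: mult_mat_mult[OF assms(1)] mult_mat_1)
  then have "det (mult_mat h u * mult_mat h g) = 1"
    by simp
  then have "det (mult_mat h u) * det (mult_mat h g) = 1"
    by (simp add: det_mult[of _ "degree h"])
  with 0 show False by simp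
qed

lemma char_poly_mult_mat:
  fixes h g :: "'a::field poly"
  shows "poly (char_poly (mult_mat h g)) l = det (mult_mat h ([:l:] - g))"
  unfolding char_poly_def
proof (rule poly_det_cong[of _ "degree h"])
  fix i j assume ij: "i < degree h" "j < degree h"
  then show "poly (char_poly_matrix (mult_mat h g) $$ (i, j)) l = mult_mat h ([:l:] - g) $$ (i, j)"
    unfolding mult_mat_diff[OF ij] mult_mat_const[OF ij]
    by (simp add: char_poly_matrix_def mult_mat_def)
qed (simp_all add: mult_mat_def char_poly_matrix_def)

abbreviation complex_poly :: "rat poly \<Rightarrow> complex poly" where
  "complex_poly \<equiv> map_poly of_rat"

interpretation complex_poly_hom: map_poly_inj_idom_hom "of_rat :: rat \<Rightarrow> complex" ..

lemma common_root_imp_dvd: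
  fixes f g :: "rat poly" and z :: complex
  assumes "irreducible f" "poly (complex_poly f) z = 0" "poly (complex_poly g) z = 0"
  shows "f dvd g"
proof (rule ccontr)
  assume "\<not> f dvd g"
  with assms(1) have "coprime f g"
    using irreducible_imp_prime_elem prime_elem_imp_coprime by blast
  then obtain u v where "u * f + v * g = 1"
    using bezout_coefficients_fst_snd[of f g] by auto
  then have "poly (complex_poly (u * f + v * g)) z = 1"
    by simp
  with assms show False
    by (simp add: hom_distribs complex_poly_hom.hom_mult)
qed

text \<open>If \<open>l\<close> is a root of the characteristic polynomial, then \<open>l - g\<close> has norm zero, hence a common factor
with \<open>h\<close>, hence a common complex root.\<close>

lemma char_poly_mult_mat_root:
  fixes h :: "rat poly" and l :: complex
  assumes "degree h > 0" "poly (complex_poly (char_poly (mult_mat h g))) l = 0"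
  obtains r where "poly (complex_poly h) r = 0" "poly (complex_poly g) r = l"
proof -
  have "map_mat of_rat (mult_mat h g) = mult_mat (complex_poly h) (complex_poly g)"
  proof (rule eq_matI)
    fix i j assume "i < dim_row (mult_mat (complex_poly h) (complex_poly g))" "j < dim_col (mult_mat (complex_poly h) (complex_poly g))"
    then have ij: "i < degree h" "j < degree h" by (simp_all add: mult_mat_def)
    have "of_rat (coeff (monom 1 j * g mod h) i) = coeff (complex_poly (monom 1 j * g mod h)) i" by simp
    also have "complex_poly (monom 1 j * g mod h) = monom 1 j * complex_poly g mod complex_poly h"
      by (simp add: complex_poly_hom.hom_mult of_rat_hom.map_poly_mod map_poly_monom)
    finally show "map_mat of_rat (mult_mat h g) $$ (i, j) = mult_mat (complex_poly h) (complex_poly g) $$ (i, j)"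
      using ij by (simp add: mult_mat_def)
  qed (simp_all add: mult_mat_def)
  then have "det (mult_mat (complex_poly h) ([:l:] - complex_poly g)) = 0"
    using assms(2) by (simp add: of_rat_hom.char_poly_hom[OF mult_mat_carrier, symmetric] char_poly_mult_mat)
  then have "\<not> coprime ([:l:] - complex_poly g) (complex_poly h)"
    using det_mult_mat_nonzero[of "complex_poly h"] assms(1) by auto
  then obtain q where q: "q dvd [:l:] - complex_poly g" "q dvd complex_poly h" "\<not> is_unit q"
    by (auto elim: not_coprimeE)
  have "complex_poly h \<noteq> 0"
    using assms(1) by auto
  then have "q \<noteq> 0"
    using q(2) by auto
  then have "degree q \<noteq> 0"
    using q(3) is_unit_iff_degree[of q] by simp
  then obtain r where "poly q r = 0"
    using fundamental_theorem_of_algebra constant_degree by metis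
  then have "poly (complex_poly h) r = 0" "poly ([:l:] - complex_poly g) r = 0"
    using q(1,2) dvd_trans unfolding poly_eq_0_iff_dvd by blast+
  then show ?thesis using that by simp
qed

lemma monic_power_if_roots:
  fixes f q :: "rat poly"
  assumes "irreducible f" "lead_coeff f = 1" "lead_coeff q = 1"
    and "\<And>z :: complex. poly (complex_poly q) z = 0 \<Longrightarrow> poly (complex_poly f) z = 0"
  shows "\<exists>k. q = f ^ k"
  using assms(3,4)
proof (induction "degree q" arbitrary: q rule: less_induct)
  case less
  show ?case
  proof (cases "degree q = 0")
    case True
    then have "q = f ^ 0"
      using less.prems(1) by (auto elim!: degree_eq_zeroE)
    then show ?thesis ..
  next
    case False
    then have "\<not> constant (poly (complex_poly q))"
      by (metis constant_degree of_rat_hom.degree_map_poly_hom)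
    then obtain z :: complex where z: "poly (complex_poly q) z = 0"
      using fundamental_theorem_of_algebra by blast
    then have "f dvd q"
      using common_root_imp_dvd assms(1) less.prems(2) by blast
    then obtain q' where q': "q = f * q'" ..
    have "lead_coeff q' = 1"
      using less.prems(1) assms(2) by (simp add: q' lead_coeff_mult)
    moreover have "degree f > 0"
      using assms(1) is_unit_iff_degree[of f] by (auto simp: irreducible_def)
    then have "degree q' < degree q"
      using less.prems(1) assms(2) degree_mult_eq[of f q'] by (cases "q' = 0"; cases "f = 0") (auto simp: q')
    moreover have "poly (complex_poly f) z = 0" if "poly (complex_poly q') z = 0" for z :: complex
      using less.prems(2)[of z] that by (simp add: q' complex_poly_hom.hom_mult)
    ultimately obtain k where "q' = f ^ k"
      using less.hyps by blast
    then have "q = f ^ Suc k" by (simp add: q')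
    then show ?thesis ..
  qed
qed

text \<open>This is the norm computation in the extension generated by a root \<open>\<rho>\<close> of \<open>h\<close> over the field
generated by \<open>\<rho>\<^sup>p\<close>, phrased without field extensions. All roots of the characteristic polynomial
of \<open>\<rho>\<^sup>p\<close> are roots of \<open>f\<close>, so it is a power \<open>f\<^sup>k\<close>. Its constant term is, up to sign, the norm of
\<open>\<rho>\<^sup>p\<close>, which is the \<open>p\<close>-th power of the norm of \<open>\<rho>\<close>.\<close>

lemma irreducible_factor_of_substitution:
  fixes f h :: "rat poly"
  assumes "irreducible f" "lead_coeff f = 1" "degree h > 0"
    and "h dvd f \<circ>\<^sub>p monom 1 p"
  shows "\<exists>k r. degree h = k * degree f \<and> poly f 0 ^ k = (- 1) ^ degree h * r ^ p"
proof -
  define M where "M = mult_mat h (monom 1 p)"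
  have M: "M \<in> carrier_mat (degree h) (degree h)" by (simp add: M_def)
  have "poly (complex_poly f) z = 0" if z: "poly (complex_poly (char_poly M)) z = 0" for z :: complex
  proof -
    obtain r where r: "poly (complex_poly h) r = 0" "poly (complex_poly (monom 1 p)) r = z"
      using char_poly_mult_mat_root[OF assms(3)] z unfolding M_def by blast
    obtain u where "f \<circ>\<^sub>p monom 1 p = h * u" using assms(4) ..
    then have "poly (complex_poly (f \<circ>\<^sub>p monom 1 p)) r = 0"
      using r(1) by (simp add: hom_distribs complex_poly_hom.hom_mult)
    then show ?thesis
      using r(2) by (simp add: of_rat_hom.map_poly_pcompose poly_pcompose)
  qed
  then obtain k where k: "char_poly M = f ^ k"
    using monic_power_if_roots[OF assms(1,2), of "char_poly M"] degree_monic_char_poly[OF M] by auto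
  then have "degree h = k * degree f"
    using degree_monic_char_poly[OF M] assms(1) degree_power_eq[of f k] by (auto simp: irreducible_def)
  moreover have "poly f 0 ^ k = det (mult_mat h ([:0:] - monom 1 p))"
    using k char_poly_mult_mat[of h "monom 1 p" 0] by (simp add: M_def poly_power)
  moreover have "mult_mat h ([:0:] - monom 1 p) = (- 1) \<cdot>\<^sub>m M"
    by (rule eq_matI) (auto simp: mult_mat_def M_def)
  moreover have "det M = det (mult_mat h [:0, 1:]) ^ p"
    using det_mult_mat_power[OF assms(3), of "[:0, 1:]" p] by (simp add: M_def monom_altdef)
  ultimately show ?thesis using M by auto
qed

lemma rat_power_int:
  fixes r :: rat
  assumes "of_int z = r ^ p" "p > 0"
  shows "\<exists>y :: int. z = y ^ p"
proof -
  obtain a b where ab: "r = of_int a / of_int b" "coprime a b" "b > 0"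
    by (metis Rat_cases Fract_of_int_quotient)
  then have "(of_int (z * b ^ p) :: rat) = of_int (a ^ p)"
    using assms(1) by (simp add: power_divide)
  then have eq: "z * b ^ p = a ^ p"
    by (simp only: of_int_eq_iff)
  then have "b ^ p dvd a ^ p" by (metis dvd_triv_right)
  moreover have "coprime (b ^ p) (a ^ p)"
    using ab(2) by (simp add: coprime_commute)
  ultimately have "is_unit (b ^ p)"
    by (metis coprime_absorb_left)
  then have "b = 1"
    using ab(3) assms(2) power_eq_iff_eq_base[of p b 1] by (auto simp: is_unit_power_iff)
  with eq show ?thesis by auto
qed

text \<open>A proper factor of \<open>f(x\<^sup>p)\<close> has degree \<open>k deg f\<close> with \<open>0 < k < p\<close>, and \<open>f(0)\<^sup>k\<close> is a \<open>p\<close>-th power up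
to sign. Since \<open>k\<close> is prime to \<open>p\<close>, the exponent \<open>k\<close> can be removed. For odd \<open>p\<close> the sign is itself
a \<open>p\<close>-th power; for \<open>p = 2\<close> it disappears because the degree is even.\<close>

lemma irreducible_substitute_prime:
  fixes f :: "rat poly"
  assumes f: "irreducible f" "lead_coeff f = 1" "poly f 0 = of_int z"
    and p: "prime p" "p = 2 \<Longrightarrow> even (degree f)"
    and red: "\<not> irreducible (f \<circ>\<^sub>p monom 1 p)"
  shows "\<exists>y :: int. z = y ^ p"
proof -
  have N: "degree f > 0"
    using f(1) is_unit_iff_degree[of f] by (auto simp: irreducible_def)
  define q where "q = f \<circ>\<^sub>p monom 1 p"
  have p0: "p > 1" using p(1) prime_gt_1_nat by blast
  have deg_q: "degree q = degree f * p"
    by (simp add: q_def degree_monom_eq)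
  then have q0: "q \<noteq> 0" "\<not> is_unit q"
    using N p0 is_unit_iff_degree[of q] by auto
  obtain a b where ab: "q = a * b" "\<not> is_unit a" "\<not> is_unit b"
    using red q0 unfolding q_def irreducible_def by blast
  then have "degree a > 0" "degree b > 0"
    using q0(1) is_unit_iff_degree[of a] is_unit_iff_degree[of b] by auto
  then have a: "degree a > 0" "degree a < degree q"
    using q0(1) by (auto simp: ab(1) degree_mult_eq)
  obtain k r where k: "degree a = k * degree f"
    and r: "poly f 0 ^ k = (- 1) ^ degree a * r ^ p"
    using irreducible_factor_of_substitution[OF f(1,2) a(1), of p] ab(1) unfolding q_def
    by (metis dvd_triv_left)
  have k0: "0 < k" "k < p"
    using a N by (auto simp: k deg_q)
  have "\<exists>r'. poly f 0 ^ k = r' ^ p"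
  proof (cases "p = 2")
    case True
    then show ?thesis using r p(2) k by auto
  next
    case False
    then have "odd p" using p(1) prime_odd_nat p0 by force
    then have "(- 1) ^ degree a * r ^ p = ((- 1) ^ degree a * r) ^ p"
      by (simp add: power_mult_distrib flip: power_mult) (simp add: mult.commute power_mult)
    then show ?thesis using r by auto
  qed
  then obtain r' where r': "poly f 0 ^ k = r' ^ p" ..
  have "coprime k p"
    using p(1) k0 by (metis coprime_commute prime_imp_coprime nat_dvd_not_less)
  then obtain u v where uv: "u * k = v * p + 1"
    using coprime_bezout_strong[of k p] p0 by (auto simp: mult.commute)
  have "\<exists>w. poly f 0 = w ^ p"
  proof (cases "poly f 0 = 0")
    case True
    then show ?thesis using p0 by (auto intro!: exI[of _ 0])
  next
    case False
    have "poly f 0 ^ (v * p) * poly f 0 = poly f 0 ^ (k * u)"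
      using uv by (simp add: mult.commute)
    also have "\<dots> = (r' ^ u) ^ p"
      unfolding power_mult r' by (simp add: mult.commute flip: power_mult)
    finally have "poly f 0 = (r' ^ u / poly f 0 ^ v) ^ p"
      using False by (simp add: power_divide power_mult [symmetric] field_simps)
    then show ?thesis ..
  qed
  then show ?thesis
    using rat_power_int p0 f(3) by auto
qed

text \<open>The prime factors of the exponent are substituted one at a time; the constant term never changes.
If \<open>d\<close> is even, then all degrees are even; therefore the exceptional case of Capelli's theorem, \<open>-4\<close> times
a fourth power, needs no separate condition: the norm of such an element is a square.\<close>

lemma irreducible_substitute_power:
  fixes f :: "rat poly"
  assumes f: "irreducible f" "lead_coeff f = 1" "poly f 0 = of_int z"
    and d: "even d \<Longrightarrow> even (degree f)" "e dvd d" "d > 0"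
    and z: "\<not> has_prime_root d z"
  shows "irreducible (f \<circ>\<^sub>p monom 1 e)"
  using d(2)
proof (induction e rule: less_induct)
  case (less e)
  have "e > 0" using less.prems d(3) by (auto intro: Nat.gr0I)
  show ?case
  proof (cases "e = 1")
    case True
    then show ?thesis using f(1) by (simp add: monom_altdef)
  next
    case False
    then obtain p where p: "prime p" "p dvd e"
      using prime_factor_nat by blast
    then obtain e' where e': "e = p * e'" by blast
    have e'0: "e' > 0" using \<open>e > 0\<close> e' by simp
    then have "e' < e"
      using p(1) prime_gt_1_nat[of p] e' by simp
    moreover have "e' dvd d" "p dvd d"
      using less.prems e' by (auto dest: dvd_mult_left dvd_mult_right)
    ultimately have irr: "irreducible (f \<circ>\<^sub>p monom 1 e')"
      using less.IH by blast
    have "lead_coeff (f \<circ>\<^sub>p monom 1 e') = 1"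
      using f(2) e'0 using lead_coeff_comp[of "monom 1 e'" f] by (simp add: degree_monom_eq)
    moreover have "poly (f \<circ>\<^sub>p monom 1 e') 0 = of_int z"
      using f(3) e'0 by (simp add: poly_pcompose poly_monom power_0_left)
    moreover have "p = 2 \<Longrightarrow> even (degree (f \<circ>\<^sub>p monom 1 e'))"
      using d(1) \<open>p dvd d\<close> by simp
    moreover have "\<not> (\<exists>y. z = y ^ p)"
      using z p(1) \<open>p dvd d\<close> unfolding has_prime_root_def by blast
    ultimately have "irreducible ((f \<circ>\<^sub>p monom 1 e') \<circ>\<^sub>p monom 1 p)"
      using irreducible_substitute_prime[OF irr] p(1) by blast
    also have "(f \<circ>\<^sub>p monom 1 e') \<circ>\<^sub>p monom 1 p = f \<circ>\<^sub>p monom 1 e"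
      by (simp add: e' pcompose_assoc [symmetric] monom_altdef pcompose_hom.hom_power power_mult pcompose_pCons)
    finally show ?thesis .
  qed
qed

section \<open>Irreducibility of compositions\<close>

definition word :: "nat \<Rightarrow> int list \<Rightarrow> rat poly" where
  "word d bs = compose_list (map (\<lambda>b. unicritical d (of_int b)) bs)"

lemma word_simps [simp]: "word d [] = [:0, 1:]"
    "word d (b # bs) = unicritical d (of_int b) \<circ>\<^sub>p word d bs"
  by (simp_all add: word_def compose_list_def)

lemma word_append: "word d (bs @ cs) = word d bs \<circ>\<^sub>p word d cs"
  by (induction bs) (simp_all add: pcompose_assoc)

lemma poly_word: "poly (word d bs) (of_int t) = of_int (eval_word d bs t)"
  by (induction bs) (simp_all add: poly_pcompose unicritical_def poly_monom)

lemma degree_word: "degree (word d bs) = d ^ length bs"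
  by (induction bs) (simp_all add: degree_unicritical)

lemma lead_coeff_word:
  assumes "d \<ge> 1"
  shows "lead_coeff (word d bs) = 1"
proof (induction bs)
  case (Cons b bs)
  have "lead_coeff (unicritical d (of_int b :: rat)) = 1"
    using assms unfolding degree_unicritical by (simp add: unicritical_def coeff_eq_0)
  then show ?case
    using Cons lead_coeff_comp[of "word d bs" "unicritical d (of_int b)"] assms
    by (simp add: degree_word)
qed simp

lemma irreducible_pcomposeD:
  fixes f g :: "'a::field poly"
  assumes "irreducible (f \<circ>\<^sub>p g)" "degree g > 0"
  shows "irreducible f"
proof (rule irreducibleI)
  show "f \<noteq> 0" using assms(1) by auto
  show "\<not> is_unit f"
  proof
    assume "is_unit f"
    then obtain c where "f = [:c:]" "c \<noteq> 0"
      by (auto simp: is_unit_iff_degree elim!: degree_eq_zeroE)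
    then have "is_unit (f \<circ>\<^sub>p g)" by (simp add: is_unit_iff_degree)
    with assms(1) show False unfolding irreducible_def by blast
  qed
next
  fix a b assume "f = a * b"
  then have "f \<circ>\<^sub>p g = (a \<circ>\<^sub>p g) * (b \<circ>\<^sub>p g)" by (simp add: pcompose_mult)
  then have "is_unit (a \<circ>\<^sub>p g) \<or> is_unit (b \<circ>\<^sub>p g)"
    using assms(1) unfolding irreducible_def by blast
  moreover have "is_unit u" if "is_unit (u \<circ>\<^sub>p g)" for u
  proof -
    have "u \<circ>\<^sub>p g \<noteq> 0" "degree (u \<circ>\<^sub>p g) = 0"
      using that is_unit_iff_degree[of "u \<circ>\<^sub>p g"] by (cases "u \<circ>\<^sub>p g = 0"; simp)+
    then show ?thesis
      using assms(2) by (auto simp: is_unit_iff_degree)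
  qed
  ultimately show "is_unit a \<or> is_unit b" by blast
qed

lemma irreducible_shift:
  fixes f :: "'a::field poly"
  assumes "irreducible f"
  shows "irreducible (f \<circ>\<^sub>p [:b, 1:])"
proof (rule irreducible_pcomposeD[of _ "[:- b, 1:]"])
  have "f \<circ>\<^sub>p [:b, 1:] \<circ>\<^sub>p [:- b, 1:] = f \<circ>\<^sub>p [:0, 1:]"
    unfolding pcompose_assoc [symmetric] by (simp add: pcompose_pCons)
  then show "irreducible (f \<circ>\<^sub>p [:b, 1:] \<circ>\<^sub>p [:- b, 1:])"
    using assms by simp
qed simp

lemma word_snoc:
  "word d (bs @ [b]) = (word d bs \<circ>\<^sub>p [:of_int b, 1:]) \<circ>\<^sub>p monom 1 d"
  by (simp add: word_append unicritical_def pcompose_pCons add.commute flip: pcompose_assoc)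

text \<open>The criterion on which everything rests: \<open>F \<circ> (x\<^sup>d + b)\<close> is \<open>F(x + b)\<close> evaluated at \<open>x\<^sup>d\<close>, and the
constant term of \<open>F(x + b)\<close> is \<open>F(b)\<close>.\<close>

lemma irreducible_word_snoc:
  assumes "d \<ge> 2" "bs \<noteq> []" "irreducible (word d bs)" "\<not> has_prime_root d (eval_word d bs b)"
  shows "irreducible (word d (bs @ [b]))"
  unfolding word_snoc
proof (rule irreducible_substitute_power[where d = d])
  let ?f = "word d bs \<circ>\<^sub>p [:of_int b, 1:]"
  show "irreducible ?f" using assms(3) by (rule irreducible_shift)
  show "lead_coeff ?f = 1"
    using lead_coeff_comp[of "[:of_int b, 1:]" "word d bs"] lead_coeff_word[of d bs] assms(1) by simp
  show "poly ?f 0 = of_int (eval_word d bs b)"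
    using poly_word[of d bs b] by (simp add: poly_pcompose)
  show "even (degree ?f)" if "even d"
    using that assms(2) by (simp add: degree_word)
qed (use assms in auto)

lemma irreducible_word_extend:
  assumes "d \<ge> 2" "bs \<noteq> []" "irreducible (word d bs)"
    and "\<And>t. \<not> has_prime_root d (eval_word d bs t)"
  shows "irreducible (word d (bs @ gs))"
proof (induction gs rule: rev_induct)
  case (snoc b gs)
  then show ?case
    using irreducible_word_snoc[of d "bs @ gs" b] assms by simp
qed (use assms in simp)

lemma irreducible_word_ConsD:
  assumes "d \<ge> 2" "irreducible (word d (b # bs))"
  shows "irreducible (word d [b])"
  using assms irreducible_pcomposeD[of "unicritical d (of_int b)" "word d bs"]
  by (simp add: degree_word)

text \<open>If \<open>-b = y\<^sup>p\<close> and \<open>d = p k\<close>, then \<open>x\<^sup>k - y\<close> divides \<open>x\<^sup>d + b\<close>.\<close>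

lemma irreducible_unicritical_imp:
  assumes "d \<ge> 2" "irreducible (word d [b])"
  shows "\<not> has_prime_root d (- b)"
proof
  assume "has_prime_root d (- b)"
  then obtain p y where p: "prime p" "p dvd d" "- b = y ^ p" by (auto simp: has_prime_root_def)
  then obtain k where k: "d = p * k" by blast
  have k0: "k > 0" using assms(1) k by (auto intro: Nat.gr0I)
  have p1: "p > 1" using p(1) prime_gt_1_nat by blast
  define a :: "rat poly" where "a = monom 1 k - [:of_int y:]"
  have "degree a = k"
    using degree_add_eq_left[of "[:- of_int y:]" "monom (1::rat) k"] k0
    by (simp add: a_def degree_monom_eq diff_conv_add_uminus del: add_uminus_conv_diff)
  have "of_int b = - ((of_int y :: rat) ^ p)"
    using p(3) by (metis minus_minus of_int_minus of_int_power)
  then have "word d [b] = monom 1 k ^ p - [:of_int y:] ^ p"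
    by (simp add: unicritical_def k monom_power poly_const_pow mult.commute)
  then have "a dvd word d [b]"
    by (simp add: a_def power_diff_sumr2) 
  then obtain c where c: "word d [b] = a * c" ..
  have "word d [b] \<noteq> 0" using assms(2) by auto
  then have "degree (word d [b]) = k + degree c"
    unfolding c using \<open>degree a = k\<close> by (simp add: degree_mult_eq)
  then have "p * k = k + degree c"
    by (simp only: degree_word k) simp
  moreover have "p * k \<ge> 2 * k" using p1 by simp
  ultimately have "degree c > 0"
    using k0 by linarith
  then have "\<not> is_unit a" "\<not> is_unit c"
    using \<open>degree a = k\<close> k0 is_unit_iff_degree[of a] is_unit_iff_degree[of c] by auto
  then show False
    using assms(2) c unfolding irreducible_def by blast
qed

section \<open>Eisenstein integers and the Fermat cubic\<close>

text \<open>The element \<open>Eis a b\<close> stands for \<open>a + b \<omega>\<close>, where \<open>\<omega>\<^sup>2 + \<omega> + 1 = 0\<close>.\<close>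

datatype eisenstein = Eis (eis_fst: int) (eis_snd: int)

instantiation eisenstein :: comm_ring_1
begin

definition "0 = Eis 0 0"
definition "1 = Eis 1 0"
definition "u + v = Eis (eis_fst u + eis_fst v) (eis_snd u + eis_snd v)"
definition "u - v = Eis (eis_fst u - eis_fst v) (eis_snd u - eis_snd v)"
definition "- u = Eis (- eis_fst u) (- eis_snd u)"
definition "u * v = Eis (eis_fst u * eis_fst v - eis_snd u * eis_snd v)
  (eis_fst u * eis_snd v + eis_snd u * eis_fst v - eis_snd u * eis_snd v)"

instance
  by standard (auto simp: zero_eisenstein_def one_eisenstein_def plus_eisenstein_def
    minus_eisenstein_def uminus_eisenstein_def times_eisenstein_def algebra_simps)

end

lemmas eis_defs = zero_eisenstein_def one_eisenstein_def plus_eisenstein_def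
    minus_eisenstein_def uminus_eisenstein_def times_eisenstein_def

lemma eis_of_int: "of_int n = Eis n 0"
proof (induction n rule: int_induct[where k = 0])
  case base show ?case by (simp add: eis_defs)
next
  case (step1 i) then show ?case by (simp add: eis_defs)
next
  case (step2 i) then show ?case by (simp add: eis_defs)
qed

definition eis_norm :: "eisenstein \<Rightarrow> int" where
  "eis_norm u = eis_fst u ^ 2 - eis_fst u * eis_snd u + eis_snd u ^ 2"

definition eis_conj :: "eisenstein \<Rightarrow> eisenstein" where
  "eis_conj u = Eis (eis_fst u - eis_snd u) (- eis_snd u)"

lemma eis_norm_mult: "eis_norm (u * v) = eis_norm u * eis_norm v"
  by (simp add: eis_norm_def eis_defs power2_eq_square algebra_simps)

lemma eis_norm_four: "4 * eis_norm u = (2 * eis_fst u - eis_snd u) ^ 2 + 3 * eis_snd u ^ 2"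
  by (simp add: eis_norm_def power2_eq_square algebra_simps)

lemma eis_norm_nonneg: "eis_norm u \<ge> 0"
proof -
  have "4 * eis_norm u \<ge> 0" unfolding eis_norm_four by simp
  then show ?thesis by simp
qed

lemma eis_norm_eq_0_iff: "eis_norm u = 0 \<longleftrightarrow> u = 0"
proof
  assume "eis_norm u = 0"
  then have "(2 * eis_fst u - eis_snd u) ^ 2 + 3 * eis_snd u ^ 2 = 0"
    using eis_norm_four[of u] by simp
  then have "eis_snd u ^ 2 = 0" "(2 * eis_fst u - eis_snd u) ^ 2 = 0"
    using zero_le_power2[of "eis_snd u"] zero_le_power2[of "2 * eis_fst u - eis_snd u"] by linarith+
  then have "eis_snd u = 0 \<and> 2 * eis_fst u - eis_snd u = 0" by simp
  then show "u = 0" by (cases u) (simp add: eis_defs)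
qed (simp add: eis_norm_def eis_defs)

lemma eis_mult_conj: "u * eis_conj u = of_int (eis_norm u)"
  by (simp add: eis_of_int eis_norm_def eis_conj_def eis_defs power2_eq_square algebra_simps)

text \<open>Rounding both coordinates of the exact quotient leaves an error whose coordinates are at most one
half in absolute value, hence of norm at most \<open>3/4\<close>.\<close>

lemma eis_division:
  assumes "v \<noteq> 0"
  shows "\<exists>q. eis_norm (u - q * v) < eis_norm v"
proof -
  define n where "n = eis_norm v"
  have n: "n > 0"
    using assms eis_norm_nonneg[of v] eis_norm_eq_0_iff[of v] by (simp add: n_def)
  define w where "w = u * eis_conj v"
  have round: "\<exists>k. 2 * \<bar>a - k * n\<bar> \<le> n" for a :: int
  proof (cases "2 * (a mod n) \<le> n")
    case True
    then have "2 * \<bar>a - (a div n) * n\<bar> \<le> n"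
      using n by (simp add: minus_div_mult_eq_mod)
    then show ?thesis ..
  next
    case False
    have "a - (a div n + 1) * n = a mod n - n"
      by (simp add: algebra_simps minus_div_mult_eq_mod [symmetric])
    then have "2 * \<bar>a - (a div n + 1) * n\<bar> \<le> n"
      using False pos_mod_bound[OF n, of a] by (simp add: abs_if)
    then show ?thesis ..
  qed
  obtain k l where k: "2 * \<bar>eis_fst w - k * n\<bar> \<le> n" and l: "2 * \<bar>eis_snd w - l * n\<bar> \<le> n"
    using round by blast
  define r where "r = u - Eis k l * v"
  have "r * eis_conj v = w - Eis k l * of_int n"
    unfolding r_def left_diff_distrib mult.assoc eis_mult_conj by (simp add: w_def n_def)
  then have rw: "r * eis_conj v = Eis (eis_fst w - k * n) (eis_snd w - l * n)"
    by (simp add: eis_of_int eis_defs)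
  have "eis_norm (eis_conj v) = n"
    by (simp add: n_def eis_norm_def eis_conj_def power2_eq_square algebra_simps)
  then have "eis_norm r * n = eis_norm (r * eis_conj v)"
    by (simp add: eis_norm_mult)
  also have "4 * \<dots> \<le> 3 * n ^ 2"
  proof -
    define e f where "e = eis_fst w - k * n" and "f = eis_snd w - l * n"
    have ef: "(2 * e) ^ 2 \<le> n ^ 2" "(2 * f) ^ 2 \<le> n ^ 2" "\<bar>2 * e * (2 * f)\<bar> \<le> n * n"
    proof -
      have *: "\<bar>2 * e\<bar> \<le> n" "\<bar>2 * f\<bar> \<le> n"
        using k l unfolding e_def f_def abs_mult by simp_all
      then show "(2 * e) ^ 2 \<le> n ^ 2" "(2 * f) ^ 2 \<le> n ^ 2"
        using n abs_le_square_iff[of "2 * e" n] abs_le_square_iff[of "2 * f" n] by linarith+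
      show "\<bar>2 * e * (2 * f)\<bar> \<le> n * n"
        unfolding abs_mult[of "2 * e"] using * n by (intro mult_mono) auto
    qed
    have "4 * eis_norm (Eis e f) = (2 * e) ^ 2 - (2 * e) * (2 * f) + (2 * f) ^ 2"
      by (simp add: eis_norm_def power2_eq_square)
    also have "\<dots> \<le> 3 * n ^ 2" using ef by (simp add: power2_eq_square abs_le_iff)
    finally show ?thesis by (simp add: rw e_def f_def)
  qed
  finally have "4 * eis_norm r * n \<le> 3 * n * n" by (simp add: power2_eq_square)
  then have "4 * eis_norm r \<le> 3 * n" using n by simp
  then have "eis_norm r < n" using n by simp
  then show ?thesis unfolding r_def n_def by blast
qed

lemma eis_bezout:
  "\<exists>g x y u' v'. g = x * u + y * v \<and> u = g * u' \<and> v = g * (v' :: eisenstein)"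
proof (induction "nat (eis_norm v)" arbitrary: u v rule: less_induct)
  case less
  show ?case
  proof (cases "v = 0")
    case True
    then have "u = 1 * u + 0 * v \<and> u = u * 1 \<and> v = u * 0" by simp
    then show ?thesis by blast
  next
    case False
    then obtain q where q: "eis_norm (u - q * v) < eis_norm v"
      using eis_division by blast
    then have "nat (eis_norm (u - q * v)) < nat (eis_norm v)"
      using eis_norm_nonneg[of "u - q * v"] by simp
    from less[OF this, of v] obtain g x y a b where
      *: "g = x * v + y * (u - q * v)" "v = g * a" "u - q * v = g * b" by blast
    have "g = y * u + (x - y * q) * v" using *(1) by (simp add: algebra_simps)
    moreover have "u = g * (b + q * a)"
      using *(2,3) by (metis (no_types) diff_add_cancel distrib_left mult.left_commute)
    ultimately show ?thesis using *(2) by blast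
  qed
qed

lemma eis_unit_cases:
  assumes "eis_norm u = 1"
  shows "u = Eis 1 0 \<or> u = Eis (-1) 0 \<or> u = Eis 0 1 \<or> u = Eis 0 (-1)
    \<or> u = Eis 1 1 \<or> u = Eis (-1) (-1)"
proof -
  define a b where "a = eis_fst u" and "b = eis_snd u"
  have 4: "(2 * a - b) ^ 2 + 3 * b ^ 2 = 4"
    using eis_norm_four[of u] assms by (simp add: a_def b_def)
  then have "b ^ 2 < 2 ^ 2" using zero_le_power2[of "2 * a - b"] unfolding power2_eq_square[of 2] by linarith
  then have "\<bar>b\<bar> < 2" using abs_le_square_iff[of 2 b] by linarith
  then consider "b = 0" | "b = 1" | "b = -1" by linarith
  then have "(a = 1 \<or> a = -1) \<and> b = 0 \<or> (a = 0 \<or> a = 1) \<and> b = 1 \<or> (a = 0 \<or> a = -1) \<and> b = -1"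
  proof cases
    case 1
    then have "a ^ 2 = 1" using 4 by (simp add: power2_eq_square)
    then show ?thesis using 1 by (simp add: power2_eq_1_iff)
  next
    case 2
    then have "(2 * a - 1) ^ 2 = 1" using 4 by simp
    then show ?thesis using 2 unfolding power2_eq_1_iff by auto
  next
    case 3
    then have "(2 * a + 1) ^ 2 = 1" using 4 by simp
    then show ?thesis using 3 unfolding power2_eq_1_iff by auto
  qed
  moreover have "u = Eis a b" by (simp add: a_def b_def)
  ultimately show ?thesis by auto
qed

text \<open>Let \<open>\<alpha> = a + b \<omega>\<close>. The ideal generated by \<open>\<alpha>\<close> and its conjugate contains \<open>3\<close>, because \<open>a\<close> and \<open>b\<close> are
coprime, and \<open>n\<^sup>3\<close>, which is prime to \<open>3\<close>; so it is the whole ring. If \<open>g\<close> generates the ideal of \<open>\<alpha>\<close> and \<open>n\<close>, then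
\<open>g\<^sup>3\<close> and \<open>\<alpha>\<close> divide each other: the cube of that ideal is generated by
\<open>\<alpha>\<^sup>3\<close>, \<open>\<alpha>\<^sup>2 n\<close>, \<open>\<alpha> n\<^sup>2\<close> and \<open>n\<^sup>3 = \<alpha> \<alpha>'\<close>.\<close>

lemma eis_cube:
  fixes a b n :: int
  assumes "coprime a b" "\<not> 3 dvd n" "a ^ 2 - a * b + b ^ 2 = n ^ 3"
  shows "\<exists>\<gamma> \<epsilon>. eis_norm \<epsilon> = 1 \<and> Eis a b = \<epsilon> * \<gamma> ^ 3"
proof -
  define \<alpha> \<alpha>' where "\<alpha> = Eis a b" and "\<alpha>' = eis_conj \<alpha>"
  have N: "\<alpha> * \<alpha>' = of_int n ^ 3"
    using assms(3) by (simp add: \<alpha>_def \<alpha>'_def eis_mult_conj eis_norm_def)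
  obtain s t where st: "s * a + t * b = 1"
    using assms(1) by (metis bezout_int coprime_iff_gcd_eq_1)
  (* The traces of (1 - \<omega>)\<alpha> and (1 + 2\<omega>)\<alpha> are 3a and -3b. *)
  have three: "(of_int s * (1 - Eis 0 1) - of_int t * (1 + 2 * Eis 0 1)) * \<alpha>
      + (of_int s * (1 - Eis (-1) (-1)) - of_int t * (1 + 2 * Eis (-1) (-1))) * \<alpha>' = 3"
  proof -
    have 3: "3 = Eis 3 0" "2 = Eis 2 0"
      using eis_of_int[of 3] eis_of_int[of 2] by simp_all
    show ?thesis using st
      by (simp add: \<alpha>_def \<alpha>'_def eis_conj_def eis_of_int 3 eis_defs algebra_simps)
  qed
  have "prime (3 :: int)" by simp
  then have "coprime 3 n" using assms(2) by (rule prime_imp_coprime)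
  then have "coprime 3 (n ^ 3)" by simp
  then obtain k l where "k * 3 + l * n ^ 3 = 1"
    by (metis bezout_int coprime_iff_gcd_eq_1)
  then have "(of_int k * 3 + of_int l * of_int n ^ 3 :: eisenstein) = of_int 1"
    by (metis of_int_add of_int_mult of_int_numeral of_int_power)
  then have kl: "of_int k * 3 + of_int l * (\<alpha> * \<alpha>') = 1" by (simp add: N)
  (* So \<alpha> and its conjugate generate the unit ideal. *)
  obtain x y where xy: "x * \<alpha> + y * \<alpha>' = 1"
  proof
    show "(of_int k * (of_int s * (1 - Eis 0 1) - of_int t * (1 + 2 * Eis 0 1)) + of_int l * \<alpha>') * \<alpha>
      + (of_int k * (of_int s * (1 - Eis (-1) (-1)) - of_int t * (1 + 2 * Eis (-1) (-1)))) * \<alpha>' = 1"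
      using kl unfolding three[symmetric] by (simp add: algebra_simps)
  qed
  obtain g p q \<alpha>1 n1 where g: "g = p * \<alpha> + q * of_int n" "\<alpha> = g * \<alpha>1" "of_int n = g * n1"
    using eis_bezout by blast
  obtain m where m: "g ^ 3 = \<alpha> * m"
  proof
    have "g ^ 3 = \<alpha> * (p ^ 3 * \<alpha> ^ 2 + 3 * p ^ 2 * q * \<alpha> * of_int n + 3 * p * q ^ 2 * of_int n ^ 2)
      + q ^ 3 * of_int n ^ 3"
      unfolding g(1) by (simp add: power3_eq_cube power2_eq_square algebra_simps)
    then show "g ^ 3 = \<alpha> * (p ^ 3 * \<alpha> ^ 2 + 3 * p ^ 2 * q * \<alpha> * of_int n + 3 * p * q ^ 2 * of_int n ^ 2
      + q ^ 3 * \<alpha>')"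
      unfolding N[symmetric] by (simp add: algebra_simps)
  qed
  obtain k where k: "\<alpha> = g ^ 3 * k"
  proof
    have "\<alpha> = \<alpha> * (x * \<alpha> + y * \<alpha>') ^ 2" using xy by simp
    also have "\<dots> = x ^ 2 * \<alpha> ^ 3 + (2 * x * y * \<alpha> + y ^ 2 * \<alpha>') * (\<alpha> * \<alpha>')"
      by (simp add: power3_eq_cube power2_eq_square algebra_simps)
    also have "\<dots> = x ^ 2 * (g * \<alpha>1) ^ 3 + (2 * x * y * \<alpha> + y ^ 2 * \<alpha>') * (g * n1) ^ 3"
      using N g(2,3) by metis
    also have "\<dots> = g ^ 3 * (x ^ 2 * \<alpha>1 ^ 3 + (2 * x * y * \<alpha> + y ^ 2 * \<alpha>') * n1 ^ 3)"
      by (simp add: power_mult_distrib algebra_simps)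
    finally show "\<alpha> = g ^ 3 * (x ^ 2 * \<alpha>1 ^ 3 + (2 * x * y * \<alpha> + y ^ 2 * \<alpha>') * n1 ^ 3)" .
  qed
  have "n \<noteq> 0" using assms(2) by auto
  then have "eis_norm \<alpha> \<noteq> 0"
    using assms(3) by (simp add: \<alpha>_def eis_norm_def)
  moreover have "eis_norm \<alpha> = eis_norm \<alpha> * (eis_norm m * eis_norm k)"
    using k m by (metis eis_norm_mult mult.assoc)
  ultimately have "eis_norm m * eis_norm k = 1" by simp
  then have "eis_norm k = 1"
    using eis_norm_nonneg[of k] zmult_eq_1_iff by force
  then show ?thesis using k by (metis \<alpha>_def mult.commute)
qed

lemma coprime_mult_cube:
  fixes a b c :: int
  assumes "coprime a b" "a * b = c ^ 3"
  shows "\<exists>k. a = k ^ 3"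
proof (cases "a = 0 \<or> b = 0")
  case True
  then have "a = 0 ^ 3 \<or> a = 1 ^ 3 \<or> a = (-1) ^ 3"
    using assms(1) by auto
  then show ?thesis by blast
next
  case False
  have "nat \<bar>a\<bar> * nat \<bar>b\<bar> = nat \<bar>c\<bar> ^ 3"
    using assms(2) by (metis abs_mult nat_abs_mult_distrib nat_power_eq power_abs abs_ge_zero)
  moreover have "coprime (nat \<bar>a\<bar>) (nat \<bar>b\<bar>)"
    using assms(1) by simp
  ultimately have "is_nth_power 3 (nat \<bar>a\<bar>)"
    using is_nth_power_mult_coprime_natD(1)[of "nat \<bar>a\<bar>" "nat \<bar>b\<bar>" 3] False
    by (auto simp: is_nth_power_def)
  then obtain k where "nat \<bar>a\<bar> = k ^ 3" by (auto elim: is_nth_powerE)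
  then have "\<bar>a\<bar> = int k ^ 3" by (metis abs_ge_zero int_nat_eq of_nat_power)
  then have "a = int k ^ 3 \<or> a = (- int k) ^ 3" by (auto simp: abs_if split: if_splits)
  then show ?thesis by blast
qed

lemma cube_mod_9: "(x::int) ^ 3 mod 9 = (if 3 dvd x then 0 else if x mod 3 = 1 then 1 else 8)"
proof -
  have "x mod 9 = 0 \<or> x mod 9 = 1 \<or> x mod 9 = 2 \<or> x mod 9 = 3 \<or> x mod 9 = 4 \<or> x mod 9 = 5
    \<or> x mod 9 = 6 \<or> x mod 9 = 7 \<or> x mod 9 = 8" by presburger
  moreover have "x ^ 3 mod 9 = (x mod 9) ^ 3 mod 9" by (simp add: power_mod)
  moreover have "x mod 3 = (x mod 9) mod 3" by (simp add: mod_mod_cancel)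
  ultimately show ?thesis unfolding dvd_eq_mod_eq_0 by (elim disjE) (simp_all only:, simp_all)
qed

lemma cube_sum_imp_three_dvd:
  fixes x y z :: int
  assumes "x ^ 3 + y ^ 3 + z ^ 3 = 0"
  shows "3 dvd x \<or> 3 dvd y \<or> 3 dvd z"
proof (rule ccontr)
  have units: "a ^ 3 mod 9 = 1 \<or> a ^ 3 mod 9 = 8" if "\<not> 3 dvd a" for a :: int
    using that unfolding cube_mod_9 by simp
  assume "\<not> (3 dvd x \<or> 3 dvd y \<or> 3 dvd z)"
  then have "x ^ 3 mod 9 = 1 \<or> x ^ 3 mod 9 = 8" "y ^ 3 mod 9 = 1 \<or> y ^ 3 mod 9 = 8"
    "z ^ 3 mod 9 = 1 \<or> z ^ 3 mod 9 = 8"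
    using units by blast+
  moreover have "((x ^ 3 mod 9 + y ^ 3 mod 9) mod 9 + z ^ 3 mod 9) mod 9 = 0"
    unfolding mod_add_eq assms by simp
  ultimately show False by (elim disjE) simp_all
qed

text \<open>Euler's descent. Since \<open>3\<close> divides \<open>z\<close>, the number \<open>x + y\<omega>\<close> is \<open>1 - \<omega>\<close> times \<open>p + 3m\<omega>\<close>, where
\<open>x + y = 9m\<close>, and both \<open>m\<close> and the norm of \<open>p + 3m\<omega>\<close> are cubes. Hence \<open>p + 3m\<omega>\<close> is a unit times a
cube \<open>(c + d\<omega>)\<^sup>3\<close>; divisibility of the second coordinate by \<open>3\<close> leaves only the units \<open>1\<close> and \<open>-1\<close>,
and then \<open>m = c d (c - d)\<close> up to sign. The three coprime factors are cubes and give a smaller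
solution.\<close>

lemma fermat_3_step:
  fixes x y z :: int
  assumes "x ^ 3 + y ^ 3 + z ^ 3 = 0" "coprime x y" "3 dvd z" "z \<noteq> 0" "x * y \<noteq> 0"
  shows "\<exists>x' y' z'. x' ^ 3 + y' ^ 3 + z' ^ 3 = 0 \<and> coprime x' y' \<and> x' * y' * z' \<noteq> 0
    \<and> \<bar>x' * y' * z'\<bar> < \<bar>z\<bar>"
proof -
  obtain w where w: "z = 3 * w" using assms(3) ..
  have "(x + y) mod 3 = 0"
  proof -
    have c: "x ^ 3 mod 3 = x mod 3" for x :: int
    proof -
      have "x mod 3 = 0 \<or> x mod 3 = 1 \<or> x mod 3 = 2" by presburger
      then have "(x mod 3) ^ 3 mod 3 = x mod 3" by auto
      then show ?thesis by (simp add: power_mod)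
    qed
    have "((x ^ 3 mod 3 + y ^ 3 mod 3) mod 3 + z ^ 3 mod 3) mod 3 = 0"
      unfolding mod_add_eq assms(1) by simp
    then show ?thesis unfolding c mod_add_eq using w by (simp add: mod_simps)
  qed
  then obtain s where s: "x + y = 3 * s" by auto
  have y: "y = 3 * s - x" using s by simp
  have "3 * (3 * (s * (3 * s ^ 2 - x * y))) = 3 * (3 * (- 3 * w ^ 3))"
    using assms(1) unfolding w y by (simp add: power2_eq_square power3_eq_cube algebra_simps)
  then have eq1: "s * (3 * s ^ 2 - x * y) = - 3 * w ^ 3" by simp
  have "prime (3::int)" by simp
  have nx: "\<not> 3 dvd x"
  proof
    assume "3 dvd x"
    moreover then have "3 dvd y" unfolding y by simp
    ultimately have "is_unit (3 :: int)" using assms(2) coprime_common_divisor by blast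
    then show False by simp
  qed
  have ny: "\<not> 3 dvd y"
  proof
    assume "3 dvd y"
    then have "3 dvd 3 * s - y" by simp
    then show False using nx unfolding y by simp
  qed
  have "3 dvd s * (3 * s ^ 2 - x * y)" unfolding eq1 by simp
  moreover have "\<not> 3 dvd 3 * s ^ 2 - x * y"
  proof
    assume "3 dvd 3 * s ^ 2 - x * y"
    then have "3 dvd x * y" using dvd_diff[of 3 "3 * s ^ 2" "3 * s ^ 2 - x * y"] by simp
    then show False using nx ny \<open>prime 3\<close> prime_dvd_mult_iff by blast
  qed
  ultimately have "3 dvd s" using \<open>prime 3\<close> prime_dvd_mult_iff by blast
  then obtain m where m: "s = 3 * m" ..
  define p where "p = x - 3 * m"
  have x: "x = p + 3 * m" and y: "y = 6 * m - p" using y m by (simp_all add: p_def)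
  (* The quadratic factor is the norm of p + 3 m \<omega>. *)
  have eq2: "m * (p ^ 2 - p * (3 * m) + (3 * m) ^ 2) = (- w) ^ 3"
    using eq1 unfolding m x y by (simp add: power2_eq_square power3_eq_cube algebra_simps)
  have np: "\<not> 3 dvd p" using nx unfolding x by auto
  have "coprime p m"
  proof (rule coprimeI)
    fix c assume "c dvd p" "c dvd m"
    then have "c dvd x" "c dvd y" unfolding x y by simp_all
    then show "is_unit c" using assms(2) coprime_common_divisor by blast
  qed
  moreover have "coprime p 3"
    using np \<open>prime 3\<close> by (metis coprime_commute prime_imp_coprime)
  ultimately have cop: "coprime p (3 * m)" by simp
  have "coprime m (p ^ 2 - p * (3 * m) + (3 * m) ^ 2)"
  proof (rule coprimeI)
    fix c assume c: "c dvd m" "c dvd p ^ 2 - p * (3 * m) + (3 * m) ^ 2"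
    have "c dvd (p ^ 2 - p * (3 * m) + (3 * m) ^ 2) + m * (3 * p - 9 * m)"
      using c by simp
    also have "(p ^ 2 - p * (3 * m) + (3 * m) ^ 2) + m * (3 * p - 9 * m) = p ^ 2"
      by (simp add: power2_eq_square algebra_simps)
    finally have "c dvd p ^ 2" .
    moreover have "coprime (p ^ 2) m" using \<open>coprime p m\<close> by simp
    ultimately show "is_unit c" using c(1) coprime_common_divisor by blast
  qed
  then obtain M n where M: "m = M ^ 3" and n: "p ^ 2 - p * (3 * m) + (3 * m) ^ 2 = n ^ 3"
    using coprime_mult_cube eq2 by (metis coprime_commute mult.commute)
  have "\<not> 3 dvd n"
  proof
    assume "3 dvd n"
    then have "3 dvd n ^ 3" by (simp add: power3_eq_cube)
    then have "3 dvd (p ^ 2 - p * (3 * m) + (3 * m) ^ 2) + 3 * (p * m - 3 * m ^ 2)"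
      unfolding n by simp
    then have "3 dvd p ^ 2" by (simp add: power2_eq_square algebra_simps)
    then show False using np \<open>prime 3\<close> prime_dvd_power by blast
  qed
  then obtain \<gamma> \<epsilon> where \<epsilon>: "eis_norm \<epsilon> = 1" and \<gamma>: "Eis p (3 * m) = \<epsilon> * \<gamma> ^ 3"
    using eis_cube[OF cop _ n] by blast
  define c d where "c = eis_fst \<gamma>" and "d = eis_snd \<gamma>"
  define A where "A = c ^ 3 - 3 * c * d ^ 2 + d ^ 3"
  have \<gamma>3: "\<gamma> ^ 3 = Eis A (3 * (c * d * (c - d)))"
    by (simp add: A_def c_def d_def eis_defs power3_eq_cube power2_eq_square algebra_simps)
  have "m = c * d * (c - d) \<or> m = - (c * d * (c - d))" and pA: "p = A \<or> p = - A"
    using eis_unit_cases[OF \<epsilon>] \<gamma> np unfolding \<gamma>3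
    by (auto simp: eis_defs) presburger+
  then obtain c' d' where cd: "M ^ 3 = c' * (d' * (c' - d'))" "coprime c' d'"
  proof -
    have "coprime c d"
    proof (rule coprimeI)
      fix e assume e: "e dvd c" "e dvd d"
      then have "e dvd A" "e dvd c * d * (c - d)" by (auto simp: A_def power3_eq_cube)
      then have "e dvd p" "e dvd m"
        using pA \<open>m = c * d * (c - d) \<or> m = - (c * d * (c - d))\<close> by auto
      then show "is_unit e" using \<open>coprime p m\<close> coprime_common_divisor by blast
    qed
    then have "coprime (- c) (- d)" by simp
    then show ?thesis
      using that[of c d] that[of "- c" "- d"] \<open>coprime c d\<close> M
        \<open>m = c * d * (c - d) \<or> m = - (c * d * (c - d))\<close>
      by (auto simp: algebra_simps)
  qed
  (* The sign of m is absorbed by replacing c and d by their negatives. *)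
  have c3: "coprime c' (c' - d')" "coprime d' (c' - d')"
  proof -
    have "is_unit e" if "e dvd c' \<or> e dvd d'" "e dvd c' - d'" for e
    proof -
      have "e dvd c' \<and> e dvd d'"
        using that(1) dvd_add[of e d' "c' - d'"] dvd_diff[of e c' "c' - d'"] that(2) by auto
      then have "e dvd c'" "e dvd d'" by blast+
      then show ?thesis using cd(2) coprime_common_divisor by blast
    qed
    then show "coprime c' (c' - d')" "coprime d' (c' - d')" by (auto intro!: coprimeI)
  qed
  obtain X where X: "c' = X ^ 3"
    using coprime_mult_cube[of c' "d' * (c' - d')" M] cd c3 by auto
  obtain Y where Y: "d' = Y ^ 3"
    using coprime_mult_cube[of d' "c' * (c' - d')" M] cd c3 by (auto simp: coprime_commute mult_ac)
  obtain Z where Z: "c' - d' = Z ^ 3"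
    using coprime_mult_cube[of "c' - d'" "c' * d'" M] cd c3 by (auto simp: coprime_commute mult_ac)
  have m0: "m \<noteq> 0"
    using eq2 assms(4) w by auto
  (* The new solution is (Y, Z, -X), and X Y Z = M divides z / 3. *)
  have "M ^ 3 = (X * Y * Z) ^ 3"
    unfolding cd(1) Z[symmetric] power_mult_distrib X [symmetric] Y [symmetric] by simp
  then have M': "M = X * Y * Z"
    by (rule odd_power_inject) simp
  have "M ^ 3 dvd (- w) ^ 3"
    unfolding eq2[symmetric] M by simp
  then have "M dvd w" by (metis pow_divides_pow_iff dvd_minus_iff zero_less_numeral)
  moreover have "w \<noteq> 0" using assms(4) w by simp
  ultimately have "\<bar>M\<bar> \<le> \<bar>w\<bar>" by (rule dvd_imp_le_int[rotated])
  then have "\<bar>M\<bar> < \<bar>z\<bar>" using \<open>w \<noteq> 0\<close> w by simp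
  moreover have "coprime Y Z" using c3(2) unfolding Z unfolding Y by simp
  moreover have "Y ^ 3 + Z ^ 3 + (- X) ^ 3 = 0" using X Y Z by simp
  moreover have "Y * Z * (- X) \<noteq> 0" using m0 M M' by auto
  moreover have "\<bar>Y * Z * (- X)\<bar> = \<bar>M\<bar>" unfolding M' by (simp add: abs_mult)
  ultimately show ?thesis by metis
qed

text \<open>A solution has a coordinate divisible by \<open>3\<close>, by reduction modulo \<open>9\<close>. Rotating it into the third
place starts the descent on \<open>\<bar>x y z\<bar>\<close>.\<close>

lemma fermat_3_coprime:
  fixes x y z :: int
  assumes "x ^ 3 + y ^ 3 + z ^ 3 = 0" "coprime x y"
  shows "x * y * z = 0"
  using assms
proof (induction "nat \<bar>x * y * z\<bar>" arbitrary: x y z rule: less_induct)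
  case less
  have core: "u * v * w = 0" if h: "u ^ 3 + v ^ 3 + w ^ 3 = 0" "coprime u v" "3 dvd w"
    "u * v * w = x * y * z" for u v w :: int
  proof (rule ccontr)
    assume nz: "u * v * w \<noteq> 0"
    obtain x' y' z' where *: "x' ^ 3 + y' ^ 3 + z' ^ 3 = 0" "coprime x' y'" "x' * y' * z' \<noteq> 0"
      "\<bar>x' * y' * z'\<bar> < \<bar>w\<bar>"
      using fermat_3_step[OF h(1,2,3)] nz by auto
    have "u * v \<noteq> 0" using nz by auto
    then have "1 \<le> \<bar>u * v\<bar>" by linarith
    then have "\<bar>w\<bar> \<le> \<bar>u * v\<bar> * \<bar>w\<bar>"
      using mult_right_mono[of 1 "\<bar>u * v\<bar>" "\<bar>w\<bar>"] by simp
    then have "\<bar>x' * y' * z'\<bar> < \<bar>x * y * z\<bar>" using *(4) by (simp add: abs_mult flip: h(4))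
    then have "nat \<bar>x' * y' * z'\<bar> < nat \<bar>x * y * z\<bar>" by linarith
    from less.hyps[OF this *(1,2)] *(3) show False by blast
  qed
  have cop: "coprime y z" "coprime z x"
  proof -
    have "is_unit c" if c: "prime c" "c dvd z" "c dvd x \<or> c dvd y" for c :: int
    proof -
      have "c dvd z ^ 3" "c dvd x ^ 3 \<or> c dvd y ^ 3" using c by (auto simp: power3_eq_cube)
      moreover have "x ^ 3 = - (y ^ 3 + z ^ 3)" "y ^ 3 = - (x ^ 3 + z ^ 3)" using less.prems(1) by auto
      ultimately have "c dvd x ^ 3 \<and> c dvd y ^ 3" by (metis dvd_add dvd_minus_iff)
      then have "c dvd x \<and> c dvd y" using c(1) prime_dvd_power by blast
      then show ?thesis using less.prems(2) coprime_common_divisor by blast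
    qed
    then have "\<not> (prime c \<and> c dvd z \<and> (c dvd x \<or> c dvd y))" for c :: int
      using not_prime_unit by blast
    moreover have "\<exists>c. prime c \<and> c dvd u \<and> c dvd v" if "\<not> coprime u v" for u v :: int
      using that prime_factor_int[of "gcd u v"] unfolding coprime_iff_gcd_eq_1 by auto
    ultimately show "coprime y z" "coprime z x" by metis+
  qed
  have rot: "y * z * x = x * y * z" "z * x * y = x * y * z" by simp_all
  have sums: "y ^ 3 + z ^ 3 + x ^ 3 = 0" "z ^ 3 + x ^ 3 + y ^ 3 = 0" using less.prems(1) by simp_all
  from cube_sum_imp_three_dvd[OF less.prems(1)] consider "3 dvd z" | "3 dvd x" | "3 dvd y" by blast
  then show ?case
  proof cases
    case 1
    show ?thesis by (rule core[OF less.prems 1 refl])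
  next
    case 2
    show ?thesis using core[OF sums(1) cop(1) 2 rot(1)] unfolding rot(1) .
  next
    case 3
    show ?thesis using core[OF sums(2) cop(2) 3 rot(2)] unfolding rot(2) .
  qed
qed

lemma fermat_3:
  fixes x y z :: int
  assumes "x ^ 3 + y ^ 3 = z ^ 3"
  shows "x = 0 \<or> y = 0 \<or> z = 0"
proof (cases "x = 0")
  case False
  define g where "g = gcd x y"
  have "g \<noteq> 0" using False by (simp add: g_def)
  obtain a b where ab: "x = g * a" "y = g * b" "coprime a b"
    unfolding g_def using False by (metis gcd_coprime_exists mult.commute gcd_eq_0_iff)
  have "g ^ 3 dvd z ^ 3" unfolding assms[symmetric] ab(1,2) by (simp add: power_mult_distrib)
  then obtain c where c: "z = g * c" by (metis pow_divides_pow_iff dvdE zero_less_numeral)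
  have "g ^ 3 * (a ^ 3 + b ^ 3 + (- c) ^ 3) = 0"
    using assms unfolding ab(1,2) c by (simp add: power_mult_distrib algebra_simps)
  then have "a ^ 3 + b ^ 3 + (- c) ^ 3 = 0" using \<open>g \<noteq> 0\<close> by simp
  from fermat_3_coprime[OF this ab(3)] show ?thesis unfolding ab(1,2) c by auto
qed simp

text \<open>Over the Eisenstein integers the form is \<open>- \<omega> \<alpha>\<^sup>3\<close> plus its conjugate, with \<open>\<alpha> = a + b\<omega>\<close>. For three
numbers \<open>A + \<omega>B + \<omega>\<^sup>2C = 0\<close> one has \<open>27ABC = (A + B + C)\<^sup>3 + (A + \<omega>\<^sup>2B + \<omega>C)\<^sup>3\<close>; with
\<open>A = R\<^sup>3\<close>, \<open>B = \<alpha>\<^sup>3\<close> and \<open>C\<close> the conjugate of \<open>B\<close>, the left side is a cube. This is the polynomial identity in the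
proof, which leads to Fermat's equation. Two of the three coordinates of the solution are odd, so the
third one, \<open>3ab(a - b)\<close>, vanishes.\<close>

lemma cubic_form_eq_cube:
  fixes a b R :: int
  assumes "coprime a b" "a ^ 3 + 3 * a ^ 2 * b - 6 * a * b ^ 2 + b ^ 3 = R ^ 3"
  shows "a = 0 \<or> b = 0 \<or> a = b"
proof -
  have par: "odd a \<or> odd b"
    using assms(1) by (metis coprime_common_divisor odd_one)
  then have "odd (R ^ 3)" unfolding assms(2) [symmetric] by auto
  then have "odd R" by simp
  moreover have "odd (a ^ 2 - a * b + b ^ 2)" using par by auto
  ultimately have "odd (R * (a ^ 2 - a * b + b ^ 2))" by simp
  then have Z: "R * (a ^ 2 - a * b + b ^ 2) \<noteq> 0" by (metis even_zero)
  have "odd (a ^ 3 - 3 * a * b ^ 2 + b ^ 3)" using par by auto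
  then have X: "a ^ 3 - 3 * a * b ^ 2 + b ^ 3 \<noteq> 0" by (metis even_zero)
  have "(a ^ 3 - 3 * a * b ^ 2 + b ^ 3) ^ 3 + (3 * (a * b * (a - b))) ^ 3
      = (a ^ 3 + 3 * a ^ 2 * b - 6 * a * b ^ 2 + b ^ 3) * (a ^ 2 - a * b + b ^ 2) ^ 3"
    by (simp add: power2_eq_square power3_eq_cube algebra_simps)
  also have "\<dots> = (R * (a ^ 2 - a * b + b ^ 2)) ^ 3"
    unfolding assms(2) by (simp add: power_mult_distrib)
  finally have "3 * (a * b * (a - b)) = 0"
    using fermat_3 X Z by blast
  then show ?thesis by simp
qed

text \<open>With \<open>m = (q - s\<^sup>2) / s\<^sup>2\<close> the two equations combine to
\<open>s\<^sup>3 ((1 + m)\<^sup>3 - 9m) = (m - 1) y\<^sup>3\<close>. Clearing denominators in \<open>m = a / b\<close>, the form of the preceding lemma at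
\<open>(a, b)\<close> equals \<open>(a - b) b\<^sup>2\<close> up to a rational cube and is coprime to it, so it is itself a cube.
The trivial solutions correspond to \<open>m = 0\<close> and \<open>m = 1\<close>.\<close>

lemma no_cubic_norm_relation:
  fixes s q :: rat and y :: int
  assumes eq1: "9 * s * (s ^ 2 - q) = of_int y - of_int y ^ 3"
    and eq2: "9 * q * (q ^ 2 + s * of_int y) = of_int y ^ 6 - of_int y ^ 2"
  shows "y = 0 \<or> y = 1 \<or> y = - 1"
proof (rule ccontr)
  assume y: "\<not> (y = 0 \<or> y = 1 \<or> y = - 1)"
  define Y :: rat where "Y = of_int y"
  have Y0: "Y \<noteq> 0" using y by (simp add: Y_def)
  have Y3: "Y ^ 3 \<noteq> Y"
  proof
    assume "Y ^ 3 = Y"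
    then have "Y * Y ^ 2 = Y * 1" by (simp add: power2_eq_square power3_eq_cube)
    then have "Y ^ 2 = 1" using Y0 by (metis mult_left_cancel)
    then have "Y = 1 \<or> Y = - 1" by (simp add: power2_eq_1_iff)
    then show False using y unfolding Y_def by (metis of_int_1 of_int_eq_iff of_int_minus)
  qed
  have s0: "s \<noteq> 0" using eq1 Y3 by (auto simp: Y_def)
  define m where "m = (q - s ^ 2) / s ^ 2"
  have q: "q = s ^ 2 * (1 + m)" using s0 by (simp add: m_def field_simps)
  have e1: "9 * s ^ 3 * m = Y ^ 3 - Y"
    using eq1 unfolding q Y_def by (simp add: power2_eq_square power3_eq_cube algebra_simps)
  have "9 * s ^ 3 * (s ^ 3 * (1 + m) ^ 3 + (1 + m) * Y) = (Y ^ 3 - Y) * (Y ^ 3 + Y)"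
    using eq2 unfolding q Y_def by (simp add: power2_eq_square power3_eq_cube eval_nat_numeral algebra_simps)
  then have "9 * s ^ 3 * (s ^ 3 * (1 + m) ^ 3 + (1 + m) * Y) = 9 * s ^ 3 * (m * (Y ^ 3 + Y))"
    unfolding e1 [symmetric] by simp
  then have "s ^ 3 * (1 + m) ^ 3 + (1 + m) * Y = m * (Y ^ 3 + Y)"
    using s0 by simp
  then have key: "s ^ 3 * ((1 + m) ^ 3 - 9 * m) = (m - 1) * Y ^ 3"
    using e1 by (simp add: algebra_simps)
  obtain a b where ab: "m = of_int a / of_int b" "coprime a b" "b > 0"
    by (metis Rat_cases Fract_of_int_quotient)
  define g where "g = a ^ 3 + 3 * a ^ 2 * b - 6 * a * b ^ 2 + b ^ 3"
  obtain u w where uw: "s / Y = of_int u / of_int w" "coprime u w" "w > 0"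
    by (metis Rat_cases Fract_of_int_quotient)
  have b0: "(of_int b :: rat) \<noteq> 0" and w0: "(of_int w :: rat) \<noteq> 0" using ab uw by simp_all
  (* The remaining steps clear denominators: u / w is the reduced form of s / y. *)
  have clear: "U ^ 3 * (B * T) = (B * S) * W ^ 3" if "W \<noteq> 0" "(U / W) ^ 3 * T = S" for U W T S B :: rat
    using that by (auto simp: power_divide)
  have "(s / Y) ^ 3 * ((1 + m) ^ 3 - 9 * m) = m - 1"
    using key Y0 by (simp add: power_divide)
  then have "(of_int u / of_int w) ^ 3 * ((1 + of_int a / of_int b) ^ 3 - 9 * (of_int a / of_int b))
      = (of_int a / of_int b - 1 :: rat)"
    unfolding ab(1) uw(1) by simp
  then have "of_int u ^ 3 * (of_int b ^ 3 * ((1 + of_int a / of_int b) ^ 3 - 9 * (of_int a / of_int b)))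
      = (of_int b ^ 3 * (of_int a / of_int b - 1)) * (of_int w ^ 3 :: rat)"
    by (rule clear[OF w0])
  moreover have "of_int b ^ 3 * ((1 + of_int a / of_int b) ^ 3 - 9 * (of_int a / of_int b)) = (of_int g :: rat)"
  proof -
    have "of_int b ^ 3 * ((1 + of_int a / of_int b) ^ 3 - 9 * (of_int a / of_int b))
        = (of_int b * (1 + of_int a / of_int b)) ^ 3
          - 9 * (of_int b * (of_int a / of_int b)) * (of_int b ^ 2 :: rat)"
      by (simp add: power_mult_distrib right_diff_distrib power2_eq_square power3_eq_cube)
    also have "of_int b * (of_int a / of_int b) = (of_int a :: rat)" using b0 by simp
    also have "of_int b * (1 + of_int a / of_int b) = (of_int a + of_int b :: rat)"
      using b0 by (simp add: distrib_left)
    finally show ?thesis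
      by (simp add: g_def power2_eq_square power3_eq_cube algebra_simps)
  qed
  moreover have "of_int b ^ 3 * (of_int a / of_int b - 1) = (of_int a - of_int b) * (of_int b ^ 2 :: rat)"
    using b0 by (simp add: power2_eq_square power3_eq_cube field_simps)
  ultimately have "(of_int u ^ 3 * of_int g :: rat) = (of_int a - of_int b) * of_int b ^ 2 * of_int w ^ 3"
    by simp
  then have "(of_int (u ^ 3 * g) :: rat) = of_int ((a - b) * b ^ 2 * w ^ 3)" by simp
  then have eq: "u ^ 3 * g = (a - b) * b ^ 2 * w ^ 3" by (simp only: of_int_eq_iff)
  have cop_b: "coprime g b"
  proof (rule coprimeI)
    fix e assume e: "e dvd g" "e dvd b"
    then have "e dvd g - b * (3 * a ^ 2 - 6 * a * b + b ^ 2)" by simp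
    also have "\<dots> = a ^ 3" by (simp add: g_def power2_eq_square power3_eq_cube algebra_simps)
    finally have "e dvd a ^ 3" .
    moreover have "coprime (a ^ 3) b" using ab(2) by simp
    ultimately show "is_unit e" using e(2) coprime_common_divisor by blast
  qed
  have "coprime g (a - b)"
  proof (rule coprimeI)
    fix e assume e: "e dvd g" "e dvd a - b"
    then have "e dvd (a - b) * (a ^ 2 + 4 * a * b - 2 * b ^ 2) - g" by simp
    also have "\<dots> = b ^ 3" by (simp add: g_def power2_eq_square power3_eq_cube algebra_simps)
    finally have "e dvd b ^ 3" .
    moreover have "coprime (b ^ 3) g" using cop_b by (simp add: coprime_commute)
    ultimately show "is_unit e" using e(1) coprime_common_divisor by blast
  qed
  with cop_b have "coprime g ((a - b) * b ^ 2)" by simp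
  moreover have "g dvd (a - b) * b ^ 2 * w ^ 3" unfolding eq [symmetric] by simp
  ultimately have "g dvd w ^ 3" using coprime_dvd_mult_right_iff by blast
  moreover have "w ^ 3 dvd g"
  proof -
    have "w ^ 3 dvd u ^ 3 * g" unfolding eq by simp
    moreover have "coprime (w ^ 3) (u ^ 3)" using uw(2) by (simp add: coprime_commute)
    ultimately show ?thesis using coprime_dvd_mult_right_iff by blast
  qed
  ultimately have "\<bar>g\<bar> = \<bar>w ^ 3\<bar>" using zdvd_antisym_abs by blast
  then have "g = w ^ 3 \<or> g = (- w) ^ 3" by (auto simp: abs_eq_iff)
  then have "a = 0 \<or> b = 0 \<or> a = b" using cubic_form_eq_cube[OF ab(2)] unfolding g_def by blast
  then have "m = 0 \<or> m = 1" using ab by auto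
  then show False using e1 key Y3 s0 by auto
qed

section \<open>Values of iterates in degree at least three\<close>

lemma not_has_prime_root_2: "\<not> has_prime_root d 2"
proof
  assume "has_prime_root d 2"
  then obtain p y where p: "prime p" "(2 :: int) = y ^ p" by (auto simp: has_prime_root_def)
  have "\<bar>y\<bar> ^ p = 2" using p(2) by (metis abs_numeral power_abs)
  moreover have "p \<ge> 2" using p(1) prime_ge_2_nat by blast
  moreover have "\<bar>y\<bar> ^ p \<ge> 2 ^ p" if "\<bar>y\<bar> \<ge> 2" using that by (intro power_mono) auto
  moreover have "(2::int) ^ p \<ge> 2 ^ 2" using \<open>p \<ge> 2\<close> by (intro power_increasing) auto
  moreover have "\<bar>y\<bar> ^ p \<le> 1 ^ p" if "\<bar>y\<bar> \<le> 1" using that by (intro power_mono) auto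
  ultimately show False by (cases "\<bar>y\<bar> \<ge> 2") auto
qed

lemma abs_le_1_if_power_small:
  fixes w :: int
  assumes "d \<ge> 3" "\<bar>w ^ d\<bar> < 8"
  shows "\<bar>w\<bar> \<le> 1"
proof (rule ccontr)
  assume "\<not> \<bar>w\<bar> \<le> 1"
  then have "2 ^ d \<le> \<bar>w\<bar> ^ d" by (intro power_mono) auto
  moreover have "(2::int) ^ 3 \<le> 2 ^ d" using assms(1) by (intro power_increasing) auto
  ultimately show False using assms(2) by (simp add: power_abs)
qed

text \<open>The \<open>p\<close>-th powers \<open>u\<^sup>d\<close> and \<open>u\<^sup>d + c\<close> are distinct, so their distance is at least
\<open>\<bar>u\<bar>\<^sup>e\<close> with \<open>e = d - d/p\<close>, and \<open>e \<ge> 2\<close> because \<open>d \<ge> 3\<close>.\<close>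

lemma has_prime_root_bound:
  assumes "d \<ge> 3" "c \<noteq> 0" "has_prime_root d (u ^ d + c)"
  shows "u ^ 2 \<le> \<bar>c\<bar>"
proof (cases "u = 0")
  case False
  obtain p z where p: "prime p" "p dvd d" "u ^ d + c = z ^ p"
    using assms(3) by (auto simp: has_prime_root_def)
  obtain e where e: "d = p * e" using p(2) ..
  have p2: "p \<ge> 2" using p(1) prime_ge_2_nat by blast
  define w where "w = u ^ e"
  have w: "u ^ d = w ^ p" by (simp add: w_def e power_mult mult.commute)
  have "z ^ p \<noteq> w ^ p" using p(3) assms(2) w by auto
  then have "\<bar>w\<bar> ^ (p - 2) * (2 * \<bar>w\<bar> - 1) \<le> \<bar>z ^ p - w ^ p\<bar>"
    using power_gap[OF p2] by blast
  also have "z ^ p - w ^ p = c" using p(3) w by simp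
  finally have *: "\<bar>w\<bar> ^ (p - 2) * (2 * \<bar>w\<bar> - 1) \<le> \<bar>c\<bar>" .
  have "w \<noteq> 0" using False by (simp add: w_def)
  then have "\<bar>w\<bar> \<ge> 1" by linarith
  then have "\<bar>w\<bar> ^ (p - 2) * \<bar>w\<bar> \<le> \<bar>w\<bar> ^ (p - 2) * (2 * \<bar>w\<bar> - 1)"
    by (intro mult_left_mono) auto
  also have "\<bar>w\<bar> ^ (p - 2) * \<bar>w\<bar> = \<bar>w\<bar> ^ (p - 1)"
    using p2 by (metis Suc_diff_Suc Suc_1 Suc_le_lessD diff_Suc_1 power_Suc2 minus_nat.simps(1) numeral_2_eq_2 One_nat_def)
  also have "\<bar>w\<bar> ^ (p - 1) = \<bar>u\<bar> ^ (e * (p - 1))"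
    by (simp add: w_def power_abs power_mult)
  finally have "\<bar>u\<bar> ^ (e * (p - 1)) \<le> \<bar>c\<bar>" using * by linarith
  moreover have "\<bar>u\<bar> ^ 2 \<le> \<bar>u\<bar> ^ (e * (p - 1))"
  proof (rule power_increasing)
    show "2 \<le> e * (p - 1)"
    proof (cases "p = 2")
      case False
      then have "p - 1 \<ge> 2" using p2 by simp
      moreover have "e \<ge> 1" using e assms(1) by (cases e) auto
      ultimately show ?thesis using mult_le_mono[of 1 e 2 "p - 1"] by simp
    qed (use e assms(1) in simp)
  qed (use False in auto)
  ultimately show ?thesis by simp
qed (use assms in simp)

text \<open>In the applications \<open>x\<^sup>d - y\<^sup>d\<close> is a difference of two orbit points \<open>y\<close> and \<open>z\<close>; if it is not zero,
then \<open>z\<close> must be as large as the gap around \<open>y\<^sup>d\<close>.\<close>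

lemma power_gap_large:
  fixes x y z :: int
  assumes "d \<ge> 3" "x ^ d \<noteq> y ^ d" "\<bar>x ^ d - y ^ d\<bar> \<le> \<bar>y\<bar> + \<bar>z\<bar>" "\<bar>y\<bar> \<ge> 2"
  shows "\<bar>y\<bar> ^ (d - 1) \<le> \<bar>z\<bar>"
proof -
  define Y P where "Y = \<bar>y\<bar>" and "P = \<bar>y\<bar> ^ (d - 2)"
  have "P * (2 * Y - 1) \<le> \<bar>x ^ d - y ^ d\<bar>"
    unfolding P_def Y_def using assms(1,2) by (intro power_gap) auto
  then have 1: "P * (2 * Y - 1) \<le> Y + \<bar>z\<bar>" using assms(3) by (simp add: Y_def)
  have "Y ^ 1 \<le> P"
    unfolding P_def Y_def using assms(1,4) by (intro power_increasing) auto
  then have "P \<ge> 2" using assms(4) by (simp add: Y_def)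
  then have "2 * (Y - 1) \<le> P * (Y - 1)"
    using assms(4) by (intro mult_right_mono) (auto simp: Y_def)
  moreover have "2 * (Y - 1) \<ge> Y" using assms(4) by (simp add: Y_def)
  ultimately have "P * (Y - 1) \<ge> Y" by (rule order_trans[rotated])
  with 1 have "P * Y \<le> \<bar>z\<bar>" by (simp add: algebra_simps)
  moreover have "P * Y = Y ^ (d - 1)"
    using assms(1) unfolding P_def Y_def
    by (metis Suc_diff_Suc power_Suc2 Suc_1 diff_Suc_1 numeral_3_eq_3 Suc_le_lessD less_Suc_eq_le One_nat_def le_eq_less_or_eq)
  ultimately show ?thesis by (simp add: Y_def)
qed

text \<open>If \<open>w\<^sup>d \<noteq> v\<^sup>d\<close> and \<open>\<bar>v\<bar> \<ge> 2\<close>, the gap gives \<open>\<bar>u\<bar> \<ge> \<bar>v\<bar>\<^sup>d\<^sup>-\<^sup>1\<close>, whereas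
\<open>u\<^sup>2 \<le> \<bar>c\<bar> \<le> \<bar>v\<bar>\<^sup>d + \<bar>u\<bar>\<close> gives \<open>\<bar>u\<bar> \<le> \<bar>v\<bar> + 1\<close>. For \<open>\<bar>v\<bar> \<le> 1\<close> only \<open>\<bar>c\<bar> \<le> 2\<close> is possible, and these values
are checked by hand.\<close>

lemma third_iterate_power_imp_fixed_point:
  fixes w :: int
  assumes d: "d \<ge> 3" and c: "c \<noteq> 0" "\<not> has_prime_root d (- c)"
    and pp: "has_prime_root d (eval_word d [c, c, c] w)"
  defines "v \<equiv> w ^ d + c"
  shows "c = v - v ^ d" "w ^ d = v ^ d" "has_prime_root d v"
proof -
  define u where "u = v ^ d + c"
  have "has_prime_root d (u ^ d + c)" using pp by (simp add: u_def v_def)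
  then have u2: "u ^ 2 \<le> \<bar>c\<bar>" using has_prime_root_bound d c(1) by blast
  have cm1: "c \<noteq> -1" using c(2) has_prime_root_1[of d] d by auto
  have diff: "w ^ d - v ^ d = v - u" by (simp add: u_def v_def)
  show "w ^ d = v ^ d"
  proof (rule ccontr)
    assume ne: "w ^ d \<noteq> v ^ d"
    show False
    proof (cases "\<bar>v\<bar> \<ge> 2")
      case True
      have "\<bar>w ^ d - v ^ d\<bar> \<le> \<bar>v\<bar> + \<bar>u\<bar>" unfolding diff by linarith
      then have "\<bar>v\<bar> ^ (d - 1) \<le> \<bar>u\<bar>" using power_gap_large d ne True by blast
      moreover have "\<bar>v\<bar> ^ 2 \<le> \<bar>v\<bar> ^ (d - 1)" using True d by (intro power_increasing) auto
      moreover have "\<bar>v\<bar> ^ 2 \<ge> 2 * \<bar>v\<bar>" using True mult_abs_le_square[of 2 v] by simp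
      ultimately have uv: "\<bar>u\<bar> \<ge> \<bar>v\<bar> + 2" "\<bar>v\<bar> ^ (d - 1) \<le> \<bar>u\<bar>" using True by linarith+
      have "\<bar>c\<bar> \<le> \<bar>v ^ d\<bar> + \<bar>u\<bar>" by (simp add: u_def)
      also have "\<bar>v ^ d\<bar> = \<bar>v\<bar> ^ (d - 1) * \<bar>v\<bar>"
        using d by (metis One_nat_def Suc_pred le_0_eq not_gr0 numeral_3_eq_3 power_Suc2 power_abs nat.distinct(1))
      also have "\<dots> \<le> \<bar>u\<bar> * \<bar>v\<bar>" using uv(2) by (intro mult_right_mono) auto
      finally have "\<bar>u\<bar> ^ 2 \<le> \<bar>u\<bar> * (\<bar>v\<bar> + 1)"
        using u2 by (simp add: algebra_simps)
      then have "\<bar>u\<bar> * \<bar>u\<bar> \<le> \<bar>u\<bar> * (\<bar>v\<bar> + 1)" by (simp only: power2_eq_square)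
      moreover have "\<bar>u\<bar> > 0" using uv(1) by linarith
      ultimately have "\<bar>u\<bar> \<le> \<bar>v\<bar> + 1" by (simp only: mult_le_cancel_left_pos)
      then show False using uv(1) by linarith
    next
      case False
      then consider "v = 0" | "v = 1" | "v = -1" by linarith
      then show False
      proof cases
        case 1
        then have "u = c" using d by (simp add: u_def)
        then have "\<not> 2 \<le> \<bar>c\<bar>" using u2 mult_abs_le_square[of 2 c] by auto
        then have "c = 1" using c(1) cm1 by linarith
        then show False using \<open>has_prime_root d (u ^ d + c)\<close> \<open>u = c\<close> not_has_prime_root_2 by simp
      next
        case 2
        then have u: "u = 1 + c" "w ^ d = 1 - c" using v_def by (simp_all add: u_def)
        have "\<bar>c\<bar> \<le> 2"
        proof (rule ccontr)
          assume "\<not> \<bar>c\<bar> \<le> 2"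
          then have "\<bar>u\<bar> \<ge> 2" "\<bar>u\<bar> \<ge> \<bar>c\<bar> - 1" using u by linarith+
          then have "u ^ 2 \<ge> 2 * \<bar>u\<bar>" by (intro mult_abs_le_square) auto
          then show False using u2 \<open>\<bar>u\<bar> \<ge> \<bar>c\<bar> - 1\<close> \<open>\<not> \<bar>c\<bar> \<le> 2\<close> by linarith
        qed
        then consider "c = 1" | "c = 2" | "c = -2" using c(1) cm1 by linarith
        then show False
        proof cases
          case 3
          then have "w ^ d = 3" using u by simp
          then have "\<bar>w\<bar> \<le> 1" using abs_le_1_if_power_small d by simp
          then have "w = 0 \<or> w = 1 \<or> w = -1" by linarith
          then show False using \<open>w ^ d = 3\<close> d by (auto simp: minus_one_power_iff power_0_left split: if_splits)
        qed (use u2 u in auto)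
      next
        case 3
        then have u: "u = (-1) ^ d + c" "w ^ d = -1 - c" using v_def by (simp_all add: u_def)
        have "\<bar>c\<bar> \<le> 2"
        proof (rule ccontr)
          assume "\<not> \<bar>c\<bar> \<le> 2"
          then have "\<bar>u\<bar> \<ge> 2" "\<bar>u\<bar> \<ge> \<bar>c\<bar> - 1" using u by (auto simp: minus_one_power_iff split: if_splits)
          then have "u ^ 2 \<ge> 2 * \<bar>u\<bar>" by (intro mult_abs_le_square) auto
          then show False using u2 \<open>\<bar>u\<bar> \<ge> \<bar>c\<bar> - 1\<close> \<open>\<not> \<bar>c\<bar> \<le> 2\<close> by linarith
        qed
        then have cs: "c = 1 \<or> c = 2 \<or> c = -2" using c(1) cm1 by linarith
        then have "\<bar>w\<bar> \<le> 1" using abs_le_1_if_power_small[OF d, of w] u(2) by auto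
        then have "w = 0 \<or> w = 1 \<or> w = -1" by linarith
        then have "c = -2 \<and> w ^ d = 1" using cs u(2) d by (auto simp: minus_one_power_iff power_0_left split: if_splits)
        then show False using ne u2 u 3 by (auto simp: minus_one_power_iff split: if_splits)
      qed
    qed
  qed
  then have "u = v" using diff by simp
  then show "c = v - v ^ d" by (simp add: u_def)
  show "has_prime_root d v" using \<open>has_prime_root d (u ^ d + c)\<close> \<open>u = v\<close> u_def by simp
qed

text \<open>The orbit of \<open>0\<close> never returns below \<open>\<bar>c\<bar>\<close> in absolute value, which is incompatible with
\<open>u\<^sup>2 \<le> \<bar>c\<bar>\<close> except for \<open>c = 1\<close>, where the value in question is \<open>2\<close>.\<close>

lemma iterates_not_has_prime_root:
  assumes d: "d \<ge> 3" and c: "c \<noteq> 0" "\<not> has_prime_root d (- c)"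
  shows "\<not> has_prime_root d (eval_word d (replicate (Suc (Suc n)) c) 0)"
proof
  define a where "a = eval_word d (replicate (Suc n) c) 0"
  have cm1: "c \<noteq> -1" using c(2) has_prime_root_1[of d] d by auto
  assume "has_prime_root d (eval_word d (replicate (Suc (Suc n)) c) 0)"
  then have pp: "has_prime_root d (a ^ d + c)" by (simp add: a_def)
  then have a2: "a ^ 2 \<le> \<bar>c\<bar>" using has_prime_root_bound d c(1) by blast
  have grow: "\<bar>c\<bar> \<le> \<bar>eval_word d (replicate (Suc m) c) 0\<bar>
    \<and> (c = 1 \<longrightarrow> 1 \<le> eval_word d (replicate (Suc m) c) 0)" for m
  proof (induction m)
    case (Suc m)
    define b where "b = eval_word d (replicate (Suc m) c) 0"
    have b: "\<bar>c\<bar> \<le> \<bar>b\<bar>" "c = 1 \<longrightarrow> 1 \<le> b" using Suc by (simp_all add: b_def)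
    show ?case
    proof (cases "c = 1")
      case True
      then have "1 \<le> b ^ d + c" using b(2) one_le_power[of b d] by simp
      moreover have "eval_word d (replicate (Suc (Suc m)) c) 0 = b ^ d + c" by (simp add: b_def)
      ultimately show ?thesis using True by simp
    next
      case False
      then have "\<bar>b\<bar> \<ge> 2" using b(1) c(1) cm1 by linarith
      then have "2 * \<bar>b\<bar> \<le> \<bar>b\<bar> ^ 2" using mult_abs_le_square[of 2 b] by simp
      also have "\<dots> \<le> \<bar>b\<bar> ^ d" using \<open>\<bar>b\<bar> \<ge> 2\<close> d by (intro power_increasing) auto
      finally have "2 * \<bar>b\<bar> \<le> \<bar>b ^ d\<bar>" by (simp add: power_abs)
      then have "\<bar>c\<bar> \<le> \<bar>b ^ d + c\<bar>" using b(1) by linarith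
      moreover have "eval_word d (replicate (Suc (Suc m)) c) 0 = b ^ d + c" by (simp add: b_def)
      ultimately show ?thesis using False by simp
    qed
  qed (use d in \<open>simp add: power_0_left\<close>)
  have a: "\<bar>c\<bar> \<le> \<bar>a\<bar>" "c = 1 \<longrightarrow> 1 \<le> a" using grow[of n] by (simp_all add: a_def)
  have "\<not> 2 \<le> \<bar>a\<bar>" using a2 a(1) mult_abs_le_square[of 2 a] by auto
  then have "c = 1" "a = 1" using a c(1) cm1 by linarith+
  then show False using pp not_has_prime_root_2 by simp
qed

lemma fixed_point_unique:
  fixes v v' :: int
  assumes d: "d \<ge> 3" and "v - v ^ d = v' - v' ^ d" "v - v ^ d \<noteq> 0"
  shows "v = v'"
proof -
  have wlog: "x = y" if h: "x - x ^ d = y - y ^ d" "x - x ^ d \<noteq> 0" "\<bar>y\<bar> \<le> \<bar>x\<bar>" for x y :: int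
  proof (rule ccontr)
    assume ne: "x \<noteq> y"
    then have "y ^ d \<noteq> x ^ d" using h(1) by auto
    show False
    proof (cases "\<bar>x\<bar> \<ge> 2")
      case True
      have "\<bar>y ^ d - x ^ d\<bar> \<le> \<bar>x\<bar> + \<bar>x\<bar>" using h(1,3) by linarith
      then have "\<bar>x\<bar> ^ (d - 1) \<le> \<bar>x\<bar>" using power_gap_large d \<open>y ^ d \<noteq> x ^ d\<close> True by blast
      moreover have "\<bar>x\<bar> ^ 2 \<le> \<bar>x\<bar> ^ (d - 1)" using True d by (intro power_increasing) auto
      moreover have "\<bar>x\<bar> ^ 2 \<ge> 2 * \<bar>x\<bar>" using True mult_abs_le_square[of 2 x] by simp
      ultimately show False using True by linarith
    next
      case False
      then have "x = 0 \<or> x = 1 \<or> x = -1" "y = 0 \<or> y = 1 \<or> y = -1" using h(3) by linarith+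
      then show False using h(1,2) ne d by (auto simp: minus_one_power_iff power_0_left split: if_splits)
    qed
  qed
  show ?thesis
    using wlog[of v v'] wlog[of v' v] assms(2,3) by (cases "\<bar>v'\<bar> \<le> \<bar>v\<bar>") auto
qed

lemma third_iterate_power:
  fixes w :: int
  assumes "d \<ge> 3" "v - v ^ d \<noteq> 0" "\<not> has_prime_root d (- (v - v ^ d))"
    and "has_prime_root d (eval_word d [v - v ^ d, v - v ^ d, v - v ^ d] w)"
  shows "w ^ d = v ^ d"
  using third_iterate_power_imp_fixed_point[OF assms] fixed_point_unique[OF assms(1) _ assms(2)]
  by metis

text \<open>Let \<open>x = f\<^sub>b(t)\<close> and \<open>f\<^sub>b(x) = w\<^sub>0\<close> with \<open>\<bar>w\<^sub>0\<bar> = \<bar>v\<bar>\<close>. As \<open>b\<close> is off the list, \<open>x \<noteq> 0\<close> and \<open>x \<noteq> w\<^sub>0\<close>, so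
\<open>x\<^sup>d - t\<^sup>d = w\<^sub>0 - x\<close> does not vanish and \<open>x\<close> is small: \<open>\<bar>x\<bar>\<^sup>d\<^sup>-\<^sup>1 \<le> \<bar>v\<bar>\<close>. If also \<open>x' = f\<^sub>c(t')\<close> is mapped to
\<open>w\<^sub>1\<close> by \<open>f\<^sub>b\<close>, then \<open>x'\<^sup>d\<close> differs from \<open>x\<^sup>d\<close> by at most \<open>2\<bar>v\<bar>\<close>, so \<open>x'\<close> is small too. But for
\<open>\<bar>v\<bar> \<ge> 2\<close> the values of \<open>f\<^sub>c\<close> are either \<open>v\<close> or at least of size \<open>\<bar>v\<bar>\<^sup>d\<^sup>-\<^sup>1\<close>. For \<open>v = -1\<close> the bound on \<open>x\<close>
puts \<open>b\<close> on the list.\<close>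

lemma never_power_extension_off_list:
  fixes b v :: int
  assumes d: "d \<ge> 3" and c: "c = v - v ^ d" "c \<noteq> 0" "\<not> has_prime_root d (- c)"
    and b: "b ^ d \<noteq> v ^ d" "\<And>w. w ^ d = v ^ d \<Longrightarrow> b \<noteq> w - w ^ d"
  shows "(\<forall>t. \<not> has_prime_root d (eval_word d [c, c, c, b, b] t)) \<or> (\<forall>t. \<not> has_prime_root d (eval_word d [c, c, c, b, c] t))"
proof (rule ccontr)
  assume "\<not> ?thesis"
  then obtain t t' where t: "has_prime_root d (eval_word d [c, c, c, b, b] t)" "has_prime_root d (eval_word d [c, c, c, b, c] t')"
    by blast
  define x w0 x' w1 where "x = t ^ d + b" and "w0 = x ^ d + b" and "x' = t' ^ d + c" and "w1 = x' ^ d + b"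
  have "has_prime_root d (eval_word d [c, c, c] w0)" "has_prime_root d (eval_word d [c, c, c] w1)"
    using t by (simp_all add: x_def w0_def x'_def w1_def)
  then have w: "w0 ^ d = v ^ d" "w1 ^ d = v ^ d"
    using third_iterate_power d c by blast+
  then have absw: "\<bar>w0\<bar> = \<bar>v\<bar>" "\<bar>w1\<bar> = \<bar>v\<bar>"
    using power_eq_imp_abs_eq d by force+
  define V X X' where "V = \<bar>v\<bar>" and "X = \<bar>x\<bar>" and "X' = \<bar>x'\<bar>"
  have "v \<noteq> 0" using c(1,2) d by auto
  then have V1: "V \<ge> 1" by (simp add: V_def)
  have "x \<noteq> 0"
  proof
    assume "x = 0"
    then have "w0 = b" using d by (simp add: w0_def)
    then show False using b(1) w(1) by simp
  qed
  then have X1: "X \<ge> 1" by (simp add: X_def)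
  have "x \<noteq> w0" using b(2)[OF w(1)] by (auto simp: w0_def)
  then have ne: "t ^ d \<noteq> x ^ d" by (simp add: x_def w0_def)
  have XV: "X ^ (d - 1) \<le> V"
  proof (cases "X \<ge> 2")
    case True
    have "\<bar>t ^ d - x ^ d\<bar> \<le> \<bar>x\<bar> + \<bar>v\<bar>" using absw by (simp add: x_def w0_def)
    then show ?thesis using power_gap_large[OF d ne] True by (simp add: X_def V_def)
  next
    case False
    then have "X = 1" using X1 by simp
    then show ?thesis using V1 by simp
  qed
  have X2V: "X ^ 2 \<le> V"
    using XV X1 d power_increasing[of 2 "d - 1" X] by linarith
  show False
  proof (cases "V \<ge> 2")
    case False
    then have "V = 1" using V1 by simp
    then have "v = 1 \<or> v = -1" by (auto simp: V_def)
    then have "v = -1" using c(1,2) by auto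
    then have ev: "even d" using c(1,2) by (auto simp: minus_one_power_iff split: if_splits)
    have "X = 1" using X2V X1 \<open>V = 1\<close> by (smt (verit) power2_eq_square mult_le_cancel_left1)
    then have "x ^ d = 1" using ev by (auto simp: X_def abs_if split: if_splits)
    moreover have "w0 ^ d = 1" using w(1) \<open>v = -1\<close> ev by simp
    ultimately show False using b(2)[OF w(1)] by (simp add: w0_def)
  next
    case True
    have "X * 1 \<le> X * X" using X1 by (intro mult_left_mono) auto
    then have X_le: "X \<le> V" using X2V by (simp add: power2_eq_square)
    have "X ^ d = X ^ (d - 1) * X" using d by (simp add: power_eq_if mult.commute)
    also have "\<dots> \<le> V * X" using XV X1 by (intro mult_right_mono) auto
    finally have Xd: "X ^ d \<le> V * X" .
    have "x' ^ d - x ^ d = w1 - w0" by (simp add: w0_def w1_def)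
    then have "\<bar>x' ^ d\<bar> \<le> \<bar>x ^ d\<bar> + 2 * V" using absw by (simp add: V_def)
    then have X'd: "X' ^ d \<le> V * X + 2 * V" using Xd by (simp add: X_def X'_def power_abs)
    show False
    proof (cases "t' ^ d = v ^ d")
      case True
      then have "x' = v" using c(1) by (simp add: x'_def)
      have "V ^ d = V * V ^ (d - 1)" using d by (simp add: power_eq_if)
      then have "V * V ^ (d - 1) \<le> V * (X + 2)"
        using X'd \<open>x' = v\<close> by (simp add: X'_def V_def algebra_simps)
      then have "V ^ (d - 1) \<le> X + 2" using V1 by simp
      then have "V ^ 2 \<le> X + 2"
        using V1 d power_increasing[of 2 "d - 1" V] by linarith
      moreover have "2 * V \<le> V ^ 2" using \<open>V \<ge> 2\<close> by (simp add: power2_eq_square mult_right_mono)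
      ultimately have "V = 2" "X = 2" using X_le \<open>V \<ge> 2\<close> by linarith+
      then show False using X2V by simp
    next
      case False
      have "\<bar>t' ^ d - v ^ d\<bar> \<le> \<bar>v\<bar> + \<bar>x'\<bar>" using c(1) by (simp add: x'_def)
      then have "V ^ (d - 1) \<le> X'" using power_gap_large[OF d False] True by (simp add: V_def X'_def)
      then have VX': "V ^ 2 \<le> X'"
        using V1 d power_increasing[of 2 "d - 1" V] by linarith
      have V2: "2 * V \<le> V ^ 2" using True by (simp add: power2_eq_square mult_right_mono)
      have X'4: "X' \<ge> 4" using VX' V2 True by linarith
      have "X' ^ 2 \<le> X' ^ d" using X'4 d by (intro power_increasing) auto
      moreover have "4 * X' \<le> X' ^ 2" using X'4 by (simp add: power2_eq_square mult_right_mono)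
      moreover have "V * X \<le> V * V" using X_le V1 by (intro mult_left_mono) auto
      ultimately show False using X'd VX' V2 X'4 unfolding power2_eq_square[of V] by linarith
    qed
  qed
qed

text \<open>This serves the case \<open>d = 3\<close>, with the word \<open>f\<^sub>c \<circ> f\<^sub>v \<circ> f\<^sub>c\<close>. Values of \<open>f\<^sub>c\<close> have absolute value at
least \<open>\<bar>v\<bar>\<close>, so \<open>f\<^sub>v\<close> maps them far outside the range \<open>u\<^sup>2 \<le> \<bar>v - v\<^sup>d\<bar>\<close>.\<close>

lemma fixed_zero_fixed_not_has_prime_root:
  fixes v :: int
  assumes d: "d \<ge> 3" and v: "\<bar>v\<bar> \<ge> 2"
  shows "\<not> has_prime_root d (eval_word d [v - v ^ d, v, v - v ^ d] t)"
proof
  define x u where "x = t ^ d + (v - v ^ d)" and "u = x ^ d + v"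
  assume "has_prime_root d (eval_word d [v - v ^ d, v, v - v ^ d] t)"
  then have pp: "has_prime_root d (u ^ d + (v - v ^ d))" by (simp add: x_def u_def)
  define V Q where "V = \<bar>v\<bar>" and "Q = \<bar>v ^ d\<bar>"
  have Q: "Q = V ^ d" by (simp add: V_def Q_def power_abs)
  have "V ^ 2 \<le> V ^ (d - 1)" using v d by (intro power_increasing) (auto simp: V_def)
  then have "V * V ^ 2 \<le> V * V ^ (d - 1)" using v by (intro mult_left_mono) (auto simp: V_def)
  moreover have "V ^ d = V * V ^ (d - 1)" using d by (simp add: power_eq_if)
  moreover have "V * 4 \<le> V * V ^ 2"
    using v power_mono[of 2 V 2] by (intro mult_left_mono) (auto simp: V_def)
  ultimately have Q4: "4 * V \<le> Q" by (simp add: Q)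
  have V2: "V \<ge> 2" using v by (simp add: V_def)
  have "v - v ^ d \<noteq> 0" using Q4 V2 by (auto simp: Q_def V_def)
  then have u2: "u ^ 2 \<le> \<bar>v - v ^ d\<bar>" using has_prime_root_bound[OF d _ pp] by simp
  also have "\<dots> \<le> Q + V" by (simp add: Q_def V_def)
  finally have u2: "u ^ 2 \<le> Q + V" .
  have big: False if "\<bar>u\<bar> \<ge> Q - V"
  proof -
    have "\<bar>u\<bar> \<ge> 3" using that Q4 V2 by linarith
    then have "3 * \<bar>u\<bar> \<le> u ^ 2" by (intro mult_abs_le_square) auto
    then show False using that u2 Q4 V2 by linarith
  qed
  show False
  proof (cases "t ^ d = v ^ d")
    case True
    then have "u = v ^ d + v" by (simp add: u_def x_def)
    then have "\<bar>u\<bar> \<ge> Q - V" by (simp add: Q_def V_def)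
    then show False by (rule big)
  next
    case False
    have "\<bar>t ^ d - v ^ d\<bar> \<le> \<bar>v\<bar> + \<bar>x\<bar>" by (simp add: x_def)
    then have "V ^ (d - 1) \<le> \<bar>x\<bar>" using power_gap_large[OF d False] v by (simp add: V_def)
    moreover have "V ^ 1 \<le> V ^ (d - 1)" using V2 d by (intro power_increasing) auto
    ultimately have "V \<le> \<bar>x\<bar>" by simp
    then have "Q \<le> \<bar>x ^ d\<bar>" unfolding Q power_abs using V2 by (intro power_mono) auto
    then have "\<bar>u\<bar> \<ge> Q - V" by (simp add: u_def V_def)
    then show False by (rule big)
  qed
qed

section \<open>Square values of iterates in degree two\<close>

lemma has_prime_root_2_iff: "has_prime_root 2 z \<longleftrightarrow> (\<exists>y. z = y ^ 2)"
proof
  assume "has_prime_root 2 z"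
  then obtain p y where p: "prime p" "p dvd 2" "z = y ^ p" by (auto simp: has_prime_root_def)
  then have "p = 2" using primes_dvd_imp_eq two_is_prime_nat by blast
  then show "\<exists>y. z = y ^ 2" using p(3) by blast
next
  assume "\<exists>y. z = y ^ 2"
  then show "has_prime_root 2 z" unfolding has_prime_root_def using two_is_prime_nat dvd_refl[of "2 :: nat"] by blast
qed

lemma square_bound:
  fixes u z m :: int
  assumes "m > 0" "u ^ 2 - m = z ^ 2"
  shows "2 * \<bar>u\<bar> - 1 \<le> m"
proof -
  have "z ^ 2 < u ^ 2" using assms by linarith
  then have "\<bar>z\<bar> < \<bar>u\<bar>" using abs_le_square_iff[of u z] by linarith
  then have "\<bar>z\<bar> ^ 2 \<le> (\<bar>u\<bar> - 1) ^ 2" by (intro power_mono) auto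
  also have "\<dots> = u ^ 2 - 2 * \<bar>u\<bar> + 1" by (simp add: power2_diff)
  finally show ?thesis using assms(2) by simp
qed

lemma not_square_between:
  fixes n N z :: int
  assumes "0 \<le> n" "n ^ 2 < N" "N < (n + 1) ^ 2"
  shows "N \<noteq> z ^ 2"
proof
  assume "N = z ^ 2"
  then have "\<not> \<bar>z\<bar> \<le> n" "\<not> n + 1 \<le> \<bar>z\<bar>"
    using assms power_mono[of "\<bar>z\<bar>" n 2] power_mono[of "n + 1" "\<bar>z\<bar>" 2] by auto
  then show False by linarith
qed

lemma positive_iterate_not_square:
  fixes c t :: int
  assumes "c > 0"
  shows "\<not> has_prime_root 2 (eval_word 2 [c, c] t)"
proof
  assume "has_prime_root 2 (eval_word 2 [c, c] t)"
  then obtain z where z: "(t ^ 2 + c) ^ 2 + c = z ^ 2" by (auto simp: has_prime_root_2_iff)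
  have "2 * \<bar>z\<bar> - 1 \<le> c"
    using square_bound[OF assms, of z "t ^ 2 + c"] z by simp
  moreover have "(t ^ 2 + c) ^ 2 < z ^ 2" using z assms by linarith
  then have "\<bar>t ^ 2 + c\<bar> < \<bar>z\<bar>" using abs_le_square_iff[of z "t ^ 2 + c"] by linarith
  ultimately show False using assms zero_le_power2[of t] by linarith
qed

lemma iterates_not_square:
  fixes m :: int
  assumes "m \<ge> 2"
  shows "\<not> has_prime_root 2 (eval_word 2 (replicate (Suc (Suc n)) (- m)) 0)"
proof
  define a where "a = eval_word 2 (replicate (Suc n) (- m)) 0"
  have "m \<le> \<bar>eval_word 2 (replicate (Suc j) (- m)) 0\<bar>" for j
  proof (induction j)
    case (Suc j)
    define b where "b = eval_word 2 (replicate (Suc j) (- m)) 0"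
    have "2 * \<bar>b\<bar> \<le> b ^ 2" using Suc assms by (intro mult_abs_le_square) (auto simp: b_def)
    then have "m \<le> \<bar>b ^ 2 - m\<bar>" using Suc unfolding b_def[symmetric] by linarith
    then show ?case by (simp add: b_def)
  qed (use assms in simp)
  then have "m \<le> \<bar>a\<bar>" by (simp add: a_def)
  assume "has_prime_root 2 (eval_word 2 (replicate (Suc (Suc n)) (- m)) 0)"
  then obtain z where "a ^ 2 - m = z ^ 2" by (auto simp: has_prime_root_2_iff a_def)
  then have "2 * \<bar>a\<bar> - 1 \<le> m" using square_bound[of m a z] assms by simp
  then show False using \<open>m \<le> \<bar>a\<bar>\<close> assms by linarith
qed

lemma second_iterate_square_bound:
  fixes v m :: int
  assumes "m > 0" "has_prime_root 2 (eval_word 2 [- m, - m] v)"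
  shows "2 * v ^ 2 \<le> 3 * m + 1"
proof -
  obtain z where "(v ^ 2 - m) ^ 2 - m = z ^ 2" using assms(2) by (auto simp: has_prime_root_2_iff)
  then have "2 * \<bar>v ^ 2 - m\<bar> - 1 \<le> m" by (rule square_bound[OF assms(1)])
  moreover have "2 * v ^ 2 - 2 * m \<le> 2 * \<bar>v ^ 2 - m\<bar>" using abs_ge_self[of "v ^ 2 - m"] by simp
  ultimately show ?thesis by linarith
qed

text \<open>Let \<open>w\<close>, \<open>v\<close>, \<open>u\<close> be the successive images of \<open>r\<close>. The bound on \<open>u\<close> gives \<open>2v\<^sup>2 \<le> 3m + 1\<close>, and
\<open>r\<^sup>2 - w\<^sup>2 = w - v\<close> then confines \<open>\<bar>r\<bar>\<close> to \<open>w\<close> or \<open>w + 1\<close> if \<open>w \<ge> 0\<close>, and to \<open>\<bar>w\<bar>\<close> or \<open>\<bar>w\<bar> - 1\<close> if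
\<open>w < 0\<close>. In each case \<open>m\<close>, \<open>v\<close>, \<open>u\<close> are polynomials in \<open>w\<close>. A fixed point \<open>w = y\<^sup>2\<close> and a cycle
\<open>{k\<^sup>2, - k\<^sup>2 - 1}\<close> remain; in the other two cases the final square would be negative.\<close>

lemma fourth_iterate_square:
  fixes m r :: int
  assumes m: "m \<ge> 2" and sq: "has_prime_root 2 (eval_word 2 [- m, - m, - m, - m] r)"
  shows "(\<exists>y. m = (y ^ 2) ^ 2 - y ^ 2 \<and> r ^ 2 = (y ^ 2) ^ 2)
    \<or> (\<exists>k. m = (k ^ 2) ^ 2 + k ^ 2 + 1 \<and> r ^ 2 = (k ^ 2) ^ 2)"
proof -
  define w where "w = r ^ 2 - m"
  define v where "v = w ^ 2 - m"
  define u where "u = v ^ 2 - m"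
  have "has_prime_root 2 (eval_word 2 [- m, - m] v)" using sq by (simp add: w_def v_def)
  then have vb: "2 * v ^ 2 \<le> 3 * m + 1" using second_iterate_square_bound m by simp
  obtain z where z: "u ^ 2 - m = z ^ 2" using sq by (auto simp: has_prime_root_2_iff w_def v_def u_def)
  define R where "R = \<bar>r\<bar>"
  have R: "R ^ 2 = m + w" "R \<ge> 0" by (simp_all add: w_def R_def)
  have wm: "w ^ 2 = m + v" by (simp add: v_def)
  consider "w \<ge> 0" | "w < 0" by linarith
  then show ?thesis
  proof cases
    case 1
    (* In each excluded range of R, the equation for R ^ 2 - w ^ 2 makes v at least about 3 w in
       absolute value, too large for the bound on v since m = w ^ 2 - v. *)
    have "\<not> R \<ge> w + 2"
    proof
      assume "R \<ge> w + 2"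
      then have "(w + 2) ^ 2 \<le> R ^ 2" using 1 by (intro power_mono) auto
      then have a: "- v \<ge> 3 * w + 4" using R(1) wm by (simp add: power2_eq_square algebra_simps)
      have "3 * (3 * w ^ 2) \<le> (- v - 4) ^ 2"
        using a 1 power_mono[of "3 * w" "- v - 4" 2] by (simp add: power_mult_distrib)
      then have "6 * v ^ 2 \<le> (- v - 4) ^ 2 - 9 * v + 3" using vb wm by linarith
      then have "5 * v ^ 2 \<le> 19 - v" by (simp add: power2_eq_square algebra_simps)
      moreover have "4 * \<bar>v\<bar> \<le> v ^ 2" using a 1 by (intro mult_abs_le_square) auto
      ultimately show False using a 1 by linarith
    qed
    moreover have "\<not> R \<le> w - 1"
    proof
      assume "R \<le> w - 1"
      then have "R ^ 2 \<le> (w - 1) ^ 2" using R(2) by (intro power_mono) auto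
      then have a: "v \<ge> 3 * w - 1" using R(1) wm by (simp add: power2_eq_square algebra_simps)
      have w1: "w \<ge> 1" using \<open>R \<le> w - 1\<close> R(2) by simp
      have "3 * (3 * w ^ 2) \<le> (v + 1) ^ 2"
        using a w1 power_mono[of "3 * w" "v + 1" 2] by (simp add: power_mult_distrib)
      then have "6 * v ^ 2 \<le> (v + 1) ^ 2 - 9 * v + 3" using vb wm by linarith
      then have "5 * v ^ 2 \<le> 4 - 7 * v" by (simp add: power2_eq_square algebra_simps)
      then show False using a w1 zero_le_power2[of v] by linarith
    qed
    ultimately consider "R = w" | "R = w + 1" by linarith
    then show ?thesis
    proof cases
      case 1
      then have "v = w" "m = w ^ 2 - w" using R(1) wm by simp_all
      then have "u = w" by (simp add: u_def)
      then have "w = z ^ 2" using z \<open>m = w ^ 2 - w\<close> by simp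
      moreover have "r ^ 2 = w ^ 2" using 1 by (simp add: R_def power2_abs[of r, symmetric])
      ultimately show ?thesis using \<open>m = w ^ 2 - w\<close> by blast
    next
      case 2
      then have "m = w ^ 2 + w + 1" using R(1) by (simp add: power2_eq_square algebra_simps)
      then have "v = - w - 1" by (simp add: v_def)
      have "u = w"
        unfolding u_def \<open>v = - w - 1\<close> \<open>m = w ^ 2 + w + 1\<close> by (simp add: power2_eq_square algebra_simps)
      then have "z ^ 2 = - w - 1" using z \<open>m = w ^ 2 + w + 1\<close> by simp
      then show ?thesis using \<open>0 \<le> w\<close> zero_le_power2[of z] by linarith
    qed
  next
    case 2
    define x where "x = - w"
    have x: "x \<ge> 1" "x ^ 2 = m + v" "R ^ 2 = m - x" using 2 wm R by (simp_all add: x_def)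
    have "\<not> R \<ge> x + 1"
    proof
      assume "R \<ge> x + 1"
      then have "(x + 1) ^ 2 \<le> R ^ 2" using x by (intro power_mono) auto
      then have a: "- v \<ge> 3 * x + 1" using x by (simp add: power2_eq_square algebra_simps)
      have "3 * (3 * x ^ 2) \<le> (- v - 1) ^ 2"
        using a x power_mono[of "3 * x" "- v - 1" 2] by (simp add: power_mult_distrib)
      then have "6 * v ^ 2 \<le> (- v - 1) ^ 2 - 9 * v + 3" using vb x by linarith
      then have "5 * v ^ 2 \<le> 4 - 7 * v" by (simp add: power2_eq_square algebra_simps)
      moreover have "4 * \<bar>v\<bar> \<le> v ^ 2" using a x by (intro mult_abs_le_square) auto
      ultimately show False using a x by linarith
    qed
    moreover have "\<not> R \<le> x - 2"
    proof
      assume "R \<le> x - 2"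
      then have "R ^ 2 \<le> (x - 2) ^ 2" using R(2) by (intro power_mono) auto
      then have a: "v \<ge> 3 * x - 4" using x by (simp add: power2_eq_square algebra_simps)
      have x2: "x \<ge> 2" using \<open>R \<le> x - 2\<close> R(2) by simp
      have "3 * (3 * x ^ 2) \<le> (v + 4) ^ 2"
        using a x2 power_mono[of "3 * x" "v + 4" 2] by (simp add: power_mult_distrib)
      then have "6 * v ^ 2 \<le> (v + 4) ^ 2 - 9 * v + 3" using vb x by linarith
      then have "5 * v ^ 2 \<le> 19 - v" by (simp add: power2_eq_square algebra_simps)
      moreover have "2 * \<bar>v\<bar> \<le> v ^ 2" using a x2 by (intro mult_abs_le_square) auto
      ultimately show False using a x2 by linarith
    qed
    ultimately consider "R = x" | "R = x - 1" by linarith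
    then show ?thesis
    proof cases
      case 1
      then have "v = - x" "m = x ^ 2 + x" using x by simp_all
      then have "u = - x" by (simp add: u_def)
      then have "z ^ 2 = - x" using z \<open>m = x ^ 2 + x\<close> by simp
      then show ?thesis using x(1) zero_le_power2[of z] by linarith
    next
      case 2
      then have "R ^ 2 = x ^ 2 - 2 * x + 1" by (simp add: power2_diff)
      then have mx: "m = x ^ 2 - x + 1" using x by linarith
      then have "v = x - 1" using x by simp
      have "u = - x" unfolding u_def \<open>v = x - 1\<close> mx by (simp add: power2_eq_square algebra_simps)
      then have "z ^ 2 = x - 1" using z mx by simp
      then have xz: "x = z ^ 2 + 1" by simp
      have "r ^ 2 = R ^ 2" by (simp add: R_def)
      then have "r ^ 2 = (z ^ 2) ^ 2" using 2 xz by simp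
      moreover have "m = (z ^ 2) ^ 2 + z ^ 2 + 1" unfolding mx xz by (simp add: power2_eq_square algebra_simps)
      ultimately show ?thesis by blast
    qed
  qed
qed

text \<open>The numbers \<open>m\<close> for which \<open>x\<^sup>2 - m\<close> is reducible or its fourth iterate may take a square value.\<close>

definition exceptional :: "int \<Rightarrow> bool" where
  "exceptional m \<longleftrightarrow> (\<exists>z. m = z ^ 2 \<or> m = (z ^ 2) ^ 2 - z ^ 2 \<or> m = (z ^ 2) ^ 2 + z ^ 2 + 1)"

lemma fourth_iterate_not_square:
  assumes "\<not> exceptional (- b)"
  shows "\<not> has_prime_root 2 (eval_word 2 [b, b, b, b] t)"
proof (cases "b > 0")
  case True
  then show ?thesis using positive_iterate_not_square[of b "eval_word 2 [b, b] t"] by simp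
next
  case False
  have "- b \<noteq> 0 ^ 2" "- b \<noteq> 1 ^ 2" using assms unfolding exceptional_def by blast+
  then have "- b \<ge> 2" using False by simp
  then show ?thesis
    using fourth_iterate_square[of "- b" t] assms unfolding exceptional_def by auto
qed

lemma pronic_inject:
  fixes X Y :: int
  assumes "X ^ 2 - X = Y ^ 2 - Y" "X \<ge> 1" "Y \<ge> 1"
  shows "X = Y"
proof -
  have "(X - Y) * (X + Y - 1) = 0" using assms(1) by (simp add: power2_eq_square algebra_simps)
  then show ?thesis using assms(2,3) by auto
qed

lemma square_plus_1_not_square:
  fixes y k :: int
  assumes "y ^ 2 = k ^ 2 + 1"
  shows "k = 0"
proof (rule ccontr)
  assume "k \<noteq> 0"
  then show False
    using not_square_between[of "\<bar>k\<bar>" "k ^ 2 + 1" y] assms by (auto simp: power2_sum)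
qed

lemma square_plus_2_not_square:
  fixes y k :: int
  shows "y ^ 2 \<noteq> k ^ 2 + 2"
proof (cases "k = 0")
  case True
  then show ?thesis using not_square_between[of 1 2 y] by auto
next
  case False
  then have "1 \<le> \<bar>k\<bar>" by linarith
  then show ?thesis
    using not_square_between[of "\<bar>k\<bar>" "k ^ 2 + 2" y] by (auto simp: power2_sum)
qed

lemma even_pronic: "even (X ^ 2 - X)" "even (X ^ 2 + X)" for X :: int
  by simp_all

text \<open>The three kinds of exceptional numbers are separated by parity: \<open>Y\<^sup>2 - Y\<close> is even and
\<open>Y\<^sup>2 + Y + 1\<close> is odd.\<close>

lemma not_exceptional_odd:
  assumes "odd m" "\<And>z. m \<noteq> z ^ 2" "\<And>z. m - 1 \<noteq> (z ^ 2) ^ 2 + z ^ 2"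
  shows "\<not> exceptional m"
  using assms even_pronic unfolding exceptional_def by (metis add_diff_cancel_right')

lemma not_exceptional_even:
  assumes "even m" "\<And>z. m \<noteq> z ^ 2" "\<And>z. m \<noteq> (z ^ 2) ^ 2 - z ^ 2"
  shows "\<not> exceptional m"
  using assms even_pronic unfolding exceptional_def by (metis even_plus_one_iff)

lemma not_exceptional_negative: "m < 0 \<Longrightarrow> \<not> exceptional m"
proof
  assume m: "m < 0" "exceptional m"
  then obtain z where z: "m = z ^ 2 \<or> m = (z ^ 2) ^ 2 - z ^ 2 \<or> m = (z ^ 2) ^ 2 + z ^ 2 + 1"
    by (auto simp: exceptional_def)
  have "z ^ 2 \<le> (z ^ 2) ^ 2" using self_le_power[of "z ^ 2" 2]
    by (cases "z = 0") (auto simp: power2_eq_square mult_le_cancel_left1)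
  then show False using z m(1) zero_le_power2[of z] by linarith
qed

lemma near_cycle_not_exceptional:
  fixes M :: int
  assumes "M \<ge> 4"
  shows "\<not> exceptional (M ^ 2 - 3 * M + 1)"
proof (rule not_exceptional_odd)
  show "odd (M ^ 2 - 3 * M + 1)" by simp
  show "M ^ 2 - 3 * M + 1 \<noteq> z ^ 2" for z
    using assms by (intro not_square_between[of "M - 2"]) (auto simp: power2_eq_square algebra_simps)
  show "M ^ 2 - 3 * M + 1 - 1 \<noteq> (z ^ 2) ^ 2 + z ^ 2" for z
  proof
    define K where "K = z ^ 2"
    assume "M ^ 2 - 3 * M + 1 - 1 = (z ^ 2) ^ 2 + z ^ 2"
    then have eq: "M ^ 2 - 3 * M = K ^ 2 + K" by (simp add: K_def)
    have "K \<ge> 0" by (simp add: K_def)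
    show False
    proof (cases "K \<ge> M - 2")
      case True
      then have "(M - 2) ^ 2 \<le> K ^ 2" using assms by (intro power_mono) auto
      then show False using eq True by (simp add: power2_eq_square algebra_simps)
    next
      case False
      then have "K \<le> M - 3" by simp
      then have "K ^ 2 \<le> (M - 3) ^ 2" using \<open>K \<ge> 0\<close> by (intro power_mono) auto
      then show False using eq \<open>K \<le> M - 3\<close> assms by (simp add: power2_eq_square algebra_simps)
    qed
  qed
qed

lemma pronic_not_exceptional:
  fixes M :: int
  assumes "M \<ge> 2" "\<And>z. z ^ 2 \<noteq> M"
  shows "\<not> exceptional (M ^ 2 - M)"
proof (rule not_exceptional_even)
  show "even (M ^ 2 - M)" by simp
  show "M ^ 2 - M \<noteq> z ^ 2" for z
    using assms(1) by (intro not_square_between[of "M - 1"]) (auto simp: power2_eq_square algebra_simps)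
  show "M ^ 2 - M \<noteq> (z ^ 2) ^ 2 - z ^ 2" for z
  proof
    assume eq: "M ^ 2 - M = (z ^ 2) ^ 2 - z ^ 2"
    then have "z \<noteq> 0" using assms(1) by (auto simp: power2_eq_square)
    then have "z ^ 2 \<ge> 1" by (simp add: int_one_le_iff_zero_less)
    then show False using pronic_inject[OF eq] assms by auto
  qed
qed

lemma pronic_plus_1_not_exceptional:
  fixes M :: int
  assumes "M \<ge> 2" "\<And>z. z ^ 2 + 1 \<noteq> M"
  shows "\<not> exceptional (M ^ 2 - M + 1)"
proof (rule not_exceptional_odd)
  show "odd (M ^ 2 - M + 1)" by simp
  show "M ^ 2 - M + 1 \<noteq> z ^ 2" for z
    using assms(1) by (intro not_square_between[of "M - 1"]) (auto simp: power2_eq_square algebra_simps)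
  show "M ^ 2 - M + 1 - 1 \<noteq> (z ^ 2) ^ 2 + z ^ 2" for z
  proof
    assume "M ^ 2 - M + 1 - 1 = (z ^ 2) ^ 2 + z ^ 2"
    then have "M ^ 2 - M = (z ^ 2 + 1) ^ 2 - (z ^ 2 + 1)" by (simp add: power2_eq_square algebra_simps)
    then show False using pronic_inject[of M "z ^ 2 + 1"] assms by auto
  qed
qed

lemma square_plus_1_not_exceptional:
  fixes k :: int
  assumes "k \<noteq> 0"
  shows "\<not> exceptional (k ^ 2 + 1)"
proof
  assume "exceptional (k ^ 2 + 1)"
  then obtain z where "k ^ 2 + 1 = z ^ 2 \<or> k ^ 2 + 1 = (z ^ 2) ^ 2 - z ^ 2
    \<or> k ^ 2 + 1 = (z ^ 2) ^ 2 + z ^ 2 + 1" by (auto simp: exceptional_def)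
  then consider "z ^ 2 = k ^ 2 + 1" | "k ^ 2 + 1 = (z ^ 2) ^ 2 - z ^ 2" | "k ^ 2 = (z ^ 2) ^ 2 + z ^ 2"
    by auto
  then show False
  proof cases
    case 1
    then show False using square_plus_1_not_square assms by blast
  next
    case 2
    have mod4: "a ^ 2 mod 4 = 0 \<or> a ^ 2 mod 4 = 1" for a :: int
    proof -
      have "a mod 4 = 0 \<or> a mod 4 = 1 \<or> a mod 4 = 2 \<or> a mod 4 = 3" by presburger
      then have "(a mod 4) ^ 2 mod 4 = 0 \<or> (a mod 4) ^ 2 mod 4 = 1" by auto
      then show ?thesis by (simp add: power_mod)
    qed
    have "(z ^ 2) ^ 2 mod 4 = z ^ 2 mod 4"
      using mod4[of z] power_mod[of "z ^ 2" 4 2] by auto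
    then have "((z ^ 2) ^ 2 - z ^ 2) mod 4 = 0" by (simp add: mod_eq_dvd_iff)
    then have "(k ^ 2 + 1) mod 4 = 0" unfolding 2 .
    then show False using mod4[of k] by presburger
  next
    case 3
    then have "z \<noteq> 0" using assms by auto
    then show False
      using not_square_between[of "z ^ 2" "(z ^ 2) ^ 2 + z ^ 2" k] 3 by (auto simp: power2_sum)
  qed
qed

text \<open>The two exceptional families are treated together through \<open>m = M\<^sup>2 - M + e\<close>, where \<open>M = y\<^sup>2\<close>, \<open>e = 0\<close> for the
fixed point and \<open>M = k\<^sup>2 + 1\<close>, \<open>e = 1\<close> for the cycle. The word ending in \<open>b, b\<close> bounds
\<open>x = f\<^sub>b(t)\<close> by \<open>M + 1\<close> unless \<open>x = f\<^sub>b(x)\<close>; the word ending in \<open>b, -m\<close> yields \<open>x' = t'\<^sup>2 - m\<close> with \<open>x'\<^sup>2\<close> within \<open>2M\<close> of \<open>x\<^sup>2\<close>.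
This leaves \<open>M\<close>, \<open>M - 1\<close> and, for \<open>M = 2\<close> only, \<open>M - 2\<close> as possible values of \<open>\<bar>t'\<bar>\<close>.\<close>

lemma extension_candidates:
  fixes M e m b :: int
  assumes M: "M \<ge> 2" and e: "e = 0 \<or> e = 1" and m: "m = M ^ 2 - M + e"
    and L: "\<And>r. has_prime_root 2 (eval_word 2 L r) \<Longrightarrow> r = M \<or> r = - M"
    and t: "has_prime_root 2 (eval_word 2 (L @ [b, b]) t)" and t': "has_prime_root 2 (eval_word 2 (L @ [b, - m]) t')"
  shows "- b \<in> {M ^ 2 - M, M ^ 2 + M, M ^ 2 - 3 * M + 1, M ^ 2 - M + 1}
    \<or> (M = 2 \<and> - b \<in> {7, 11})"
proof -
  define x w0 x' w1 where "x = t ^ 2 + b" and "w0 = x ^ 2 + b" and "x' = t' ^ 2 - m" and "w1 = x' ^ 2 + b"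
  have w0: "w0 = M \<or> w0 = - M" and w1: "w1 = M \<or> w1 = - M"
    using L[of w0] L[of w1] t t' by (simp_all add: x_def w0_def x'_def w1_def)
  show ?thesis
  proof (cases "t ^ 2 = x ^ 2")
    case True
    then have "x = w0" by (simp add: x_def w0_def)
    then have "b = w0 - w0 ^ 2" by (simp add: w0_def)
    then show ?thesis using w0 by auto
  next
    case False
    have "2 * \<bar>x\<bar> - 1 \<le> \<bar>t ^ 2 - x ^ 2\<bar>" using power_gap[of 2 t x] False by simp
    also have "t ^ 2 - x ^ 2 = x - w0" by (simp add: x_def w0_def)
    finally have X: "\<bar>x\<bar> \<le> M + 1" using w0 M by linarith
    have "x ^ 2 \<le> (M + 1) ^ 2" using X abs_le_square_iff[of x "M + 1"] M by simp
    moreover have "x' ^ 2 = x ^ 2 + (w1 - w0)" by (simp add: w0_def w1_def)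
    ultimately have "x' ^ 2 < (M + 2) ^ 2" using w0 w1 M by (auto simp: power2_sum)
    then have X': "\<bar>x'\<bar> \<le> M + 1" using abs_le_square_iff[of "M + 2" x'] M by linarith
    define T where "T = \<bar>t'\<bar>"
    have T: "T ^ 2 = M ^ 2 - M + e + x'" "T \<ge> 0" by (simp_all add: T_def x'_def m)
    have "\<not> T \<ge> M + 1"
    proof
      assume "T \<ge> M + 1"
      then have "(M + 1) ^ 2 \<le> T ^ 2" using M by (intro power_mono) auto
      then show False using T(1) X' e M by (auto simp: power2_sum)
    qed
    moreover have "\<not> T \<le> M - 3"
    proof
      assume "T \<le> M - 3"
      then have "T ^ 2 \<le> (M - 3) ^ 2" using T(2) by (intro power_mono) auto
      then show False using T(1) X' e \<open>T \<le> M - 3\<close> T(2) by (auto simp: power2_diff)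
    qed
    ultimately consider "T = M" | "T = M - 1" | "T = M - 2" by linarith
    then show ?thesis
    proof cases
      case 1
      then have "x' = M - e" using T(1) by simp
      then have "- b = (M - e) ^ 2 - w1" by (simp add: w1_def)
      then show ?thesis using e w1 by (auto simp: power2_diff)
    next
      case 2
      then have "x' = 1 - M - e" using T(1) by (simp add: power2_diff)
      then have "- b = (1 - M - e) ^ 2 - w1" by (simp add: w1_def)
      then show ?thesis using e w1 by (auto simp: power2_diff)
    next
      (* This range of t' occurs only for M = 2; with e = 1 it produces the values 7 and 11. *)
      case 3
      then have x': "x' = 4 - 3 * M - e" using T(1) by (simp add: power2_diff)
      then have "M = 2" using X' M e by auto
      then have "- b = (- 2 - e) ^ 2 - w1" using x' by (simp add: w1_def)
      then show ?thesis using e w1 \<open>M = 2\<close> by auto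
    qed
  qed
qed

lemma square_value:
  fixes a :: int
  shows "a ^ 2 = (b ^ 2) ^ 2 \<Longrightarrow> a = b ^ 2 \<or> a = - (b ^ 2)"
  using power2_eq_iff[of a "b ^ 2"] by blast

lemma fixed_point_case_fourth:
  fixes y r :: int
  assumes "\<bar>y\<bar> \<ge> 2" "m = (y ^ 2) ^ 2 - y ^ 2" "has_prime_root 2 (eval_word 2 [- m, - m, - m, - m] r)"
  shows "r = y ^ 2 \<or> r = - (y ^ 2)"
proof -
  have Y: "2 * \<bar>y\<bar> \<le> y ^ 2" using assms(1) by (intro mult_abs_le_square) auto
  then have Y4: "y ^ 2 \<ge> 4" using assms(1) by linarith
  then have "4 * \<bar>y ^ 2\<bar> \<le> (y ^ 2) ^ 2" by (intro mult_abs_le_square) auto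
  then have "m \<ge> 2" using Y4 assms(2) by linarith
  from fourth_iterate_square[OF this assms(3)] show ?thesis
  proof
    assume "\<exists>z. m = (z ^ 2) ^ 2 - z ^ 2 \<and> r ^ 2 = (z ^ 2) ^ 2"
    then obtain z where z: "m = (z ^ 2) ^ 2 - z ^ 2" "r ^ 2 = (z ^ 2) ^ 2" by blast
    have "z \<noteq> 0" using z(1) \<open>m \<ge> 2\<close> by auto
    then have "z ^ 2 \<ge> 1" by (simp add: int_one_le_iff_zero_less)
    then have "z ^ 2 = y ^ 2" using pronic_inject[of "z ^ 2" "y ^ 2"] z(1) assms(2) Y4 by simp
    then show ?thesis using square_value[OF z(2)] by simp
  next
    assume "\<exists>k. m = (k ^ 2) ^ 2 + k ^ 2 + 1 \<and> r ^ 2 = (k ^ 2) ^ 2"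
    then obtain k where "m = (k ^ 2) ^ 2 + k ^ 2 + 1" by blast
    then have "odd m" using even_pronic(2)[of "k ^ 2"] by simp
    then show ?thesis using assms(2) even_pronic(1)[of "y ^ 2"] by simp
  qed
qed

text \<open>Three iterations suffice here, and they are preferable to four: the only preimages are then
\<open>k\<^sup>2 + 1\<close> and its negative, and \<open>x\<^sup>2 - (k\<^sup>2 + 1)\<close> is irreducible, unlike \<open>x\<^sup>2 - k\<^sup>2\<close>.\<close>

lemma two_cycle_case_third:
  fixes k r :: int
  assumes "k \<noteq> 0" "m = (k ^ 2) ^ 2 + k ^ 2 + 1" "has_prime_root 2 (eval_word 2 [- m, - m, - m] r)"
  shows "r = k ^ 2 + 1 \<or> r = - (k ^ 2 + 1)"
proof -
  define K where "K = k ^ 2"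
  have K: "K \<ge> 1" using assms(1) by (simp add: K_def int_one_le_iff_zero_less)
  have m: "m = K ^ 2 + K + 1" using assms(2) by (simp add: K_def)
  have "m > 0" using K m zero_le_power2[of K] by linarith
  define v where "v = r ^ 2 - m"
  define u where "u = v ^ 2 - m"
  have "has_prime_root 2 (eval_word 2 [- m, - m] v)" using assms(3) by (simp add: v_def)
  then have vb: "2 * v ^ 2 \<le> 3 * m + 1" using second_iterate_square_bound \<open>m > 0\<close> by simp
  obtain z where z: "u ^ 2 - m = z ^ 2" using assms(3) by (auto simp: has_prime_root_2_iff v_def u_def)
  define R where "R = \<bar>r\<bar>"
  have R: "R ^ 2 = m + v" "R \<ge> 0" by (simp_all add: R_def v_def)
  have K2: "K * 1 \<le> K ^ 2" using K by (simp add: power2_eq_square mult_left_mono)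
  have "\<not> R \<ge> K + 2"
  proof
    assume "R \<ge> K + 2"
    then have "(K + 2) ^ 2 \<le> R ^ 2" using K by (intro power_mono) auto
    then have "v \<ge> 3 * K" using R(1) m by (simp add: power2_sum)
    then have "(3 * K) ^ 2 \<le> v ^ 2" using K by (intro power_mono) auto
    then show False using vb m K K2 by (simp add: power_mult_distrib)
  qed
  moreover have "\<not> R \<le> K - 1"
  proof
    assume "R \<le> K - 1"
    then have "R ^ 2 \<le> (K - 1) ^ 2" using R(2) by (intro power_mono) auto
    then have "- v \<ge> 3 * K" using R(1) m by (simp add: power2_diff)
    then have "(3 * K) ^ 2 \<le> (- v) ^ 2" using K by (intro power_mono) auto
    then show False using vb m K K2 by (simp add: power_mult_distrib)
  qed
  ultimately consider "R = K" | "R = K + 1" by linarith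
  then show ?thesis
  proof cases
    case 1
    then have "v = - K - 1" using R(1) m by simp
    have "u = K" unfolding u_def \<open>v = - K - 1\<close> m by (simp add: power2_eq_square algebra_simps)
    then have "z ^ 2 = - K - 1" using z m by simp
    then show ?thesis using K zero_le_power2[of z] by linarith
  next
    case 2
    then show ?thesis by (auto simp: R_def K_def abs_if split: if_splits)
  qed
qed

lemma two_cycle_case_extension:
  fixes k b :: int
  assumes k: "k \<noteq> 0" and m: "m = (k ^ 2) ^ 2 + k ^ 2 + 1" and b: "b \<noteq> - m" "exceptional (- b)"
  shows "\<not> has_prime_root 2 (eval_word 2 [- m, - m, - m] b) \<and>
    ((\<forall>t. \<not> has_prime_root 2 (eval_word 2 ([- m, - m, - m] @ [b, b]) t)) \<or>
     (\<forall>t. \<not> has_prime_root 2 (eval_word 2 ([- m, - m, - m] @ [b, - m]) t)))"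
proof -
  define M where "M = k ^ 2 + 1"
  have "k ^ 2 \<ge> 1" using k by (simp add: int_one_le_iff_zero_less)
  then have M2: "M \<ge> 2" by (simp add: M_def)
  have mM: "m = M ^ 2 - M + 1" unfolding m M_def by (simp add: power2_eq_square algebra_simps)
  have L: "r = M \<or> r = - M" if "has_prime_root 2 (eval_word 2 [- m, - m, - m] r)" for r
    using two_cycle_case_third[OF k m that] by (simp add: M_def)
  have "\<not> exceptional M" "\<not> exceptional (- M)"
    using not_exceptional_negative[of "- M"] M2 square_plus_1_not_exceptional[OF k]
    by (simp_all add: M_def)
  then have bM: "b \<noteq> M" "b \<noteq> - M" using b(2) by (metis, metis minus_minus)
  have exc7: "\<not> exceptional 7"
  proof (rule not_exceptional_odd)
    show "7 \<noteq> z ^ 2" for z :: int by (rule not_square_between[of 2]) auto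
    show "7 - 1 \<noteq> (z ^ 2) ^ 2 + z ^ 2" for z :: int
    proof
      assume "7 - 1 = (z ^ 2) ^ 2 + z ^ 2"
      then have "(z ^ 2 - 2) * (z ^ 2 + 3) = 0" by (simp add: power2_eq_square algebra_simps)
      then have "2 = z ^ 2" using zero_le_power2[of z] by auto
      then show False using not_square_between[of 1 2 z] by simp
    qed
  qed simp
  have exc11: "\<not> exceptional 11"
  proof (rule not_exceptional_odd)
    show "11 \<noteq> z ^ 2" for z :: int by (rule not_square_between[of 3]) auto
    show "11 - 1 \<noteq> (z ^ 2) ^ 2 + z ^ 2" for z :: int
    proof
      define K where "K = z ^ 2"
      assume "11 - 1 = (z ^ 2) ^ 2 + z ^ 2"
      then have K: "K ^ 2 + K = 10" by (simp add: K_def)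
      have "K \<ge> 0" by (simp add: K_def)
      consider "K \<le> 2" | "K \<ge> 3" by linarith
      then show False
        using K power_mono[of K 2 2] power_mono[of 3 K 2] \<open>K \<ge> 0\<close> by cases auto
    qed
  qed simp
  have "\<not> exceptional (M ^ 2 - M)"
  proof (rule pronic_not_exceptional)
    show "z ^ 2 \<noteq> M" for z using square_plus_1_not_square[of z k] k by (auto simp: M_def)
  qed (rule M2)
  moreover have "\<not> exceptional (M ^ 2 + M)"
  proof -
    have "\<not> exceptional ((M + 1) ^ 2 - (M + 1))"
    proof (rule pronic_not_exceptional)
      show "z ^ 2 \<noteq> M + 1" for z using square_plus_2_not_square[of z k] by (auto simp: M_def)
    qed (use M2 in simp)
    then show ?thesis by (simp add: power2_eq_square algebra_simps)
  qed
  moreover have "\<not> exceptional (M ^ 2 - 3 * M + 1)"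
  proof (cases "M \<ge> 4")
    case False
    have "k ^ 2 \<noteq> 2" using not_square_between[of 1 2 k] by auto
    then have "M = 2" using False M2 by (auto simp: M_def)
    then show ?thesis by (intro not_exceptional_negative) simp
  qed (rule near_cycle_not_exceptional)
  ultimately have "- b \<notin> {M ^ 2 - M, M ^ 2 + M, M ^ 2 - 3 * M + 1, M ^ 2 - M + 1}" "- b \<notin> {7, 11}"
    using b mM exc7 exc11 by auto
  then show ?thesis
    using extension_candidates[where b = b, OF M2 disjI2[OF refl] mM L] L[of b] bM by blast
qed

lemma fixed_point_case_extension:
  fixes y b :: int
  assumes y: "\<bar>y\<bar> \<ge> 2" and m: "m = (y ^ 2) ^ 2 - y ^ 2"
    and b: "b \<noteq> - m" "b \<noteq> - (y ^ 2)" "exceptional (- b)"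
  shows "\<not> has_prime_root 2 (eval_word 2 [- m, - m, - m, - m] b) \<and>
    ((\<forall>t. \<not> has_prime_root 2 (eval_word 2 ([- m, - m, - m, - m] @ [b, b]) t)) \<or>
     (\<forall>t. \<not> has_prime_root 2 (eval_word 2 ([- m, - m, - m, - m] @ [b, - m]) t)))"
proof -
  define M where "M = y ^ 2"
  have "2 * \<bar>y\<bar> \<le> y ^ 2" using y by (intro mult_abs_le_square) auto
  then have M4: "M \<ge> 4" using y unfolding M_def by linarith
  have mM: "m = M ^ 2 - M + 0" by (simp add: m M_def)
  have L: "r = M \<or> r = - M" if "has_prime_root 2 (eval_word 2 [- m, - m, - m, - m] r)" for r
    using fixed_point_case_fourth[OF y m that] by (simp add: M_def)
  have bM: "b \<noteq> M" "b \<noteq> - M"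
    using b(2,3) not_exceptional_negative[of "- M"] M4 by (auto simp: M_def)
  have "y \<noteq> 0" using y by auto
  have "\<not> exceptional (M ^ 2 + M)"
  proof -
    have "\<not> exceptional ((M + 1) ^ 2 - (M + 1))"
    proof (rule pronic_not_exceptional)
      show "z ^ 2 \<noteq> M + 1" for z using square_plus_1_not_square[of z y] \<open>y \<noteq> 0\<close> by (auto simp: M_def)
    qed (use M4 in simp)
    then show ?thesis by (simp add: power2_eq_square algebra_simps)
  qed
  moreover have "\<not> exceptional (M ^ 2 - 3 * M + 1)" using M4 by (rule near_cycle_not_exceptional)
  moreover have "\<not> exceptional (M ^ 2 - M + 1)"
  proof (rule pronic_plus_1_not_exceptional)
    show "z ^ 2 + 1 \<noteq> M" for z
    proof
      assume "z ^ 2 + 1 = M"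
      then have "z = 0" using square_plus_1_not_square[of y z] by (simp add: M_def)
      then show False using \<open>z ^ 2 + 1 = M\<close> M4 by simp
    qed
  qed (use M4 in simp)
  ultimately have "- b \<notin> {M ^ 2 - M, M ^ 2 + M, M ^ 2 - 3 * M + 1, M ^ 2 - M + 1}" "M \<noteq> 2"
    using b mM M4 by auto
  moreover have "M \<ge> 2" using M4 by simp
  ultimately show ?thesis
    using extension_candidates[where b = b, OF _ disjI1[OF refl] mM L] L[of b] bM by blast
qed

lemma fixed_zero_fixed_not_square:
  fixes y t :: int
  assumes y: "\<bar>y\<bar> \<ge> 2" and m: "m = (y ^ 2) ^ 2 - y ^ 2"
  shows "\<not> has_prime_root 2 (eval_word 2 [- m, - m, - (y ^ 2), - m] t)"
proof
  define Y x v where "Y = y ^ 2" and "x = t ^ 2 - m" and "v = x ^ 2 - y ^ 2"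
  assume "has_prime_root 2 (eval_word 2 [- m, - m, - (y ^ 2), - m] t)"
  then have sq: "has_prime_root 2 (eval_word 2 [- m, - m] v)" by (simp add: x_def v_def)
  have "2 * \<bar>y\<bar> \<le> y ^ 2" using y by (intro mult_abs_le_square) auto
  then have Y4: "Y \<ge> 4" using y unfolding Y_def by linarith
  have mY: "m = Y ^ 2 - Y" by (simp add: m Y_def)
  have Y2: "4 * Y \<le> Y ^ 2" using Y4 mult_abs_le_square[of 4 Y] by simp
  then have "m > 0" using Y4 mY by linarith
  then have vb: "2 * v ^ 2 \<le> 3 * m + 1" using second_iterate_square_bound sq by blast
  have "\<bar>x\<bar> \<le> Y - 2"
  proof (rule ccontr)
    assume "\<not> \<bar>x\<bar> \<le> Y - 2"
    then have "(Y - 1) ^ 2 \<le> \<bar>x\<bar> ^ 2" using Y4 by (intro power_mono) auto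
    then have "Y ^ 2 - 3 * Y + 1 \<le> v" by (simp add: v_def Y_def power2_diff)
    then have v: "Y + 1 \<le> v" "Y ^ 2 - 3 * Y + 1 \<le> v" using Y2 by linarith+
    have "v * (Y + 1) \<le> v * v" using v(1) Y4 by (intro mult_left_mono) auto
    moreover have "(Y ^ 2 - 3 * Y + 1) * (Y + 1) \<le> v * (Y + 1)" using v(2) Y4 by (intro mult_right_mono) auto
    moreover have "2 * ((Y ^ 2 - 3 * Y + 1) * (Y + 1)) = 2 * (Y ^ 2 * Y) - 4 * Y ^ 2 - 4 * Y + 2"
      by (simp add: power2_eq_square algebra_simps)
    moreover have "Y ^ 2 * 4 \<le> Y ^ 2 * Y" using Y4 by (intro mult_left_mono) auto
    ultimately have "2 * (Y ^ 2 * 4) - 4 * Y ^ 2 - 4 * Y + 2 \<le> 3 * m + 1"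
      using vb by (simp add: power2_eq_square)
    then show False using Y2 mY Y4 by simp
  qed
  then have "(Y - 1) ^ 2 < t ^ 2" "t ^ 2 < Y ^ 2"
    using mY by (simp_all add: x_def power2_diff)
  then show False using not_square_between[of "Y - 1" "t ^ 2" t] Y4 by simp
qed

section \<open>Three compositions treated by explicit norms\<close>

lemma irreducible_quadratic:
  assumes "\<not> has_prime_root 2 (- b)"
  shows "irreducible (word 2 [b])"
proof (rule irreducibleI)
  let ?f = "word 2 [b]"
  have deg: "degree ?f = 2" using degree_word[of 2 "[b]"] by simp
  then show "?f \<noteq> 0" by (metis degree_0 zero_neq_numeral)
  show "\<not> is_unit ?f" using deg is_unit_iff_degree[of ?f] \<open>?f \<noteq> 0\<close> by simp
  fix p q assume pq: "?f = p * q"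
  have "p \<noteq> 0" "q \<noteq> 0" using pq \<open>?f \<noteq> 0\<close> by auto
  then have sum: "degree p + degree q = 2" using deg unfolding pq by (simp add: degree_mult_eq)
  show "is_unit p \<or> is_unit q"
  proof (rule ccontr)
    assume "\<not> (is_unit p \<or> is_unit q)"
    then have "degree p = 1"
      using sum \<open>p \<noteq> 0\<close> \<open>q \<noteq> 0\<close> is_unit_iff_degree[of p] is_unit_iff_degree[of q] by linarith
    then obtain u v where "p = [:u, v:]" "v \<noteq> 0"
      by (metis degree1_coeffs)
    then have "poly p (- u / v) = 0" by simp
    then obtain r where "poly p r = 0" by blast
    then have "poly ?f r = 0" unfolding pq by simp
    then have "of_int (- b) = r ^ 2"
      by (simp add: unicritical_def poly_monom add_eq_0_iff2)
    then obtain y where "- b = y ^ 2" using rat_power_int[of "- b" r 2] by auto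
    then show False using assms by (auto simp: has_prime_root_2_iff)
  qed
qed

text \<open>Otherwise \<open>f\<close> would be coprime to \<open>f - H\<close>, and substituting \<open>g\<close> in a Bezout identity would make \<open>h\<close> a
unit. This identifies \<open>f\<close> with the characteristic polynomial \<open>H\<close> when \<open>H\<close> is given by explicit
coefficients.\<close>

lemma unique_monic_norm:
  fixes f H h g :: "rat poly"
  assumes "irreducible f" "degree H = degree f" "lead_coeff f = lead_coeff H"
    and "\<not> is_unit h" "h dvd f \<circ>\<^sub>p g" "h dvd H \<circ>\<^sub>p g"
  shows "f = H"
proof (rule ccontr)
  assume "f \<noteq> H"
  then have nz: "f - H \<noteq> 0" by simp
  have "degree f > 0"
    using assms(1) is_unit_iff_degree[of f] by (auto simp: irreducible_def)
  moreover have "coeff (f - H) (degree f) = 0" using assms(2,3) by simp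
  ultimately have "degree (f - H) < degree f"
    using nz degree_diff_le[of f "degree f" H] assms(2)
    by (metis leading_coeff_0_iff le_neq_implies_less order_refl)
  then have "\<not> f dvd f - H" using nz dvd_imp_degree_le leD by blast
  then have "coprime f (f - H)"
    using assms(1) irreducible_imp_prime_elem prime_elem_imp_coprime by blast
  then obtain u v where "u * f + v * (f - H) = 1"
    using bezout_coefficients_fst_snd[of f "f - H"] by auto
  then have "(u * f + v * (f - H)) \<circ>\<^sub>p g = 1" by simp
  then have "(u \<circ>\<^sub>p g) * (f \<circ>\<^sub>p g) + (v \<circ>\<^sub>p g) * (f \<circ>\<^sub>p g - H \<circ>\<^sub>p g) = 1"
    by (simp add: pcompose_add pcompose_mult pcompose_diff)
  moreover have "h dvd (u \<circ>\<^sub>p g) * (f \<circ>\<^sub>p g) + (v \<circ>\<^sub>p g) * (f \<circ>\<^sub>p g - H \<circ>\<^sub>p g)"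
    using assms(5,6) by (intro dvd_add dvd_mult dvd_diff)
  ultimately show False using assms(4) by simp
qed


text \<open>These are the coefficient equations for a factor \<open>x\<^sup>4 + a x\<^sup>3 + b x\<^sup>2 + c x + e\<close> of
\<open>f\<^sup>2 \<circ> (x\<^sup>2 - y\<^sup>2)\<close>. Eliminating \<open>b\<close> and \<open>c\<close> leaves
\<open>(2T\<^sup>2 - 4e\<^sup>2T + e\<^sup>2 - e)\<^sup>2 = 8e(e + 1)T\<^sup>2\<close> with \<open>T = (a/2)\<^sup>2\<close> and \<open>e = y\<close> or \<open>e = - y\<close>. Hence
\<open>2e(e + 1) = n\<^sup>2\<close> for an integer \<open>n\<close>, and the resulting quadratic equation for \<open>T\<close> has the discriminant
\<open>(2e\<^sup>2 + n)\<^sup>2 - 2(e\<^sup>2 - e)\<close>, which lies strictly between the squares of \<open>B - 1\<close> and \<open>B\<close> for \<open>B = 2e\<^sup>2 + n\<close>, unless \<open>e = -2\<close>, when it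
is \<open>24\<close> or \<open>88\<close>.\<close>

lemma quartic_norm_contradiction:
  fixes a b c e :: rat and y :: int
  assumes y: "\<bar>y\<bar> \<ge> 2"
    and e: "e ^ 2 = of_int y ^ 2"
    and 1: "2 * b - a ^ 2 = - 4 * of_int y ^ 2"
    and 2: "b ^ 2 + 2 * e - 2 * a * c = 4 * of_int y ^ 4 + 2 * of_int y ^ 2"
    and 3: "2 * b * e - c ^ 2 = - 4 * of_int y ^ 4"
  shows False
proof -
  have "e = of_int y \<or> e = - of_int y" using e by (simp add: power2_eq_iff)
  then obtain z where z: "e = of_int z" "\<bar>z\<bar> = \<bar>y\<bar>"
    by (metis abs_minus_cancel of_int_minus)
  have zy: "(of_int y :: rat) ^ 2 = e ^ 2" "(of_int y :: rat) ^ 4 = e ^ 4"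
    using e by (simp, metis (mono_tags) e numeral_Bit0 power_add power2_eq_square)
  define T where "T = (a / 2) ^ 2"
  define \<alpha> \<gamma> where "\<alpha> = a / 2" and "\<gamma> = c / 2"
  have a: "a = 2 * \<alpha>" and c: "c = 2 * \<gamma>" by (simp_all add: \<alpha>_def \<gamma>_def)
  have T: "T = \<alpha> ^ 2" by (simp add: T_def \<alpha>_def)
  have b: "b = 2 * T - 2 * e ^ 2" using 1 unfolding zy a T by (simp add: power2_eq_square algebra_simps)
  have g: "\<gamma> ^ 2 = (T - e ^ 2) * e + e ^ 4"
    using 3 unfolding zy b c by (simp add: power2_eq_square algebra_simps)
  have ag: "4 * \<alpha> * \<gamma> = 2 * T ^ 2 - 4 * T * e ^ 2 + e - e ^ 2"
  proof -
    have "(2 * T - 2 * e ^ 2) ^ 2 + 2 * e - 8 * \<alpha> * \<gamma> = 4 * e ^ 4 + 2 * e ^ 2"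
      using 2 unfolding zy b a c by (simp add: algebra_simps)
    moreover have "(2 * T - 2 * e ^ 2) ^ 2 = 4 * T ^ 2 - 8 * T * e ^ 2 + 4 * e ^ 4"
      by (simp add: eval_nat_numeral algebra_simps)
    ultimately show ?thesis by simp
  qed
  have "(4 * \<alpha> * \<gamma>) ^ 2 = 16 * T * \<gamma> ^ 2"
    by (simp add: T power_mult_distrib)
  then have "16 * T * \<gamma> ^ 2 = (2 * T ^ 2 - 4 * T * e ^ 2 + e - e ^ 2) ^ 2"
    unfolding ag by (rule sym)
  then have main: "(2 * T ^ 2 - 4 * e ^ 2 * T + e ^ 2 - e) ^ 2 = 8 * e * (e + 1) * T ^ 2"
  proof -
    have "(2 * T ^ 2 - 4 * e ^ 2 * T + e ^ 2 - e) ^ 2 - 8 * e * (e + 1) * T ^ 2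
        = (2 * T ^ 2 - 4 * T * e ^ 2 + e - e ^ 2) ^ 2 - 16 * T * ((T - e ^ 2) * e + e ^ 4)"
      by (simp add: eval_nat_numeral algebra_simps)
    with \<open>16 * T * \<gamma> ^ 2 = _\<close> show ?thesis unfolding g by simp
  qed
  have T0: "T \<noteq> 0"
  proof
    assume "T = 0"
    then have "(e ^ 2 - e) ^ 2 = 0" using main by simp
    then have "e * (e - 1) = 0" by (simp add: power2_eq_square right_diff_distrib)
    then have "z = 0 \<or> z = 1" unfolding z(1) by auto
    then show False using y z(2) by auto
  qed
  define \<nu> where "\<nu> = (2 * T ^ 2 - 4 * e ^ 2 * T + e ^ 2 - e) / (2 * T)"
  have nu: "2 * T ^ 2 - 4 * e ^ 2 * T + e ^ 2 - e = 2 * T * \<nu>" using T0 by (simp add: \<nu>_def)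
  have "4 * T ^ 2 * \<nu> ^ 2 = 4 * T ^ 2 * (2 * e * (e + 1))"
    using main unfolding nu by (simp add: power_mult_distrib)
  then have "\<nu> ^ 2 = 2 * e * (e + 1)" using T0 by simp
  then have nu2: "of_int (2 * z * (z + 1)) = \<nu> ^ 2" by (simp add: z(1))
  then obtain n' where "2 * z * (z + 1) = n' ^ 2" using rat_power_int[OF nu2] by auto
  then have "\<nu> ^ 2 = of_int n' ^ 2" using nu2 by simp
  then have "\<nu> = of_int n' \<or> \<nu> = of_int (- n')" by (simp add: power2_eq_iff)
  then obtain n where n: "\<nu> = of_int n" by blast
  have n2: "n ^ 2 = 2 * z * (z + 1)"
    using nu2 unfolding n by (metis of_int_eq_iff of_int_power)
  define B where "B = 2 * z ^ 2 + n"
  have "(2 * T - of_int B) ^ 2 = of_int (B ^ 2 - 2 * (z ^ 2 - z))"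
  proof -
    have "2 * T ^ 2 - 4 * e ^ 2 * T + e ^ 2 - e - 2 * T * of_int n = 0" using nu n by simp
    moreover have "(2 * T - (2 * e ^ 2 + of_int n)) ^ 2 - ((2 * e ^ 2 + of_int n) ^ 2 - 2 * (e ^ 2 - e))
        = 2 * (2 * T ^ 2 - 4 * e ^ 2 * T + e ^ 2 - e - 2 * T * of_int n)"
      by (simp add: power2_eq_square algebra_simps)
    ultimately have "(2 * T - (2 * e ^ 2 + of_int n)) ^ 2 = (2 * e ^ 2 + of_int n) ^ 2 - 2 * (e ^ 2 - e)"
      by simp
    then show ?thesis by (simp add: B_def z(1))
  qed
  then obtain D where D: "B ^ 2 - 2 * (z ^ 2 - z) = D ^ 2"
    using rat_power_int[of "B ^ 2 - 2 * (z ^ 2 - z)" "2 * T - of_int B" 2] by auto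
  have z2: "\<bar>z\<bar> \<ge> 2" using y z(2) by simp
  have zz: "2 * \<bar>z\<bar> \<le> z ^ 2" using z2 by (intro mult_abs_le_square) auto
  then have "2 * (z ^ 2 - z) > 0" using z2 by (simp add: abs_if split: if_splits)
  then have "2 * \<bar>B\<bar> - 1 \<le> 2 * (z ^ 2 - z)" using square_bound[OF _ D] by blast
  moreover have "2 * z ^ 2 - \<bar>n\<bar> \<le> \<bar>B\<bar>" unfolding B_def by linarith
  moreover have "2 * (z ^ 2 - z) = 2 * z ^ 2 - 2 * z" by simp
  ultimately have "2 * z ^ 2 + 2 * z \<le> 2 * \<bar>n\<bar> + 1" by linarith
  then have n_le: "n ^ 2 \<le> 2 * \<bar>n\<bar> + 1" unfolding n2 by (simp add: power2_eq_square algebra_simps)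
  have "\<bar>n\<bar> \<le> 2"
  proof (rule ccontr)
    assume "\<not> \<bar>n\<bar> \<le> 2"
    then have "3 * \<bar>n\<bar> \<le> n ^ 2" by (intro mult_abs_le_square) auto
    then show False using n_le \<open>\<not> \<bar>n\<bar> \<le> 2\<close> by linarith
  qed
  then have "n ^ 2 \<le> 4" using abs_le_square_iff[of n 2] by simp
  have n2': "n ^ 2 = 2 * z ^ 2 + 2 * z" using n2 by (simp add: power2_eq_square algebra_simps)
  have "z = - 2"
  proof (rule ccontr)
    assume "z \<noteq> - 2"
    then consider "z \<ge> 2" | "z \<le> - 3" using z2 by linarith
    then show False
    proof cases
      case 1
      then show False using \<open>n ^ 2 \<le> 4\<close> zz n2' by linarith
    next
      case 2
      then have "3 * \<bar>z\<bar> \<le> z ^ 2" by (intro mult_abs_le_square) auto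
      then show False using \<open>n ^ 2 \<le> 4\<close> \<open>z \<le> - 3\<close> n2' by linarith
    qed
  qed
  then have "n ^ 2 = 2 ^ 2" using n2 by simp
  then have "n = 2 \<or> n = - 2" using power2_eq_iff by blast
  then have "D ^ 2 = 88 \<or> D ^ 2 = 24" using D \<open>z = - 2\<close> by (auto simp: B_def)
  then show False
    using not_square_between[of 9 88 D] not_square_between[of 4 24 D] by auto
qed


text \<open>Of two complementary factors, the one of smaller degree is normalized to be monic.\<close>

lemma reducible_snoc_factor:
  assumes "d \<ge> 2" "irreducible (word d bs)" "\<not> irreducible (word d (bs @ [b]))"
  shows "\<exists>h. lead_coeff h = 1 \<and> \<not> is_unit h \<and> h dvd word d (bs @ [b])
    \<and> (\<exists>k. degree h = k * d ^ length bs \<and> 0 < k \<and> 2 * k \<le> d)"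
proof -
  define q where "q = word d (bs @ [b])"
  define f where "f = word d bs \<circ>\<^sub>p [:of_int b, 1:]"
  have q: "q = f \<circ>\<^sub>p monom 1 d" by (simp add: q_def f_def word_snoc)
  have irr: "irreducible f" unfolding f_def using assms(2) by (rule irreducible_shift)
  have lc: "lead_coeff f = 1"
    using lead_coeff_comp[of "[:of_int b, 1:]" "word d bs"] lead_coeff_word[of d bs] assms(1)
    by (simp add: f_def)
  have df: "degree f = d ^ length bs" by (simp add: f_def degree_word)
  have dq: "degree q = d ^ length bs * d" by (simp add: q_def degree_word)
  have "degree q > 0" using dq assms(1) by simp
  then have q0: "q \<noteq> 0" "\<not> is_unit q" using is_unit_iff_degree[of q] by auto
  obtain a c where ac: "q = a * c" "\<not> is_unit a" "\<not> is_unit c"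
    using assms(3) q0 unfolding q_def irreducible_def by blast
  have nz: "a \<noteq> 0" "c \<noteq> 0" using ac q0 by auto
  have sum: "degree a + degree c = degree q" using nz by (simp add: ac(1) degree_mult_eq)
  have "a dvd q" "c dvd q" by (simp_all add: ac(1))
  moreover have "2 * degree a \<le> degree q \<or> 2 * degree c \<le> degree q" using sum by linarith
  ultimately obtain h where h: "\<not> is_unit h" "h dvd q" "h \<noteq> 0" "2 * degree h \<le> degree q"
    using ac(2,3) nz by blast
  have "degree h > 0" using h is_unit_iff_degree[of h] by auto
  then obtain k where k: "degree h = k * degree f"
    using irreducible_factor_of_substitution[OF irr lc _ h(2)[unfolded q]] by blast
  have "0 < d ^ length bs" using assms(1) by simp
  moreover have "d ^ length bs * (2 * k) \<le> d ^ length bs * d"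
    using h(4) unfolding k df dq by (simp only: mult.left_commute mult.commute)
  ultimately have "2 * k \<le> d" by (simp only: mult_le_cancel1)
  have "0 < k" using k \<open>degree h > 0\<close> by (auto intro: Nat.gr0I)
  define h' where "h' = Polynomial.smult (inverse (lead_coeff h)) h"
  have "lead_coeff h' = 1" "degree h' = degree h" "h' dvd q" "\<not> is_unit h'"
    using h by (simp_all add: h'_def smult_dvd_iff is_unit_smult_iff)
  moreover have "degree h = k * d ^ length bs" using k df by simp
  ultimately show ?thesis using \<open>0 < k\<close> \<open>2 * k \<le> d\<close> unfolding q_def by metis
qed

text \<open>One factor \<open>f\<close> fewer would not be enough: \<open>f \<circ> (x\<^sup>2 - y\<^sup>2)\<close> is reducible for \<open>y = 8\<close>. A factor \<open>h\<close> has degree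
four, and \<open>h(x) h(-x)\<close> is a polynomial in \<open>x\<^sup>2\<close> with explicit coefficients.\<close>

lemma irreducible_fixed_fixed_zero:
  fixes y :: int
  assumes y: "\<bar>y\<bar> \<ge> 2" and m: "m = (y ^ 2) ^ 2 - y ^ 2"
    and irr: "irreducible (word 2 [- m, - m])"
  shows "irreducible (word 2 [- m, - m, - (y ^ 2)])"
proof (rule ccontr)
  define Y :: rat where "Y = of_int y ^ 2"
  assume nirr: "\<not> irreducible (word 2 [- m, - m, - (y ^ 2)])"
  then obtain h where h: "lead_coeff h = 1" "\<not> is_unit h" "h dvd word 2 ([- m, - m] @ [- (y ^ 2)])"
    "degree h = 4"
  proof -
    have "\<not> irreducible (word 2 ([- m, - m] @ [- (y ^ 2)]))" unfolding append.simps using nirr .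
    from reducible_snoc_factor[OF _ irr this] obtain h k where *: "lead_coeff h = 1" "\<not> is_unit h"
      "h dvd word 2 ([- m, - m] @ [- (y ^ 2)])" "degree h = k * 2 ^ length [- m, - m]" "0 < k" "2 * k \<le> 2"
      by auto
    then have "k = 1" by simp
    then show ?thesis using that[OF *(1-3)] *(4) by simp
  qed
  define e c b a where "e = coeff h 0" and "c = coeff h 1" and "b = coeff h 2" and "a = coeff h 3"
  have h_eq: "h = [:e, c, b, a, 1:]"
    by (rule poly_eqI) (use h(1,4) in \<open>auto simp: e_def c_def b_def a_def coeff_pCons coeff_eq_0
      eval_nat_numeral split: nat.splits\<close>)
  define f where "f = word 2 [- m, - m] \<circ>\<^sub>p [:of_int (- (y ^ 2)), 1:]"
  define H where "H = [:e ^ 2, 2 * b * e - c ^ 2, b ^ 2 + 2 * e - 2 * a * c, 2 * b - a ^ 2, 1:]"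
  have x2: "monom (1 :: rat) 2 = [:0, 0, 1:]" by (simp add: monom_altdef power2_eq_square)
  have uni: "unicritical 2 (of_int (- m)) = [:- (Y ^ 2 - Y), 0, 1 :: rat:]"
    by (simp add: unicritical_def x2 m Y_def)
  have shift: "of_int (- (y ^ 2)) = - Y" by (simp add: Y_def)
  have f_eq: "f = [:Y, - 4 * Y ^ 2, 4 * Y ^ 2 + 2 * Y, - 4 * Y, 1:]"
    unfolding f_def word_simps uni shift
    by (simp add: pcompose_pCons power2_eq_square algebra_simps)
  have dvd_f: "h dvd f \<circ>\<^sub>p monom 1 2" using h(3) unfolding word_snoc f_def .
  have "H \<circ>\<^sub>p monom 1 2 = h * [:e, - c, b, - a, 1:]"
    unfolding H_def h_eq x2 by (simp add: pcompose_pCons power2_eq_square algebra_simps)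
  then have "h dvd H \<circ>\<^sub>p monom 1 2" by (rule dvdI)
  moreover have "irreducible f" unfolding f_def using irr by (rule irreducible_shift)
  moreover have "degree H = degree f" "lead_coeff f = lead_coeff H" by (simp_all add: f_eq H_def)
  ultimately have "f = H" using h(2) dvd_f by (intro unique_monic_norm)
  then have "Y = e ^ 2" "- 4 * Y ^ 2 = 2 * b * e - c ^ 2" "4 * Y ^ 2 + 2 * Y = b ^ 2 + 2 * e - 2 * a * c"
    "- 4 * Y = 2 * b - a ^ 2" unfolding f_eq H_def pCons_eq_iff by blast+
  then show False
    using quartic_norm_contradiction[OF y, of e b a c] unfolding Y_def power_mult [symmetric] by simp
qed

text \<open>A factor \<open>h = x\<^sup>3 - s x\<^sup>2 + q x - e\<close> is the characteristic polynomial of a cube root of \<open>\<alpha> - v\<close>. The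
product of \<open>h(x)\<close>, \<open>h(\<omega>x)\<close> and \<open>h(\<omega>\<^sup>2x)\<close> for a cube root of unity \<open>\<omega>\<close> is a polynomial in \<open>x\<^sup>3\<close>; the
explicit sextic in the proof is the product of the last two.\<close>

lemma irreducible_cubic_fixed_zero:
  fixes y :: int
  assumes y: "\<bar>y\<bar> \<ge> 2" and v: "v = y ^ 3" and irr: "irreducible (word 3 [v - v ^ 3])"
  shows "irreducible (word 3 [v - v ^ 3, v])"
proof (rule ccontr)
  define V :: rat where "V = of_int v"
  assume nirr: "\<not> irreducible (word 3 [v - v ^ 3, v])"
  then obtain h where h: "lead_coeff h = 1" "\<not> is_unit h" "h dvd word 3 ([v - v ^ 3] @ [v])"
    "degree h = 3"
  proof -
    have "\<not> irreducible (word 3 ([v - v ^ 3] @ [v]))" unfolding append.simps using nirr .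
    from reducible_snoc_factor[OF _ irr this] obtain h k where *: "lead_coeff h = 1" "\<not> is_unit h"
      "h dvd word 3 ([v - v ^ 3] @ [v])" "degree h = k * 3 ^ length [v - v ^ 3]" "0 < k" "2 * k \<le> 3"
      by auto
    then have "k = 1" by simp
    then show ?thesis using that[OF *(1-3)] *(4) by simp
  qed
  define e q s where "e = - coeff h 0" and "q = coeff h 1" and "s = - coeff h 2"
  have h_eq: "h = [:- e, q, - s, 1:]"
    by (rule poly_eqI) (use h(1,4) in \<open>auto simp: e_def q_def s_def coeff_pCons coeff_eq_0
      eval_nat_numeral split: nat.splits\<close>)
  define f where "f = word 3 [v - v ^ 3] \<circ>\<^sub>p [:of_int v, 1:]"
  define H where "H = [:- (e ^ 3), q ^ 3 - 3 * q * s * e + 3 * e ^ 2, - (s ^ 3 - 3 * s * q + 3 * e), 1:]"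
  have x3: "monom (1 :: rat) 3 = [:0, 0, 0, 1:]" by (simp add: monom_altdef power3_eq_cube)
  have f_eq: "f = [:V, 3 * V ^ 2, 3 * V, 1:]"
    unfolding f_def word_simps
    by (simp add: unicritical_def x3 pcompose_pCons V_def[symmetric] power2_eq_square power3_eq_cube algebra_simps)
  have dvd_f: "h dvd f \<circ>\<^sub>p monom 1 3" using h(3) unfolding word_snoc f_def .
  have "H \<circ>\<^sub>p monom 1 3 = h * [:e ^ 2, e * q, q ^ 2 - s * e, s * q - 2 * e, s ^ 2 - q, s, 1:]"
    unfolding H_def h_eq x3
    by (simp add: pcompose_pCons power2_eq_square power3_eq_cube algebra_simps)
  then have "h dvd H \<circ>\<^sub>p monom 1 3" by (rule dvdI)
  moreover have "irreducible f" unfolding f_def using irr by (rule irreducible_shift)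
  moreover have "degree H = degree f" "lead_coeff f = lead_coeff H" by (simp_all add: f_eq H_def)
  ultimately have "f = H" using h(2) dvd_f by (intro unique_monic_norm)
  then have "V = - (e ^ 3)" "3 * V ^ 2 = q ^ 3 - 3 * q * s * e + 3 * e ^ 2"
    "3 * V = - (s ^ 3 - 3 * s * q + 3 * e)" unfolding f_eq H_def pCons_eq_iff by blast+
  note eqs = this[symmetric]
  have "of_int (- v) = e ^ 3" using eqs(1) by (simp add: V_def)
  then have "e ^ 3 = (- of_int y) ^ 3" using v by simp
  then have e: "e = - of_int y"
    by (rule odd_power_inject) simp
  have "9 * (s / 3) * ((s / 3) ^ 2 - q / 3) = of_int y - of_int y ^ 3"
    using eqs(3) by (simp add: e V_def v power2_eq_square power3_eq_cube field_simps)
  moreover have "9 * (q / 3) * ((q / 3) ^ 2 + (s / 3) * of_int y) = of_int y ^ 6 - of_int y ^ 2"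
    using eqs(2) by (simp add: e V_def v power2_eq_square power3_eq_cube eval_nat_numeral field_simps)
  ultimately show False using no_cubic_norm_relation y by fastforce
qed

section \<open>The dichotomy\<close>

definition has_stable_word :: "nat \<Rightarrow> int set \<Rightarrow> bool" where
  "has_stable_word d C \<longleftrightarrow> (\<exists>bs. bs \<noteq> [] \<and> set bs \<subseteq> C \<and> length bs \<le> 6 \<and>
    (\<forall>gs. set gs \<subseteq> C \<longrightarrow> irreducible (word d (bs @ gs))))"

lemma has_stable_word_if_never_power:
  assumes "d \<ge> 2" "bs \<noteq> []" "set bs \<subseteq> C" "length bs \<le> 6" "irreducible (word d bs)"
    and "\<And>t. \<not> has_prime_root d (eval_word d bs t)"
  shows "has_stable_word d C"
  unfolding has_stable_word_def using assms irreducible_word_extend[of d bs] by blast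

lemma has_stable_word_snoc:
  assumes "d \<ge> 2" "bs \<noteq> []" "set bs \<subseteq> C" "length bs \<le> 5" "b \<in> C" "irreducible (word d bs)"
    and pp: "\<And>t. \<not> has_prime_root d (eval_word d (bs @ [b]) t)"
  shows "has_stable_word d C"
proof (rule has_stable_word_if_never_power[of d "bs @ [b]"])
  have "\<not> has_prime_root d (eval_word d bs b)" using pp[of 0] assms(1) by (simp add: power_0_left)
  then show "irreducible (word d (bs @ [b]))"
    using irreducible_word_snoc assms by blast
qed (use assms in auto)

lemma has_stable_word_snoc2:
  assumes "d \<ge> 2" "bs \<noteq> []" "set bs \<subseteq> C" "length bs \<le> 4" "a \<in> C" "b \<in> C" "irreducible (word d bs)"
    and "\<not> has_prime_root d (eval_word d bs a)" "\<And>t. \<not> has_prime_root d (eval_word d (bs @ [a, b]) t)"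
  shows "has_stable_word d C"
proof (rule has_stable_word_snoc[of d "bs @ [a]"])
  show "irreducible (word d (bs @ [a]))"
    using irreducible_word_snoc assms by blast
  show "\<not> has_prime_root d (eval_word d ((bs @ [a]) @ [b]) t)" for t using assms(9)[of t] by simp
qed (use assms in auto)

lemma irreducible_word_replicate:
  assumes "d \<ge> 2" "irreducible (word d [c])"
    and pp: "\<And>n. \<not> has_prime_root d (eval_word d (replicate (Suc (Suc n)) c) 0)"
  shows "irreducible (word d (replicate (Suc n) c))"
proof (induction n)
  case 0
  show ?case using assms(2) by simp
next
  case (Suc n)
  have rep: "replicate (Suc (Suc n)) c = replicate (Suc n) c @ [c]"
    by (simp only: replicate_append_same replicate_Suc append.simps)
  have "eval_word d (replicate (Suc n) c @ [c]) 0 = eval_word d (replicate (Suc n) c) c"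
    using assms(1) by (simp only: eval_word_append) (simp add: power_0_left)
  then have "\<not> has_prime_root d (eval_word d (replicate (Suc n) c) c)"
    using pp[of n] unfolding rep by simp
  then show ?case
    unfolding rep using Suc assms(1) by (intro irreducible_word_snoc) auto
qed

lemma has_stable_word_singleton:
  assumes "d \<ge> 2" "irreducible (word d [c])" "c \<in> C" "C \<subseteq> {c}"
    and pp: "\<And>n. \<not> has_prime_root d (eval_word d (replicate (Suc (Suc n)) c) 0)"
  shows "has_stable_word d C"
  unfolding has_stable_word_def
proof (intro exI[of _ "[c]"] conjI allI impI)
  fix gs assume "set gs \<subseteq> C"
  then have "gs = replicate (length gs) c"
    using assms(4) by (intro replicate_eqI) auto
  then have "[c] @ gs = replicate (Suc (length gs)) c"
    by (metis append_Cons append_Nil replicate_Suc)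
  then show "irreducible (word d ([c] @ gs))"
    using irreducible_word_replicate[OF assms(1,2) pp] by metis
qed (use assms in auto)

lemma quadratic_iterates_not_square:
  assumes "\<not> has_prime_root 2 (- b)"
  shows "\<not> has_prime_root 2 (eval_word 2 (replicate (Suc (Suc n)) b) 0)"
proof (cases "b > 0")
  case True
  have "eval_word 2 (replicate (Suc (Suc n)) b) 0 = eval_word 2 [b, b] (eval_word 2 (replicate n b) 0)" by simp
  then show ?thesis using positive_iterate_not_square[OF True] by metis
next
  case False
  have "- b \<noteq> 0 ^ 2" "- b \<noteq> 1 ^ 2" using assms unfolding has_prime_root_2_iff by blast+
  then have "- b \<ge> 2" using False by simp
  then show ?thesis using iterates_not_square[of "- b" n] by simp
qed

text \<open>A generator that is not exceptional gives its fourth iterate. If all are exceptional, the generator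
\<open>c\<close> belongs to a fixed point or to a cycle of length two, and any other generator yields one of the
extensions above.\<close>

lemma quadratic_has_stable_word:
  assumes "c \<in> C" "irreducible (word 2 [c])"
  shows "has_stable_word 2 C"
proof (cases "\<exists>b\<in>C. \<not> exceptional (- b)")
  case True
  then obtain b where b: "b \<in> C" "\<not> exceptional (- b)" by blast
  then have npp: "\<not> has_prime_root 2 (- b)" by (auto simp: exceptional_def has_prime_root_2_iff)
  have "irreducible (word 2 (replicate (Suc 3) b))"
    by (rule irreducible_word_replicate)
      (use npp irreducible_quadratic quadratic_iterates_not_square in auto)
  then have "irreducible (word 2 [b, b, b, b])"
    unfolding numeral_3_eq_3 replicate_Suc replicate_0 .
  then show ?thesis
    using b fourth_iterate_not_square[OF b(2)]
    by (intro has_stable_word_if_never_power[of 2 "[b, b, b, b]"]) auto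
next
  case False
  then have exc: "exceptional (- b)" if "b \<in> C" for b using that by blast
  define m where "m = - c"
  have c: "c = - m" by (simp add: m_def)
  have npp: "\<not> has_prime_root 2 (- c)" using irreducible_unicritical_imp[OF _ assms(2)] by simp
  have irr: "irreducible (word 2 (replicate (Suc n) (- m)))" for n
    using irreducible_word_replicate[of 2 "- m"] assms(2) quadratic_iterates_not_square[OF npp] c by simp
  have irr2: "irreducible (word 2 [- m, - m])" and irr3: "irreducible (word 2 [- m, - m, - m])"
    and irr4: "irreducible (word 2 [- m, - m, - m, - m])"
    using irr[of 1] irr[of 2] irr[of 3]
    unfolding numeral_3_eq_3 numeral_2_eq_2 One_nat_def replicate_Suc replicate_0 by blast+
  have single: "has_stable_word 2 C" if "C \<subseteq> {c}"
    using has_stable_word_singleton[OF _ assms(2,1) that] quadratic_iterates_not_square[OF npp] by simp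
  have not_sq: "m \<noteq> z ^ 2" for z using npp by (auto simp: has_prime_root_2_iff m_def)
  have "exceptional m" using exc[OF assms(1)] by (simp add: m_def)
  then consider y where "m = (y ^ 2) ^ 2 - y ^ 2" | k where "m = (k ^ 2) ^ 2 + k ^ 2 + 1"
    using not_sq unfolding exceptional_def by blast
  then show ?thesis
  proof cases
    case 1
    have "y \<noteq> 0" "y \<noteq> 1" "y \<noteq> - 1" using not_sq[of 0] 1 by auto
    then have y: "\<bar>y\<bar> \<ge> 2" by linarith
    show ?thesis
    proof (cases "C \<subseteq> {c}")
      case False
      then obtain b where b: "b \<in> C" "b \<noteq> - m" using c by blast
      show ?thesis
      proof (cases "b = - (y ^ 2)")
        case True
        show ?thesis
        proof (rule has_stable_word_snoc[of 2 "[- m, - m, - (y ^ 2)]" _ "- m"])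
          show "irreducible (word 2 [- m, - m, - (y ^ 2)])"
            using irreducible_fixed_fixed_zero[OF y 1 irr2] .
          show "\<not> has_prime_root 2 (eval_word 2 ([- m, - m, - (y ^ 2)] @ [- m]) t)" for t
            using fixed_zero_fixed_not_square[OF y 1, of t] by simp
        qed (use b True assms(1) c in auto)
      next
        case False
        from fixed_point_case_extension[OF y 1 b(2) False exc[OF b(1)]]
        consider "\<not> has_prime_root 2 (eval_word 2 [- m, - m, - m, - m] b)"
            "\<And>t. \<not> has_prime_root 2 (eval_word 2 ([- m, - m, - m, - m] @ [b, b]) t)"
          | "\<not> has_prime_root 2 (eval_word 2 [- m, - m, - m, - m] b)"
            "\<And>t. \<not> has_prime_root 2 (eval_word 2 ([- m, - m, - m, - m] @ [b, - m]) t)" by blast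
        then show ?thesis
        proof cases
          case 1
          show ?thesis
            by (rule has_stable_word_snoc2[OF _ _ _ _ b(1) b(1) irr4 1]) (use assms(1) c in auto)
        next
          case 2
          show ?thesis
            by (rule has_stable_word_snoc2[OF _ _ _ _ b(1) _ irr4 2]) (use assms(1) c in auto)
        qed
      qed
    qed (rule single)
  next
    case 2
    have k: "k \<noteq> 0" using not_sq[of 1] 2 by auto
    show ?thesis
    proof (cases "C \<subseteq> {c}")
      case False
      then obtain b where b: "b \<in> C" "b \<noteq> - m" using c by blast
      from two_cycle_case_extension[OF k 2 b(2) exc[OF b(1)]]
      consider "\<not> has_prime_root 2 (eval_word 2 [- m, - m, - m] b)"
          "\<And>t. \<not> has_prime_root 2 (eval_word 2 ([- m, - m, - m] @ [b, b]) t)"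
        | "\<not> has_prime_root 2 (eval_word 2 [- m, - m, - m] b)"
          "\<And>t. \<not> has_prime_root 2 (eval_word 2 ([- m, - m, - m] @ [b, - m]) t)" by blast
      then show ?thesis
      proof cases
        case 1
        show ?thesis
          by (rule has_stable_word_snoc2[OF _ _ _ _ b(1) b(1) irr3 1]) (use assms(1) c in auto)
      next
        case 2
        show ?thesis
          by (rule has_stable_word_snoc2[OF _ _ _ _ b(1) _ irr3 2]) (use assms(1) c in auto)
      qed
    qed (rule single)
  qed
qed

lemma higher_degree_stable_or_listed:
  assumes d: "d \<ge> 3" and c: "c \<in> C" "irreducible (word d [c])" and ng: "\<not> has_stable_word d C"
  obtains v where "has_prime_root d v" "c = v - v ^ d" "c \<noteq> 0"
    "\<And>b. b \<in> C \<Longrightarrow> b ^ d = v ^ d \<or> (\<exists>w. w ^ d = v ^ d \<and> b = w - w ^ d)"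
proof -
  have d2: "d \<ge> 2" using d by simp
  have npp: "\<not> has_prime_root d (- c)" using irreducible_unicritical_imp[OF d2 c(2)] .
  have "has_prime_root d (0 :: int)"
    using d unfolding has_prime_root_def by (metis has_prime_root_1[OF d2, unfolded has_prime_root_def] prime_gt_0_nat power_eq_0_iff)
  then have c0: "c \<noteq> 0" using npp by auto
  have irr: "irreducible (word d (replicate (Suc n) c))" for n
    using irreducible_word_replicate[OF d2 c(2)] iterates_not_has_prime_root[OF d c0 npp] by blast
  have irr3: "irreducible (word d [c, c, c])"
    using irr[of 2] unfolding numeral_2_eq_2 One_nat_def replicate_Suc replicate_0 .
  have "\<exists>t. has_prime_root d (eval_word d [c, c, c] t)"
    using has_stable_word_if_never_power[OF d2 _ _ _ irr3, of C] ng c(1) by auto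
  then obtain t where "has_prime_root d (eval_word d [c, c, c] t)" ..
  note fp = third_iterate_power_imp_fixed_point[OF d c0 npp this]
  define v where "v = t ^ d + c"
  have v: "c = v - v ^ d" "has_prime_root d v" using fp by (simp_all add: v_def)
  show thesis
  proof (rule that[OF v(2,1) c0])
    fix b assume b: "b \<in> C"
    show "b ^ d = v ^ d \<or> (\<exists>w. w ^ d = v ^ d \<and> b = w - w ^ d)"
    proof (rule ccontr)
      assume off: "\<not> ?thesis"
      then have "\<not> has_prime_root d (eval_word d [c, c, c] b)"
        using third_iterate_power[of d v b] d v(1) c0 npp by auto
      moreover from never_power_extension_off_list[OF d v(1) c0 npp, of b] off
      have "(\<forall>t. \<not> has_prime_root d (eval_word d [c, c, c, b, b] t)) \<or> (\<forall>t. \<not> has_prime_root d (eval_word d [c, c, c, b, c] t))"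
        by blast
      ultimately consider "\<not> has_prime_root d (eval_word d [c, c, c] b)" "\<And>t. \<not> has_prime_root d (eval_word d ([c, c, c] @ [b, b]) t)"
        | "\<not> has_prime_root d (eval_word d [c, c, c] b)" "\<And>t. \<not> has_prime_root d (eval_word d ([c, c, c] @ [b, c]) t)"
        unfolding append.simps by blast
      then have "has_stable_word d C"
      proof cases
        case 1
        show ?thesis by (rule has_stable_word_snoc2[OF d2 _ _ _ b b irr3 1]) (use c(1) in auto)
      next
        case 2
        show ?thesis by (rule has_stable_word_snoc2[OF d2 _ _ _ b c(1) irr3 2]) (use c(1) in auto)
      qed
      then show False using ng by blast
    qed
  qed
qed

text \<open>For even \<open>d\<close> the solutions of \<open>w\<^sup>d = v\<^sup>d\<close> are \<open>v\<close> and \<open>-v\<close>, for odd \<open>d\<close> only \<open>v\<close>; this produces the two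
lists. The word used for \<open>d = 3\<close> is \<open>f\<^sub>c \<circ> f\<^sub>v \<circ> f\<^sub>c\<close>.\<close>

lemma higher_degree_alternatives:
  assumes d: "d \<ge> 3" and c: "c \<in> C" "irreducible (word d [c])"
  shows "has_stable_word d C
    \<or> (d \<ge> 4 \<and> even d \<and> (\<exists>(y::int) (p::nat). prime p \<and> p dvd d \<and>
          C \<subseteq> {y ^ p - y ^ (p * d), y ^ p, - (y ^ p), - (y ^ p) - y ^ (p * d)}))
    \<or> (d \<ge> 5 \<and> odd d \<and> (\<exists>(y::int) (p::nat). prime p \<and> p dvd d \<and> C = {y ^ p - y ^ (p * d), y ^ p}))"
proof (cases "has_stable_word d C")
  case False
  obtain v where v: "has_prime_root d v" "c = v - v ^ d" "c \<noteq> 0"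
    and list: "\<And>b. b \<in> C \<Longrightarrow> b ^ d = v ^ d \<or> (\<exists>w. w ^ d = v ^ d \<and> b = w - w ^ d)"
    using higher_degree_stable_or_listed[OF d c False] by blast
  have d2: "d \<ge> 2" using d by simp
  have npp: "\<not> has_prime_root d (- c)" using irreducible_unicritical_imp[OF d2 c(2)] .
  obtain p y where p: "prime p" "p dvd d" "v = y ^ p" using v(1) by (auto simp: has_prime_root_def)
  have vd: "v ^ d = y ^ (p * d)" by (simp add: p(3) power_mult)
  show ?thesis
  proof (cases "even d")
    case True
    have w: "w = v \<or> w = - v" if "w ^ d = v ^ d" for w
      using power_eq_imp_abs_eq[OF that] d by (auto simp: abs_eq_iff)
    have "b \<in> {y ^ p - y ^ (p * d), y ^ p, - (y ^ p), - (y ^ p) - y ^ (p * d)}" if "b \<in> C" for b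
    proof -
      have "b = v \<or> b = - v \<or> (\<exists>w. (w = v \<or> w = - v) \<and> b = w - v ^ d)"
        using list[OF that] w by metis
      then show ?thesis unfolding vd[symmetric] p(3)[symmetric] by auto
    qed
    moreover have "d \<ge> 4" using d True by (cases "d = 3") auto
    ultimately show ?thesis using True p(1,2) by blast
  next
    case False
    have w: "w = v" if "w ^ d = v ^ d" for w using odd_power_inject[OF that False] .
    then have sub: "C \<subseteq> {v - v ^ d, v}" using list by blast
    have "v \<in> C"
    proof (rule ccontr)
      assume "v \<notin> C"
      then have "C \<subseteq> {c}" using sub v(2) by blast
      then have "has_stable_word d C"
        using has_stable_word_singleton[OF d2 c(2,1)] iterates_not_has_prime_root[OF d v(3) npp] by blast
      then show False using \<open>\<not> has_stable_word d C\<close> by blast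
    qed
    then have C: "C = {y ^ p - y ^ (p * d), y ^ p}"
      using sub c(1) v(2) vd p(3) by auto
    have "d \<noteq> 3"
    proof
      assume d3: "d = 3"
      then have "p = 3" using p(1,2) primes_dvd_imp_eq[of p 3] by simp
      then have vy: "v = y ^ 3" using p(3) by simp
      have "y \<noteq> 0" "y \<noteq> 1" "y \<noteq> - 1" using v(2,3) vy d3 by auto
      then have y: "\<bar>y\<bar> \<ge> 2" by linarith
      then have "2 * \<bar>y\<bar> \<le> y ^ 2" by (intro mult_abs_le_square) auto
      then have "\<bar>y\<bar> ^ 3 \<ge> 2" using power_mono[of 2 "\<bar>y\<bar>" 3] y by simp
      then have v2: "\<bar>v\<bar> \<ge> 2" by (simp add: vy power_abs)
      have "has_stable_word d C"
      proof (rule has_stable_word_snoc[of d "[v - v ^ 3, v]" C "v - v ^ 3"])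
        show "irreducible (word d [v - v ^ 3, v])"
          using irreducible_cubic_fixed_zero[OF y vy] c(2) v(2) d3 by simp
        show "\<not> has_prime_root d (eval_word d ([v - v ^ 3, v] @ [v - v ^ 3]) t)" for t
          using fixed_zero_fixed_not_has_prime_root[OF d v2, of t] d3 by simp
      qed (use \<open>v \<in> C\<close> c(1) v(2) d3 in auto)
      then show False using \<open>\<not> has_stable_word d C\<close> by blast
    qed
    then have "d \<ge> 5" using d False by (cases "d = 4") auto
    then show ?thesis using False p(1,2) C by blast
  qed
qed simp

theorem theorem3p11:
  fixes d s :: nat and c :: "nat \<Rightarrow> int" and G :: "rat poly set"
  assumes "d \<ge> 2"
    and "G = comp_semigroup ((\<lambda>i. unicritical d (of_int (c i))) ` {1..s})"
    and "\<exists>F\<in>G. irreducible F"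
  shows "(\<exists>F\<in>G. comp_length d F \<le> 6 \<and> (\<forall>H\<in>{F \<circ>\<^sub>p g | g. g \<in> G}. irreducible H))
    \<or> (d \<ge> 4 \<and> even d \<and>
        (\<exists>(y::int) (p::nat). prime p \<and> p dvd d \<and>
          c ` {1..s} \<subseteq> {y ^ p - y ^ (p * d), y ^ p, - (y ^ p), - (y ^ p) - y ^ (p * d)}))
    \<or> (d \<ge> 5 \<and> odd d \<and>
        (\<exists>(y::int) (p::nat). prime p \<and> p dvd d \<and>
          c ` {1..s} = {y ^ p - y ^ (p * d), y ^ p}))"
proof -
  define C where "C = c ` {1..s}"
  have gens: "(\<lambda>i. unicritical d (of_int (c i))) ` {1..s} = (\<lambda>b. unicritical d (of_int b :: rat)) ` C"
    by (simp add: C_def image_image)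
  have G: "F \<in> G \<longleftrightarrow> (\<exists>bs. bs \<noteq> [] \<and> set bs \<subseteq> C \<and> F = word d bs)" for F
  proof
    assume "F \<in> G"
    then obtain fs where fs: "fs \<noteq> []" "F = compose_list fs"
      "set fs \<subseteq> (\<lambda>b. unicritical d (of_int b)) ` C"
      unfolding assms(2) gens comp_semigroup_def by blast
    then have "fs \<in> lists ((\<lambda>b. unicritical d (of_int b)) ` C)" by (simp add: in_lists_conv_set subset_iff)
    then obtain bs where "fs = map (\<lambda>b. unicritical d (of_int b)) bs" "bs \<in> lists C"
      unfolding lists_image by blast
    then show "\<exists>bs. bs \<noteq> [] \<and> set bs \<subseteq> C \<and> F = word d bs"
      using fs by (intro exI[of _ bs]) (auto simp: word_def)
  next
    assume "\<exists>bs. bs \<noteq> [] \<and> set bs \<subseteq> C \<and> F = word d bs"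
    then obtain bs where "bs \<noteq> []" "set bs \<subseteq> C" "F = word d bs" by blast
    then show "F \<in> G"
      unfolding assms(2) gens comp_semigroup_def word_def
      by (intro CollectI exI[of _ "map (\<lambda>b. unicritical d (of_int b)) bs"]) auto
  qed
  obtain b bs where "set (b # bs) \<subseteq> C" "irreducible (word d (b # bs))"
    using assms(3) G by (metis list.exhaust)
  then have b: "b \<in> C" "irreducible (word d [b])"
    using irreducible_word_ConsD[OF assms(1)] by auto
  have from_has_stable_word: "\<exists>F\<in>G. comp_length d F \<le> 6 \<and> (\<forall>H\<in>{F \<circ>\<^sub>p g | g. g \<in> G}. irreducible H)"
    if "has_stable_word d C"
  proof -
    obtain as where as: "as \<noteq> []" "set as \<subseteq> C" "length as \<le> 6"
      "\<And>gs. set gs \<subseteq> C \<Longrightarrow> irreducible (word d (as @ gs))"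
      using \<open>has_stable_word d C\<close> unfolding has_stable_word_def by blast
    have "comp_length d (word d as) = length as"
      using comp_length_compose_list[OF assms(1), of "map of_int as"] as(1)
      by (simp add: word_def comp_def)
    moreover have "word d as \<in> G" using as G by blast
    moreover have "irreducible (word d as \<circ>\<^sub>p g)" if "g \<in> G" for g
      using that as(4) unfolding G by (auto simp: word_append [symmetric])
    ultimately show ?thesis using as(3) by (intro bexI[of _ "word d as"]) auto
  qed
  show ?thesis
  proof (cases "d = 2")
    case True
    then show ?thesis using quadratic_has_stable_word b from_has_stable_word by blast
  next
    case False
    then have "d \<ge> 3" using assms(1) by simp
    from higher_degree_alternatives[OF this b] from_has_stable_word show ?thesis
      unfolding C_def by blast
  qed
qed

end
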